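(* Let $m,n\ge 1$ be integers and let $\mathcal{A}$ be a configuration of type $(m,1^n)$ in $\mathbb{C}^2$. Then $\mathcal{A}$ admits the Baker-Akhiezer function if and only if $\mathcal{A}$ is equivalent to the configuration $\mathcal{A}_{(m,1^n)}$.
   Context: A configuration $\mathcal{A}=(A,m)$ is a finite set $A$ of pairwise non-collinear vectors $\alpha_0,\dots,\alpha_n\in\mathbb{C}^2$ with multiplicities $m_i=m(\alpha_i)\in\mathbb{N}$. Here $(u,v)=u_1v_1+u_2v_2$ is the standard (complex bilinear) inner product, and all vectors are assumed non-isotropic: $(\alpha_i,\alpha_i)\neq 0$. The configuration has type $(m,1^n)$ if it consists of $n+1$ pairwise non-collinear vectors $\alpha_0,\dots,\alpha_n$ with $m_0=m$ and $m_i=1$ for $1\le i\le n$. Baker-Akhiezer (BA) function: a function $\phi(\lambda,x)$, $\lambda,x\in\mathbb{C}^2$, such that (1) $\phi(\lambda,x)=P(\lambda,x)e^{(\lambda,x)}$ where $P$ is a polynomial in $\lambda$ and $x$ with highest term $\prod_{i}(\alpha_i,\lambda)^{m_i}(\alpha_i,x)^{m_i}$; (2) for all $i$ and all $1\le s\le m_i$, $\partial_{\alpha_i}^{2s-1}\phi(\lambda,x)|_{\Pi_i}=0$, where $\Pi_i=\{x:(\alpha_i,x)=0\}$ and $\partial_{\alpha_i}=(\alpha_i,\frac{\partial}{\partial x})$. The configuration admits the BA function if such $\phi$ exists. Two configurations are equivalent if one is obtained from the other by applying an orthogonal transformation of $\mathbb{C}^2$ (preserving $(\cdot,\cdot)$)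 and multiplying the vectors by non-zero scalars, keeping multiplicities. The configuration $\mathcal{A}_{(m,1^n)}$: vectors $\alpha_s=(\cos\varphi_s,\sin\varphi_s)$, $0\le s\le n$, with $\alpha_0=(1,0)$, $m_0=m$, $m_i=1$ for $1\le i\le n$, such that, with $z_s=e^{2i\varphi_s}$, the elementary symmetric polynomials $e_k=e_k(z_1,\dots,z_n)$ have the values $e_k=(-1)^k\binom{n}{k}\binom{m+k-1}{k}\binom{m+n-1}{k}^{-1}$ for $1\le k\le n$. *)

theory Defs
  imports "HOL-Analysis.Analysis"
begin

text \<open>
  The standard complex bilinear product on \<open>\<complex>\<^sup>2\<close>. The library product \<open>\<bullet>\<close> on \<^typ>\<open>complex^2\<close>
  is the real inner product and is not what is meant here.
\<close>

definition cbil :: "complex^2 \<Rightarrow> complex^2 \<Rightarrow> complex" where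
  "cbil u v = u $ 1 * v $ 1 + u $ 2 * v $ 2"

definition proportional :: "complex^2 \<Rightarrow> complex^2 \<Rightarrow> bool" where
  "proportional u v \<longleftrightarrow> (\<exists>c. u = c *s v \<or> v = c *s u)"

text \<open>
  A configuration \<open>(A, \<mu>)\<close> is a set of vectors with a multiplicity function; the values of \<open>\<mu>\<close>
  outside \<open>A\<close> are irrelevant.
\<close>

definition configuration :: "(complex^2) set \<Rightarrow> (complex^2 \<Rightarrow> nat) \<Rightarrow> bool" where
  "configuration A \<mu> \<longleftrightarrow>
     finite A \<and>
     pairwise (\<lambda>u v. \<not> proportional u v) A \<and>
     (\<forall>\<alpha>\<in>A. cbil \<alpha> \<alpha> \<noteq> 0 \<and> 0 < \<mu> \<alpha>)"

definition configuration_of_type ::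
    "nat \<Rightarrow> nat \<Rightarrow> (complex^2) set \<Rightarrow> (complex^2 \<Rightarrow> nat) \<Rightarrow> bool" where
  "configuration_of_type m n A \<mu> \<longleftrightarrow>
     configuration A \<mu> \<and> card A = n + 1 \<and>
     (\<exists>\<alpha>\<^sub>0\<in>A. \<mu> \<alpha>\<^sub>0 = m \<and> (\<forall>\<alpha>\<in>A - {\<alpha>\<^sub>0}. \<mu> \<alpha> = 1))"

text \<open>
  \<open>P\<close> is a polynomial in the four variables \<open>l\<^sub>1, l\<^sub>2, x\<^sub>1, x\<^sub>2\<close>, and \<open>H\<close> is its
  non-zero homogeneous component of highest total degree \<open>d\<close>; \<open>c i j p q\<close> is the coefficient of
  \<open>l\<^sub>1\<^sup>i l\<^sub>2\<^sup>j x\<^sub>1\<^sup>p x\<^sub>2\<^sup>q\<close>.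
\<close>

definition polynomial_with_highest_term ::
    "(complex^2 \<Rightarrow> complex^2 \<Rightarrow> complex) \<Rightarrow> (complex^2 \<Rightarrow> complex^2 \<Rightarrow> complex) \<Rightarrow> bool" where
  "polynomial_with_highest_term P H \<longleftrightarrow>
     (\<exists>l x. H l x \<noteq> 0) \<and>
     (\<exists>(d::nat) (c :: nat \<Rightarrow> nat \<Rightarrow> nat \<Rightarrow> nat \<Rightarrow> complex).
        (\<forall>l x. P l x = (\<Sum>(i, j, p, q) \<in> {(i, j, p, q). i + j + p + q \<le> d}.
                 c i j p q * (l $ 1) ^ i * (l $ 2) ^ j * (x $ 1) ^ p * (x $ 2) ^ q)) \<and>
        (\<forall>l x. H l x = (\<Sum>(i, j, p, q) \<in> {(i, j, p, q). i + j + p + q = d}.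
                 c i j p q * (l $ 1) ^ i * (l $ 2) ^ j * (x $ 1) ^ p * (x $ 2) ^ q)))"

lemma finite_exponents_le: "finite {(i, j, p, q). i + j + p + q \<le> (d::nat)}"
  by (rule finite_subset[of _ "{..d} \<times> {..d} \<times> {..d} \<times> {..d}"]) auto

lemma finite_exponents_eq: "finite {(i, j, p, q). i + j + p + q = (d::nat)}"
  by (rule finite_subset[OF _ finite_exponents_le[of d]]) auto

definition cgradient :: "(complex^2 \<Rightarrow> complex) \<Rightarrow> complex^2 \<Rightarrow> complex^2" where
  "cgradient f x = (\<chi> i. deriv (\<lambda>t::complex. f (x + t *s axis i 1)) 0)"

definition dir_deriv :: "complex^2 \<Rightarrow> (complex^2 \<Rightarrow> complex) \<Rightarrow> complex^2 \<Rightarrow> complex" where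
  "dir_deriv \<alpha> f = (\<lambda>x. cbil \<alpha> (cgradient f x))"

definition BA_function ::
    "(complex^2) set \<Rightarrow> (complex^2 \<Rightarrow> nat) \<Rightarrow> (complex^2 \<Rightarrow> complex^2 \<Rightarrow> complex) \<Rightarrow> bool" where
  "BA_function A \<mu> \<phi> \<longleftrightarrow>
     (\<exists>P. polynomial_with_highest_term P
            (\<lambda>l x. \<Prod>\<alpha>\<in>A. cbil \<alpha> l ^ \<mu> \<alpha> * cbil \<alpha> x ^ \<mu> \<alpha>) \<and>
          (\<forall>l x. \<phi> l x = P l x * exp (cbil l x))) \<and>
     (\<forall>\<alpha>\<in>A. \<forall>s\<in>{1..\<mu> \<alpha>}. \<forall>l x. cbil \<alpha> x = 0 \<longrightarrow>
          (dir_deriv \<alpha> ^^ (2 * s - 1)) (\<phi> l) x = 0)"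

definition admits_BA :: "(complex^2) set \<Rightarrow> (complex^2 \<Rightarrow> nat) \<Rightarrow> bool" where
  "admits_BA A \<mu> \<longleftrightarrow> (\<exists>\<phi>. BA_function A \<mu> \<phi>)"

definition equivalent_configurations ::
    "(complex^2) set \<Rightarrow> (complex^2 \<Rightarrow> nat) \<Rightarrow> (complex^2) set \<Rightarrow> (complex^2 \<Rightarrow> nat) \<Rightarrow> bool" where
  "equivalent_configurations A \<mu> B \<nu> \<longleftrightarrow>
     (\<exists>(T :: complex^2^2) (r :: complex^2 \<Rightarrow> complex).
        orthogonal_matrix T \<and> (\<forall>\<alpha>\<in>A. r \<alpha> \<noteq> 0) \<and>
        bij_betw (\<lambda>\<alpha>. r \<alpha> *s (T *v \<alpha>)) A B \<and>
        (\<forall>\<alpha>\<in>A. \<nu> (r \<alpha> *s (T *v \<alpha>)) = \<mu> \<alpha>))"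

definition elem_sym :: "nat \<Rightarrow> nat \<Rightarrow> (nat \<Rightarrow> complex) \<Rightarrow> complex" where
  "elem_sym n k z = (\<Sum>I | I \<subseteq> {1..n} \<and> card I = k. \<Prod>i\<in>I. z i)"

definition unit_vec :: "complex \<Rightarrow> complex^2" where
  "unit_vec \<theta> = vector [cos \<theta>, sin \<theta>]"

text \<open>
  The configuration \<open>\<A>\<^bsub>(m,1\<^sup>n)\<^esub>\<close>. The prescribed values \<open>e\<^sub>k\<close> determine \<open>z\<^sub>1, \<dots>, z\<^sub>n\<close> only up to
  order, and each \<open>z\<^sub>s = exp (2 \<i> \<theta>\<^sub>s)\<close> determines its vector only up to sign; the predicate
  holds for every such choice. The angles are complex.
\<close>

definition is_A_m1n ::
    "nat \<Rightarrow> nat \<Rightarrow> (complex^2) set \<Rightarrow> (complex^2 \<Rightarrow> nat) \<Rightarrow> bool" where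
  "is_A_m1n m n B \<nu> \<longleftrightarrow>
     configuration_of_type m n B \<nu> \<and>
     (\<exists>\<theta> :: nat \<Rightarrow> complex.
        unit_vec (\<theta> 0) = vector [1, 0] \<and>
        B = (\<lambda>s. unit_vec (\<theta> s)) ` {0..n} \<and>
        \<nu> (unit_vec (\<theta> 0)) = m \<and>
        (\<forall>s\<in>{1..n}. \<nu> (unit_vec (\<theta> s)) = 1) \<and>
        (\<forall>k\<in>{1..n}. elem_sym n k (\<lambda>s. exp (2 * \<i> * \<theta> s)) =
           (-1) ^ k * of_nat (n choose k) * of_nat ((m + k - 1) choose k)
             / of_nat ((m + n - 1) choose k)))"

end

theory Submission
  imports Defs "HOL-Computational_Algebra.Polynomial_FPS"
begin

text \<open>
  A function \<open>P(l, x) exp (l, x)\<close> satisfies the Baker--Akhiezer conditions on the line orthogonal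
  to \<open>\<alpha>\<close> if the first \<open>\<mu> \<alpha>\<close> odd Taylor coefficients in the direction of \<open>\<alpha>\<close> vanish there.
  With \<open>A(x) = \<Prod>\<^sub>\<gamma> (\<gamma>, x)\<^bsup>\<mu> \<gamma>\<^esup>\<close>, the operator
  \<open>L = \<Delta> - \<Sum>\<^sub>\<gamma> 2 \<mu> \<gamma> (\<gamma>, x)\<^sup>-\<^sup>1 \<partial>\<^sub>\<gamma>\<close> preserves these conditions as soon as the odd power sums
  \<open>\<Sum>\<^sub>\<gamma> \<mu> \<gamma> cot\<^bsup>2 s - 1\<^esup> \<angle>(\<gamma>, \<alpha>)\<close>, \<open>s \<le> \<mu> \<alpha>\<close>, vanish, and then, \<open>N\<close> being the degree of \<open>A\<close>,
  \<open>(L - (l, l))\<^sup>N (A(x)\<^sup>2 exp (l, x))\<close> is a multiple of the Baker--Akhiezer function (Berest, Chalykh).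

  Conversely, let \<open>\<alpha>\<close> have multiplicity one and restrict the Baker--Akhiezer function to
  \<open>l = \<theta> \<beta>\<close> with \<open>\<beta> \<perp> \<alpha>\<close>. The top coefficient in \<open>\<theta>\<close> of its part of weight zero has degree
  \<open>N - 1\<close> and vanishes to order \<open>\<mu> \<gamma>\<close> on every other line, so it is a multiple of \<open>A(x) / (\<alpha>, x)\<close>; since its
  normal derivative vanishes on the line of \<open>\<alpha>\<close>, the first of the cotangent sums is zero.

  For type \<open>(m, 1\<^sup>n)\<close> these equations for \<open>\<alpha>\<^sub>1, \<dots>, \<alpha>\<^sub>n\<close>, written in \<open>z\<^sub>s = exp (2 i \<phi>\<^sub>s)\<close>, say
  that \<open>\<Prod>\<^sub>s (z - z\<^sub>s)\<close> solves a hypergeometric equation, which determines its coefficients. The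
  solution is palindromic, so the configuration is symmetric about \<open>\<alpha>\<^sub>0\<close>, and the odd power sums
  for \<open>\<alpha>\<^sub>0\<close> vanish as well.
\<close>


subsection \<open>Polynomial functions of the spectral and space variables\<close>

text \<open>The operator L has poles along the lines, so it never appears as an operator on rational
  functions: quasi-invariance makes \<open>tderiv \<alpha> F\<close> vanish on the line of \<alpha>,
  and its polynomial quotient by \<open>cbil \<alpha> x\<close> stands for the singular term.
  Conjugating by exp (l, x) keeps everything inside polynomial functions of (l, x).

  The highest term is defined by total degree in l and x, and L - (l, l) does not raise that degree:
  multiplication by (l, l) is removed, and a derivative along l exchanges a power of x for one of l.
  Conversely, the lower components of a given \<open>P\<close> need not be homogeneous in l and x
  separately. The rescaling (\<tau> l, x / \<tau>) fixes the exponential and the lines, and thereby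
  isolates the components of equal degree in l and x.

  The two directions meet in different conditions: the construction uses all odd cotangent sums,
  while the converse extracts only the first sum on lines of multiplicity one. The gap closes
  because these n equations already determine the n unknown coefficients of the monic polynomial
  with roots \<open>z i\<close>.\<close>

definition monom4 :: "nat \<times> nat \<times> nat \<times> nat \<Rightarrow> complex^2 \<Rightarrow> complex^2 \<Rightarrow> complex" where
  "monom4 = (\<lambda>(i, j, p, q) l x. l $ 1 ^ i * l $ 2 ^ j * x $ 1 ^ p * x $ 2 ^ q)"

definition total :: "nat \<times> nat \<times> nat \<times> nat \<Rightarrow> nat" where
  "total = (\<lambda>(i, j, p, q). i + j + p + q)"

text \<open>Polynomials are kept as functions, together with a set of admissible exponents: degree
  bounds and homogeneity are two choices of this set, and closure properties follow by adding one
  monomial at a time.\<close>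

inductive polyfun ::
    "(nat \<times> nat \<times> nat \<times> nat) set \<Rightarrow> (complex^2 \<Rightarrow> complex^2 \<Rightarrow> complex) \<Rightarrow> bool"
  for S where
  zero: "polyfun S (\<lambda>l x. 0)"
| add_monom: "polyfun S F \<Longrightarrow> e \<in> S \<Longrightarrow> polyfun S (\<lambda>l x. F l x + c * monom4 e l x)"

abbreviation polyfun_le :: "nat \<Rightarrow> (complex^2 \<Rightarrow> complex^2 \<Rightarrow> complex) \<Rightarrow> bool" where
  "polyfun_le d \<equiv> polyfun {e. total e \<le> d}"

abbreviation polyfun_hom :: "nat \<Rightarrow> (complex^2 \<Rightarrow> complex^2 \<Rightarrow> complex) \<Rightarrow> bool" where
  "polyfun_hom d \<equiv> polyfun {e. total e = d}"

lemma polyfun_cong: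
  assumes "polyfun S F" "\<And>l x. F l x = G l x"
  shows "polyfun S G"
  using assms by (metis ext)

lemma polyfun_mono: "polyfun S F \<Longrightarrow> S \<subseteq> T \<Longrightarrow> polyfun T F"
  by (induction rule: polyfun.induct) (auto intro: polyfun.intros)

lemma polyfun_le_mono: "polyfun_le d F \<Longrightarrow> d \<le> e \<Longrightarrow> polyfun_le e F"
  by (erule polyfun_mono) auto

lemma polyfun_monom: "e \<in> S \<Longrightarrow> polyfun S (\<lambda>l x. c * monom4 e l x)"
  using polyfun.add_monom[OF polyfun.zero, of e S c] by simp

lemma polyfun_add:
  assumes "polyfun S F" "polyfun S G"
  shows "polyfun S (\<lambda>l x. F l x + G l x)"
  using assms(2)
proof (induction rule: polyfun.induct)
  case zero
  then show ?case using assms(1) by simp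
next
  case (add_monom G e c)
  then show ?case
    using polyfun.add_monom[of S "\<lambda>l x. F l x + G l x" e c] by (simp add: add.assoc)
qed

lemma polyfun_cmult: "polyfun S F \<Longrightarrow> polyfun S (\<lambda>l x. c * F l x)"
proof (induction rule: polyfun.induct)
  case zero
  then show ?case by (simp add: polyfun.zero)
next
  case (add_monom F e k)
  then show ?case
    using polyfun.add_monom[of S "\<lambda>l x. c * F l x" e "c * k"] by (simp add: algebra_simps)
qed

lemma polyfun_diff:
  assumes "polyfun S F" "polyfun S G"
  shows "polyfun S (\<lambda>l x. F l x - G l x)"
  using polyfun_add[OF assms(1) polyfun_cmult[OF assms(2), of "-1"]] by simp

lemma polyfun_sum:
  assumes "\<And>i. i \<in> I \<Longrightarrow> polyfun S (F i)"
  shows "polyfun S (\<lambda>l x. \<Sum>i\<in>I. F i l x)"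
  using assms
proof (induction I rule: infinite_finite_induct)
  case (insert i I)
  then show ?case by (simp add: polyfun_add)
qed (auto simp: polyfun.zero)

lemma monom4_mult: "monom4 e l x * monom4 f l x = monom4 (e + f) l x"
  by (cases e; cases f) (simp add: monom4_def power_add algebra_simps)

lemma total_plus: "total (e + f) = total e + total f"
  by (cases e; cases f) (simp add: total_def)

lemma polyfun_mult:
  assumes F: "polyfun S F" and G: "polyfun T G" and U: "\<And>e f. e \<in> S \<Longrightarrow> f \<in> T \<Longrightarrow> e + f \<in> U"
  shows "polyfun U (\<lambda>l x. F l x * G l x)"
  using F
proof (induction rule: polyfun.induct)
  case zero
  then show ?case by (simp add: polyfun.zero)
next
  case (add_monom F e c)
  have "polyfun U (\<lambda>l x. c * monom4 e l x * G l x)"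
    using G
  proof (induction rule: polyfun.induct)
    case zero
    then show ?case by (simp add: polyfun.zero)
  next
    case (add_monom G f k)
    have "polyfun U (\<lambda>l x. c * monom4 e l x * G l x + (c * k) * monom4 (e + f) l x)"
      using add_monom \<open>e \<in> S\<close> U by (intro polyfun.add_monom) auto
    then show ?case
      by (rule polyfun_cong) (simp add: monom4_mult[symmetric] algebra_simps)
  qed
  from polyfun_add[OF add_monom.IH this] show ?case
    by (rule polyfun_cong) (simp add: algebra_simps)
qed

lemma polyfun_le_mult:
  assumes "polyfun_le d F" "polyfun_le e G"
  shows "polyfun_le (d + e) (\<lambda>l x. F l x * G l x)"
  using assms by (rule polyfun_mult) (auto simp: total_plus)

lemma polyfun_hom_mult:
  assumes "polyfun_hom d F" "polyfun_hom e G"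
  shows "polyfun_hom (d + e) (\<lambda>l x. F l x * G l x)"
  using assms by (rule polyfun_mult) (auto simp: total_plus)

lemma polyfun_hom_const: "polyfun_hom 0 (\<lambda>l x. c)"
  using polyfun_monom[of "(0,0,0,0)" "{e. total e = 0}" c] by (simp add: monom4_def total_def)

lemma polyfun_hom_imp_le: "polyfun_hom d F \<Longrightarrow> polyfun_le d F"
  by (erule polyfun_mono) auto

lemma polyfun_le_const: "polyfun_le d (\<lambda>l x. c)"
  by (rule polyfun_mono[OF polyfun_hom_const]) auto

lemma polyfun_hom_linear_x: "polyfun_hom 1 (\<lambda>l x. cbil a x)"
proof -
  have "polyfun_hom 1 (\<lambda>l x. a$1 * monom4 (0,0,1,0) l x + a$2 * monom4 (0,0,0,1) l x)"
    by (intro polyfun_add polyfun_monom) (auto simp: total_def)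
  then show ?thesis by (rule polyfun_cong) (simp add: monom4_def cbil_def)
qed

lemma polyfun_hom_linear_l: "polyfun_hom 1 (\<lambda>l x. cbil a l)"
proof -
  have "polyfun_hom 1 (\<lambda>l x. a$1 * monom4 (1,0,0,0) l x + a$2 * monom4 (0,1,0,0) l x)"
    by (intro polyfun_add polyfun_monom) (auto simp: total_def)
  then show ?thesis by (rule polyfun_cong) (simp add: monom4_def cbil_def)
qed

lemma polyfun_le_linear_mult_l:
  "polyfun_le d F \<Longrightarrow> polyfun_le (Suc d) (\<lambda>l x. cbil a l * F l x)"
  using polyfun_le_mult[OF polyfun_hom_imp_le[OF polyfun_hom_linear_l]] by simp

lemma polyfun_hom_power:
  assumes "polyfun_hom d F"
  shows "polyfun_hom (k * d) (\<lambda>l x. F l x ^ k)"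
proof (induction k)
  case 0
  then show ?case using polyfun_hom_const by simp
next
  case (Suc k)
  show ?case using polyfun_hom_mult[OF assms Suc] by simp
qed

lemma polyfun_hom_prod:
  assumes "finite I" "\<And>i. i \<in> I \<Longrightarrow> polyfun_hom (d i) (F i)"
  shows "polyfun_hom (\<Sum>i\<in>I. d i) (\<lambda>l x. \<Prod>i\<in>I. F i l x)"
  using assms
proof (induction I rule: finite_induct)
  case empty
  then show ?case using polyfun_hom_const by simp
next
  case (insert i I)
  then show ?case by (simp add: polyfun_hom_mult)
qed

lemma polyfun_sum_iff:
  assumes "finite S"
  shows "polyfun S F \<longleftrightarrow> (\<exists>c. \<forall>l x. F l x = (\<Sum>e\<in>S. c e * monom4 e l x))"
proof
  assume "polyfun S F"
  then show "\<exists>c. \<forall>l x. F l x = (\<Sum>e\<in>S. c e * monom4 e l x)"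
  proof (induction rule: polyfun.induct)
    case zero
    show ?case by (rule exI[of _ "\<lambda>e. 0"]) simp
  next
    case (add_monom F e k)
    then obtain c where c: "\<And>l x. F l x = (\<Sum>e\<in>S. c e * monom4 e l x)" by blast
    have "F l x + k * monom4 e l x = (\<Sum>f\<in>S. (c f + (if f = e then k else 0)) * monom4 f l x)" for l x
    proof -
      have "(\<Sum>f\<in>S. (if f = e then k else 0) * monom4 f l x) = (\<Sum>f\<in>S. if f = e then k * monom4 e l x else 0)"
        by (rule sum.cong) auto
      also have "\<dots> = k * monom4 e l x" using assms add_monom by simp
      finally show ?thesis by (simp add: c algebra_simps sum.distrib)
    qed
    then show ?case by (intro exI[of _ "\<lambda>f. c f + (if f = e then k else 0)"] allI)
  qed
next
  assume "\<exists>c. \<forall>l x. F l x = (\<Sum>e\<in>S. c e * monom4 e l x)"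
  then obtain c where c: "\<And>l x. F l x = (\<Sum>e\<in>S. c e * monom4 e l x)" by blast
  have "polyfun S (\<lambda>l x. \<Sum>e\<in>S. c e * monom4 e l x)"
    by (intro polyfun_sum polyfun_monom)
  then show "polyfun S F" by (rule polyfun_cong) (simp add: c)
qed

lemma finite_total: "finite {e. total e \<le> d}" "finite {e. total e = d}"
  using finite_exponents_le[of d] finite_exponents_eq[of d]
  by (simp_all add: total_def case_prod_unfold)

lemma polynomial_with_highest_term_iff:
  "polynomial_with_highest_term P H \<longleftrightarrow>
     (\<exists>l x. H l x \<noteq> 0) \<and>
     (\<exists>d c. (\<forall>l x. P l x = (\<Sum>e | total e \<le> d. c e * monom4 e l x)) \<and>
            (\<forall>l x. H l x = (\<Sum>e | total e = d. c e * monom4 e l x)))"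
  (is "?L = ?R")
proof
  assume ?L
  then obtain d c where *: "\<exists>l x. H l x \<noteq> 0"
    "\<And>l x. P l x = (\<Sum>(i, j, p, q) \<in> {(i, j, p, q). i + j + p + q \<le> d}.
                 c i j p q * (l $ 1) ^ i * (l $ 2) ^ j * (x $ 1) ^ p * (x $ 2) ^ q)"
    "\<And>l x. H l x = (\<Sum>(i, j, p, q) \<in> {(i, j, p, q). i + j + p + q = d}.
                 c i j p q * (l $ 1) ^ i * (l $ 2) ^ j * (x $ 1) ^ p * (x $ 2) ^ q)"
    unfolding polynomial_with_highest_term_def by blast
  show ?R
    by (intro conjI *(1) exI[of _ d] exI[of _ "\<lambda>(i,j,p,q). c i j p q"])
      (auto simp: * total_def monom4_def case_prod_unfold intro!: sum.cong)
next
  assume ?R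
  then obtain d c where *: "\<exists>l x. H l x \<noteq> 0"
    "\<And>l x. P l x = (\<Sum>e | total e \<le> d. c e * monom4 e l x)"
    "\<And>l x. H l x = (\<Sum>e | total e = d. c e * monom4 e l x)" by blast
  show ?L
    unfolding polynomial_with_highest_term_def
    by (intro conjI *(1) exI[of _ d] exI[of _ "\<lambda>i j p q. c (i,j,p,q)"])
      (auto simp: * total_def monom4_def case_prod_unfold intro!: sum.cong)
qed

text \<open>The definition asks for one coefficient family that serves both \<open>P\<close> and
  \<open>H\<close>. The exponents of \<open>H\<close> and of the remainder are separated by total
  degree, so their two families can be glued.\<close>

lemma polynomial_with_highest_termI:
  assumes "H l x \<noteq> 0" and H: "polyfun_hom (Suc d) H" and R: "polyfun_le d (\<lambda>l x. P l x - H l x)"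
  shows "polynomial_with_highest_term P H"
proof -
  obtain c where c: "\<And>l x. H l x = (\<Sum>e | total e = Suc d. c e * monom4 e l x)"
    using H by (auto simp: polyfun_sum_iff finite_total)
  obtain b where b: "\<And>l x. P l x - H l x = (\<Sum>e | total e \<le> d. b e * monom4 e l x)"
    using R by (auto simp: polyfun_sum_iff finite_total)
  define k where "k = (\<lambda>e. if total e = Suc d then c e else b e)"
  have "{e. total e \<le> Suc d} = {e. total e = Suc d} \<union> {e. total e \<le> d}" by auto
  moreover have "{e. total e = Suc d} \<inter> {e. total e \<le> d} = {}" by auto
  ultimately have "(\<Sum>e | total e \<le> Suc d. k e * monom4 e l x) =
      (\<Sum>e | total e = Suc d. k e * monom4 e l x) + (\<Sum>e | total e \<le> d. k e * monom4 e l x)" for l x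
    by (simp add: sum.union_disjoint finite_total)
  also have "\<dots> l x = H l x + (P l x - H l x)" for l x
    unfolding b unfolding c
    by (intro arg_cong2[where f = "(+)"] sum.cong) (auto simp: k_def)
  finally have "P l x = (\<Sum>e | total e \<le> Suc d. k e * monom4 e l x)" for l x by simp
  moreover have "H l x = (\<Sum>e | total e = Suc d. k e * monom4 e l x)" for l x
    unfolding c by (intro sum.cong) (auto simp: k_def)
  ultimately show ?thesis
    unfolding polynomial_with_highest_term_iff using assms(1) by blast
qed

subsection \<open>Derivatives and restrictions to lines\<close>

lemma cbil_commute: "cbil u v = cbil v u"
  by (simp add: cbil_def)

lemma cbil_add_right: "cbil u (v + w) = cbil u v + cbil u w"
  and cbil_add_left: "cbil (v + w) u = cbil v u + cbil w u"
  and cbil_smult_right: "cbil u (c *s v) = c * cbil u v"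
  and cbil_smult_left: "cbil (c *s v) u = c * cbil v u"
  and cbil_diff_right: "cbil u (v - w) = cbil u v - cbil u w"
  by (simp_all add: cbil_def algebra_simps)

lemmas cbil_simps = cbil_add_right cbil_add_left cbil_smult_right cbil_smult_left cbil_diff_right

lemma bounded_linear_smult_vec: "bounded_linear (\<lambda>t::complex. t *s (v :: complex^2))"
proof -
  have "linear (\<lambda>t::complex. t *s v)"
    by (rule linearI) (auto simp: vec_eq_iff algebra_simps)
  then show ?thesis by (simp add: linear_conv_bounded_linear)
qed

text \<open>Derivatives on \<open>complex^2\<close> are only real linear in general, but one of the
  form \<open>cbil g\<close> is complex linear, so the restriction to a complex line is
  holomorphic.\<close>

lemma has_field_derivative_line:
  assumes "(f has_derivative (\<lambda>h. cbil g h)) (at (y + t *s \<alpha>))"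
  shows "((\<lambda>t. f (y + t *s \<alpha>)) has_field_derivative cbil \<alpha> g) (at t)"
proof -
  have "((\<lambda>t::complex. y + t *s \<alpha>) has_derivative (\<lambda>t. t *s \<alpha>)) (at t)"
    by (auto intro!: derivative_eq_intros bounded_linear.has_derivative[OF bounded_linear_smult_vec])
  from has_derivative_compose[OF this assms]
  moreover have "(\<lambda>t. cbil g (t *s \<alpha>)) = (*) (cbil \<alpha> g)"
    by (simp add: fun_eq_iff cbil_def algebra_simps)
  ultimately show ?thesis by (simp add: has_field_derivative_def)
qed

lemma cgradient_eqI:
  assumes "(f has_derivative (\<lambda>h. cbil g h)) (at x)"
  shows "cgradient f x = g"
proof -
  have "deriv (\<lambda>t::complex. f (x + t *s axis i 1)) 0 = g $ i" for i :: 2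
  proof -
    have "((\<lambda>t. f (x + t *s axis i 1)) has_field_derivative cbil (axis i 1) g) (at 0)"
      by (rule has_field_derivative_line) (simp add: assms)
    moreover have "cbil (axis i 1) g = g $ i"
      using exhaust_2[of i] by (auto simp: cbil_def axis_def)
    ultimately show ?thesis by (simp add: DERIV_imp_deriv)
  qed
  then show ?thesis by (simp add: cgradient_def vec_eq_iff)
qed

lemma dir_deriv_eqI:
  "(f has_derivative (\<lambda>h. cbil g h)) (at x) \<Longrightarrow> dir_deriv \<alpha> f x = cbil \<alpha> g"
  by (simp add: dir_deriv_def cgradient_eqI)

lemma has_derivative_nth [derivative_intros]:
  "((\<lambda>x::complex^2. x $ i) has_derivative (\<lambda>h. h $ i)) (at x)"
  by (rule bounded_linear.has_derivative[OF bounded_linear_vec_nth has_derivative_ident])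

lemma monom4_has_derivative:
  "(monom4 (i, j, p, q) l has_derivative
     (\<lambda>h. cbil (vector [of_nat p * monom4 (i, j, p - 1, q) l x, of_nat q * monom4 (i, j, p, q - 1) l x]) h)) (at x)"
proof -
  have 1: "monom4 (i, j, p, q) l = (\<lambda>x. l $ 1 ^ i * l $ 2 ^ j * x $ 1 ^ p * x $ 2 ^ q)"
    by (simp add: monom4_def fun_eq_iff)
  show ?thesis
    unfolding 1
    by (auto intro!: derivative_eq_intros simp: fun_eq_iff cbil_def monom4_def algebra_simps)
qed

lemma polyfun_has_derivative:
  assumes "polyfun S F"
  shows "(F l has_derivative (\<lambda>h. cbil (cgradient (F l) x) h)) (at x)"
proof -
  have "\<exists>g. (F l has_derivative (\<lambda>h. cbil g h)) (at x)"
    using assms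
  proof (induction rule: polyfun.induct)
    case zero
    show ?case by (rule exI[of _ 0]) (simp add: cbil_def)
  next
    case (add_monom F e c)
    then obtain g where g: "(F l has_derivative (\<lambda>h. cbil g h)) (at x)" by blast
    obtain i j p q where e: "e = (i, j, p, q)" by (cases e)
    have "((\<lambda>x. F l x + c * monom4 e l x) has_derivative
            (\<lambda>h. cbil (g + c *s vector [of_nat p * monom4 (i, j, p - 1, q) l x, of_nat q * monom4 (i, j, p, q - 1) l x]) h)) (at x)"
      unfolding e
      by (rule derivative_eq_intros g monom4_has_derivative refl)+ (simp add: cbil_simps fun_eq_iff)
    then show ?case by blast
  qed
  then show ?thesis using cgradient_eqI by blast
qed

lemma dir_deriv_monom4:
  "dir_deriv \<alpha> (monom4 (i, j, p, q) l) x =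
     \<alpha> $ 1 * of_nat p * monom4 (i, j, p - 1, q) l x + \<alpha> $ 2 * of_nat q * monom4 (i, j, p, q - 1) l x"
  by (subst dir_deriv_eqI[OF monom4_has_derivative]) (simp add: cbil_def algebra_simps)

lemma polyfun_line:
  assumes "polyfun S F"
  shows "((\<lambda>t. F l (y + t *s \<alpha>)) has_field_derivative dir_deriv \<alpha> (F l) (y + t *s \<alpha>)) (at t)"
  unfolding dir_deriv_def by (rule has_field_derivative_line polyfun_has_derivative assms)+

lemma dir_deriv_add:
  assumes "polyfun S F" "polyfun T G"
  shows "dir_deriv \<alpha> (\<lambda>x. F l x + G l x) x = dir_deriv \<alpha> (F l) x + dir_deriv \<alpha> (G l) x"
proof -
  have "((\<lambda>x. F l x + G l x) has_derivative (\<lambda>h. cbil (cgradient (F l) x + cgradient (G l) x) h)) (at x)"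
    by (rule derivative_eq_intros polyfun_has_derivative assms refl)+ (simp add: cbil_simps fun_eq_iff)
  from dir_deriv_eqI[OF this] show ?thesis by (simp add: cbil_simps dir_deriv_def)
qed

lemma dir_deriv_mult:
  assumes "polyfun S F" "(g has_derivative (\<lambda>h. cbil v h)) (at x)"
  shows "dir_deriv \<alpha> (\<lambda>x. F l x * g x) x = dir_deriv \<alpha> (F l) x * g x + F l x * cbil \<alpha> v"
proof -
  have "((\<lambda>x. F l x * g x) has_derivative (\<lambda>h. cbil (g x *s cgradient (F l) x + F l x *s v) h)) (at x)"
    by (rule derivative_eq_intros polyfun_has_derivative assms refl)+ (simp add: cbil_simps fun_eq_iff)
  from dir_deriv_eqI[OF this] show ?thesis by (simp add: cbil_simps dir_deriv_def)
qed

lemma dir_deriv_polyfun_mult: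
  assumes "polyfun S F" "polyfun T G"
  shows "dir_deriv \<alpha> (\<lambda>x. F l x * G l x) x = dir_deriv \<alpha> (F l) x * G l x + F l x * dir_deriv \<alpha> (G l) x"
  using dir_deriv_mult[OF assms(1) polyfun_has_derivative[OF assms(2)]] by (simp add: dir_deriv_def)

lemma dir_deriv_zero: "dir_deriv \<alpha> (\<lambda>x. c) x = 0"
  using dir_deriv_eqI[of "\<lambda>x. c" 0 x \<alpha>] by (simp add: cbil_def)

lemma dir_deriv_cmult:
  assumes "polyfun S F"
  shows "dir_deriv \<alpha> (\<lambda>x. c * F l x) x = c * dir_deriv \<alpha> (F l) x"
  using dir_deriv_polyfun_mult[OF polyfun_le_const[of 0 c] assms, of \<alpha> l x] by (simp add: dir_deriv_zero)

lemma dir_deriv_linear: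
  "dir_deriv (a *s u + b *s v) f x = a * dir_deriv u f x + b * dir_deriv v f x"
  by (simp add: dir_deriv_def cbil_simps)

lemma polyfun_le_dir_deriv:
  assumes "polyfun_le d F"
  shows "polyfun_le (d - 1) (\<lambda>l x. dir_deriv \<alpha> (F l) x)"
  using assms
proof (induction rule: polyfun.induct)
  case zero
  show ?case by (simp add: dir_deriv_zero polyfun.zero)
next
  case (add_monom F e c)
  obtain i j p q where e: "e = (i, j, p, q)" by (cases e)
  have m: "polyfun UNIV (\<lambda>l x. k * monom4 f l x)" for f k by (rule polyfun_monom) simp
  have m': "polyfun UNIV (\<lambda>l x. monom4 f l x)" for f using m[of 1] by simp
  \<comment> \<open>At \<open>p = 0\<close> the truncated exponent \<open>p - 1\<close> may break
    the degree bound, but then the coefficient \<open>of_nat p\<close> is zero.\<close>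
  have 1: "polyfun_le (d - 1) (\<lambda>l x. (a * of_nat p) * monom4 (i, j, p - 1, q) l x)" for a
    using add_monom(2) polyfun.zero
    by (cases "p = 0") (auto intro!: polyfun_monom simp: total_def e)
  have 2: "polyfun_le (d - 1) (\<lambda>l x. (a * of_nat q) * monom4 (i, j, p, q - 1) l x)" for a
    using add_monom(2) polyfun.zero
    by (cases "q = 0") (auto intro!: polyfun_monom simp: total_def e)
  have "polyfun_le (d - 1) (\<lambda>l x. dir_deriv \<alpha> (F l) x +
      (c * \<alpha> $ 1 * of_nat p * monom4 (i, j, p - 1, q) l x + c * \<alpha> $ 2 * of_nat q * monom4 (i, j, p, q - 1) l x))"
    by (intro polyfun_add add_monom.IH 1 2)
  then show ?case
    by (rule polyfun_cong)
      (simp add: dir_deriv_add[OF add_monom(1) m] dir_deriv_cmult[OF m'] e dir_deriv_monom4 algebra_simps)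
qed

lemma polyfun_le_dir_deriv':
  "polyfun_le d F \<Longrightarrow> polyfun_le d (\<lambda>l x. dir_deriv \<alpha> (F l) x)"
  by (rule polyfun_le_mono[OF polyfun_le_dir_deriv]) auto

lemma dir_deriv_commute:
  assumes "polyfun_le d F"
  shows "dir_deriv \<alpha> (\<lambda>x. dir_deriv \<beta> (F l) x) x = dir_deriv \<beta> (\<lambda>x. dir_deriv \<alpha> (F l) x) x"
  using assms
proof (induction rule: polyfun.induct)
  case zero
  show ?case by (simp add: dir_deriv_zero)
next
  case (add_monom F e c)
  obtain i j p q where e: "e = (i, j, p, q)" by (cases e)
  have m: "polyfun UNIV (\<lambda>l x. k * monom4 f l x)" for f k by (rule polyfun_monom) simp
  have m': "polyfun UNIV (\<lambda>l x. monom4 f l x)" for f using m[of 1] by simp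
  have pd: "polyfun_le d (\<lambda>l x. dir_deriv \<gamma> (F l) x)" for \<gamma>
    by (rule polyfun_le_dir_deriv' add_monom)+
  have "dir_deriv \<gamma> (\<lambda>x. F l x + c * monom4 e l x) x = dir_deriv \<gamma> (F l) x +
     ((c * \<gamma> $ 1 * of_nat p) * monom4 (i, j, p - 1, q) l x + (c * \<gamma> $ 2 * of_nat q) * monom4 (i, j, p, q - 1) l x)" for \<gamma> x
    by (simp add: dir_deriv_add[OF add_monom(1) m] dir_deriv_cmult[OF m'] e dir_deriv_monom4 algebra_simps)
  then show ?case
    by (simp add: dir_deriv_add[OF pd polyfun_add[OF m m]] dir_deriv_add[OF m m] dir_deriv_cmult[OF m']
        dir_deriv_monom4 add_monom.IH) (simp add: algebra_simps)
qed

text \<open>The derivative along \<alpha> conjugated by exp (l, x): its action on the polynomial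
  factor of F(l, x) exp (l, x).\<close>

definition tderiv ::
    "complex^2 \<Rightarrow> (complex^2 \<Rightarrow> complex^2 \<Rightarrow> complex) \<Rightarrow> complex^2 \<Rightarrow> complex^2 \<Rightarrow> complex" where
  "tderiv \<alpha> F = (\<lambda>l x. dir_deriv \<alpha> (F l) x + cbil \<alpha> l * F l x)"

lemma polyfun_le_tderiv: "polyfun_le d F \<Longrightarrow> polyfun_le (Suc d) (tderiv \<alpha> F)"
  unfolding tderiv_def
  by (intro polyfun_add polyfun_le_linear_mult_l polyfun_le_mono[OF polyfun_le_dir_deriv']) auto

lemma polyfun_le_tderiv_power: "polyfun_le d F \<Longrightarrow> polyfun_le (d + k) ((tderiv \<alpha> ^^ k) F)"
  by (induction k) (auto intro: polyfun_le_tderiv)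

lemma exp_cbil_has_derivative:
  "((\<lambda>x. exp (cbil l x)) has_derivative (\<lambda>h. cbil (exp (cbil l x) *s l) h)) (at x)"
proof -
  have "((\<lambda>x. cbil l x) has_derivative (\<lambda>h. cbil l h)) (at x)"
    unfolding cbil_def by (auto intro!: derivative_eq_intros)
  moreover have "(exp has_derivative (\<lambda>h. exp (cbil l x) * h)) (at (cbil l x))"
    using DERIV_exp has_field_derivative_def by blast
  ultimately have "((\<lambda>x. exp (cbil l x)) has_derivative (\<lambda>h. exp (cbil l x) * cbil l h)) (at x)"
    by (rule has_derivative_compose)
  then show ?thesis by (simp add: cbil_simps)
qed

lemma dir_deriv_exp:
  assumes "polyfun S F"
  shows "dir_deriv \<alpha> (\<lambda>x. F l x * exp (cbil l x)) = (\<lambda>x. tderiv \<alpha> F l x * exp (cbil l x))"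
  by (rule ext, subst dir_deriv_mult[OF assms exp_cbil_has_derivative])
    (simp add: tderiv_def cbil_simps algebra_simps)

lemma dir_deriv_power_exp:
  assumes "polyfun_le d F"
  shows "(dir_deriv \<alpha> ^^ k) (\<lambda>x. F l x * exp (cbil l x)) =
           (\<lambda>x. (tderiv \<alpha> ^^ k) F l x * exp (cbil l x))"
  by (induction k) (simp_all add: dir_deriv_exp[OF polyfun_le_tderiv_power[OF assms]])

lemma tderiv_commute:
  assumes "polyfun_le d F"
  shows "tderiv \<alpha> (tderiv \<beta> F) = tderiv \<beta> (tderiv \<alpha> F)"
proof (intro ext)
  fix l x
  have D: "polyfun_le d (\<lambda>l x. dir_deriv \<gamma> (F l) x)" for \<gamma>
    by (rule polyfun_le_dir_deriv' assms)+
  have L: "polyfun_le (Suc d) (\<lambda>l x. cbil \<gamma> l * F l x)" for \<gamma>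
    by (rule polyfun_le_linear_mult_l assms)+
  show "tderiv \<alpha> (tderiv \<beta> F) l x = tderiv \<beta> (tderiv \<alpha> F) l x"
    by (simp add: tderiv_def dir_deriv_add[OF D L] dir_deriv_cmult[OF assms]
        dir_deriv_commute[OF assms, of \<alpha> \<beta>] algebra_simps)
qed

lemma tderiv_power_commute:
  assumes "polyfun_le d F"
  shows "(tderiv \<alpha> ^^ k) (tderiv \<beta> F) = tderiv \<beta> ((tderiv \<alpha> ^^ k) F)"
  by (induction k) (simp_all add: tderiv_commute[OF polyfun_le_tderiv_power[OF assms], of \<alpha> \<beta>])

lemma tderiv_linear:
  "tderiv (a *s u + b *s v) F l x = a * tderiv u F l x + b * tderiv v F l x"
  by (simp add: tderiv_def dir_deriv_linear cbil_simps algebra_simps)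

lemma tderiv_add:
  assumes "polyfun S F" "polyfun T G"
  shows "tderiv \<alpha> (\<lambda>l x. a * F l x + b * G l x) l x = a * tderiv \<alpha> F l x + b * tderiv \<alpha> G l x"
  by (simp add: tderiv_def dir_deriv_add[OF polyfun_cmult[OF assms(1)] polyfun_cmult[OF assms(2)]]
      dir_deriv_cmult[OF assms(1)] dir_deriv_cmult[OF assms(2)] algebra_simps)

section \<open>Restriction to lines and Taylor series along them\<close>

definition line_poly :: "(complex^2 \<Rightarrow> complex) \<Rightarrow> complex^2 \<Rightarrow> complex^2 \<Rightarrow> complex poly" where
  "line_poly f y \<alpha> = (SOME p. \<forall>t. f (y + t *s \<alpha>) = poly p t)"

lemma line_poly_eqI:
  assumes "\<And>t. f (y + t *s \<alpha>) = poly p t"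
  shows "line_poly f y \<alpha> = p"
  unfolding line_poly_def
proof (rule some_equality)
  fix q assume "\<forall>t. f (y + t *s \<alpha>) = poly q t"
  then show "q = p" using assms by (metis ext poly_eq_poly_eq_iff)
qed (simp add: assms)

lemma poly_line_poly:
  assumes "polyfun S F"
  shows "poly (line_poly (F l) y \<alpha>) t = F l (y + t *s \<alpha>)"
proof -
  have "\<exists>p. \<forall>t. F l (y + t *s \<alpha>) = poly p t"
    using assms
  proof (induction rule: polyfun.induct)
    case zero
    show ?case by (rule exI[of _ 0]) simp
  next
    case (add_monom F e c)
    then obtain r where "\<forall>t. F l (y + t *s \<alpha>) = poly r t" by blast
    moreover obtain i j p q where "e = (i, j, p, q)" by (cases e)
    ultimately show ?case
      by (intro exI[of _ "r + [:c * l $ 1 ^ i * l $ 2 ^ j:] * [:y $ 1, \<alpha> $ 1:] ^ p * [:y $ 2, \<alpha> $ 2:] ^ q"])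
        (simp add: monom4_def algebra_simps)
  qed
  then show ?thesis using line_poly_eqI by metis
qed

lemma line_poly_dir_deriv:
  assumes "polyfun S F"
  shows "line_poly (\<lambda>x. dir_deriv \<alpha> (F l) x) y \<alpha> = pderiv (line_poly (F l) y \<alpha>)"
proof (rule line_poly_eqI)
  fix t
  have "(\<lambda>t. F l (y + t *s \<alpha>)) = poly (line_poly (F l) y \<alpha>)"
    by (rule ext) (simp add: poly_line_poly[OF assms])
  then show "dir_deriv \<alpha> (F l) (y + t *s \<alpha>) = poly (pderiv (line_poly (F l) y \<alpha>)) t"
    using polyfun_line[OF assms, of l y \<alpha> t] poly_DERIV[of "line_poly (F l) y \<alpha>" t]
    by (simp add: DERIV_unique)
qed

text \<open>
  Up to the constant factor \<open>exp (l, y)\<close>, this is the Taylor series in \<open>t\<close> of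
  \<open>F(l, x) exp (l, x)\<close> at \<open>x = y + t \<alpha>\<close>.
\<close>

definition line_series ::
    "(complex^2 \<Rightarrow> complex^2 \<Rightarrow> complex) \<Rightarrow> complex^2 \<Rightarrow> complex^2 \<Rightarrow> complex^2 \<Rightarrow> complex fps" where
  "line_series F \<alpha> l y = fps_of_poly (line_poly (F l) y \<alpha>) * fps_exp (cbil \<alpha> l)"

lemma line_series_0: "polyfun S F \<Longrightarrow> fps_nth (line_series F \<alpha> l y) 0 = F l y"
  using poly_line_poly[of S F l y \<alpha> 0] by (simp add: line_series_def poly_0_coeff_0)

lemma line_poly_linear:
  assumes "polyfun S F" "polyfun T G"
  shows "line_poly (\<lambda>x. a * F l x + b * G l x) y \<alpha> =
           smult a (line_poly (F l) y \<alpha>) + smult b (line_poly (G l) y \<alpha>)"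
  by (rule line_poly_eqI) (simp add: poly_line_poly[OF assms(1)] poly_line_poly[OF assms(2)])

lemma line_poly_mult:
  assumes "polyfun S F" "polyfun T G"
  shows "line_poly (\<lambda>x. F l x * G l x) y \<alpha> = line_poly (F l) y \<alpha> * line_poly (G l) y \<alpha>"
  by (rule line_poly_eqI) (simp add: poly_line_poly[OF assms(1)] poly_line_poly[OF assms(2)])

lemma line_poly_cbil: "line_poly (\<lambda>x. cbil a x) y \<alpha> = [:cbil a y, cbil a \<alpha>:]"
  by (rule line_poly_eqI) (simp add: cbil_simps)

lemma line_series_linear:
  assumes "polyfun S F" "polyfun T G"
  shows "line_series (\<lambda>l x. a l * F l x + b l * G l x) \<alpha> l y =
           fps_const (a l) * line_series F \<alpha> l y + fps_const (b l) * line_series G \<alpha> l y"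
  by (simp add: line_series_def line_poly_linear[OF assms] fps_of_poly_add fps_of_poly_smult algebra_simps)

lemma line_series_cbil_mult:
  assumes "polyfun S F"
  shows "line_series (\<lambda>l x. cbil a x * F l x) \<alpha> l y =
           (fps_const (cbil a y) + fps_const (cbil a \<alpha>) * fps_X) * line_series F \<alpha> l y"
  unfolding line_series_def line_poly_mult[OF polyfun_hom_linear_x assms] line_poly_cbil
  by (simp only: fps_of_poly_mult fps_of_poly_pCons) (simp add: algebra_simps)

lemma line_series_sum:
  assumes "\<And>i. i \<in> I \<Longrightarrow> polyfun S (F i)"
  shows "line_series (\<lambda>l x. \<Sum>i\<in>I. F i l x) \<alpha> l y = (\<Sum>i\<in>I. line_series (F i) \<alpha> l y)"
proof -
  have "line_poly (\<lambda>x. \<Sum>i\<in>I. F i l x) y \<alpha> = (\<Sum>i\<in>I. line_poly (F i l) y \<alpha>)"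
    by (rule line_poly_eqI) (simp add: poly_sum poly_line_poly[OF assms])
  then show ?thesis by (simp add: line_series_def fps_of_poly_sum sum_distrib_right)
qed

lemma line_series_tderiv:
  assumes "polyfun_le d F"
  shows "line_series (tderiv \<alpha> F) \<alpha> l y = fps_deriv (line_series F \<alpha> l y)"
proof -
  have "line_poly (\<lambda>x. 1 * dir_deriv \<alpha> (F l) x + cbil \<alpha> l * F l x) y \<alpha> =
      pderiv (line_poly (F l) y \<alpha>) + smult (cbil \<alpha> l) (line_poly (F l) y \<alpha>)"
    using line_poly_linear[OF polyfun_le_dir_deriv[OF assms, of \<alpha>] assms, of 1 l "cbil \<alpha> l" y \<alpha>]
      line_poly_dir_deriv[OF assms] by simp
  then show ?thesis
    by (simp add: line_series_def tderiv_def fps_of_poly_add fps_of_poly_smult fps_of_poly_pderiv algebra_simps)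
qed

text \<open>On \<open>line_series\<close> the operator \<open>tderiv \<alpha>\<close> is formal
  differentiation, so its iterates at \<open>y\<close> are Taylor coefficients.\<close>

lemma tderiv_power_eq_nth:
  assumes "polyfun_le d F"
  shows "(tderiv \<alpha> ^^ k) F l y = fact k * fps_nth (line_series F \<alpha> l y) k"
  using assms
proof (induction k arbitrary: F d)
  case 0
  then show ?case by (simp add: line_series_0)
next
  case (Suc k)
  have "(tderiv \<alpha> ^^ Suc k) F l y = (tderiv \<alpha> ^^ k) (tderiv \<alpha> F) l y"
    by (simp add: funpow_Suc_right del: funpow.simps)
  also have "\<dots> = fact k * fps_nth (line_series (tderiv \<alpha> F) \<alpha> l y) k"
    by (rule Suc.IH polyfun_le_tderiv Suc.prems)+
  finally show ?case by (simp add: line_series_tderiv[OF Suc.prems] algebra_simps)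
qed

section \<open>The Baker-Akhiezer conditions in terms of Taylor coefficients\<close>

definition quasi_invariant ::
    "(complex^2) set \<Rightarrow> (complex^2 \<Rightarrow> nat) \<Rightarrow> (complex^2 \<Rightarrow> complex^2 \<Rightarrow> complex) \<Rightarrow> bool" where
  "quasi_invariant A \<mu> F \<longleftrightarrow>
     (\<forall>\<alpha>\<in>A. \<forall>s\<in>{1..\<mu> \<alpha>}. \<forall>l y. cbil \<alpha> y = 0 \<longrightarrow>
        fps_nth (line_series F \<alpha> l y) (2 * s - 1) = 0)"

lemma polynomial_with_highest_term_imp_polyfun:
  assumes "polynomial_with_highest_term P H"
  shows "\<exists>d. polyfun_le d P"
  using assms unfolding polynomial_with_highest_term_iff by (auto simp: polyfun_sum_iff finite_total)

text \<open>Every derivative of \<phi> is a polynomial times the exponential, which has no zeros, so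
  the conditions concern the polynomial factor alone.\<close>

lemma admits_BA_iff:
  "admits_BA A \<mu> \<longleftrightarrow>
     (\<exists>P. polynomial_with_highest_term P (\<lambda>l x. \<Prod>\<alpha>\<in>A. cbil \<alpha> l ^ \<mu> \<alpha> * cbil \<alpha> x ^ \<mu> \<alpha>) \<and>
          quasi_invariant A \<mu> P)"
proof -
  have "(\<forall>\<alpha>\<in>A. \<forall>s\<in>{1..\<mu> \<alpha>}. \<forall>l x. cbil \<alpha> x = 0 \<longrightarrow> (dir_deriv \<alpha> ^^ (2 * s - 1)) (\<phi> l) x = 0)
      \<longleftrightarrow> quasi_invariant A \<mu> P"
    if P: "polynomial_with_highest_term P H" and \<phi>: "\<And>l x. \<phi> l x = P l x * exp (cbil l x)" for P H \<phi>
  proof -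
    obtain d where d: "polyfun_le d P" using polynomial_with_highest_term_imp_polyfun[OF P] by blast
    have "\<phi> l = (\<lambda>x. P l x * exp (cbil l x))" for l using \<phi> by auto
    then have "(dir_deriv \<alpha> ^^ k) (\<phi> l) x = 0 \<longleftrightarrow> fps_nth (line_series P \<alpha> l x) k = 0" for \<alpha> k l x
      by (simp add: dir_deriv_power_exp[OF d] tderiv_power_eq_nth[OF d])
    then show ?thesis by (simp add: quasi_invariant_def)
  qed
  note QI = this
  show ?thesis
  proof
    assume "admits_BA A \<mu>"
    then obtain \<phi> P
      where P: "polynomial_with_highest_term P (\<lambda>l x. \<Prod>\<alpha>\<in>A. cbil \<alpha> l ^ \<mu> \<alpha> * cbil \<alpha> x ^ \<mu> \<alpha>)"
        and "\<And>l x. \<phi> l x = P l x * exp (cbil l x)"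
        and "\<forall>\<alpha>\<in>A. \<forall>s\<in>{1..\<mu> \<alpha>}. \<forall>l x. cbil \<alpha> x = 0 \<longrightarrow> (dir_deriv \<alpha> ^^ (2 * s - 1)) (\<phi> l) x = 0"
      unfolding admits_BA_def BA_function_def by (elim exE conjE) (rule that, assumption, rule spec, erule spec)
    then have "quasi_invariant A \<mu> P" using QI[OF P] by (simp only:)
    with P show "\<exists>P. polynomial_with_highest_term P (\<lambda>l x. \<Prod>\<alpha>\<in>A. cbil \<alpha> l ^ \<mu> \<alpha> * cbil \<alpha> x ^ \<mu> \<alpha>) \<and>
          quasi_invariant A \<mu> P" by blast
  next
    assume "\<exists>P. polynomial_with_highest_term P (\<lambda>l x. \<Prod>\<alpha>\<in>A. cbil \<alpha> l ^ \<mu> \<alpha> * cbil \<alpha> x ^ \<mu> \<alpha>) \<and>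
          quasi_invariant A \<mu> P"
    then obtain P
      where P: "polynomial_with_highest_term P (\<lambda>l x. \<Prod>\<alpha>\<in>A. cbil \<alpha> l ^ \<mu> \<alpha> * cbil \<alpha> x ^ \<mu> \<alpha>)"
        and Q: "quasi_invariant A \<mu> P" by blast
    have "BA_function A \<mu> (\<lambda>l x. P l x * exp (cbil l x))"
      unfolding BA_function_def
      by (rule conjI, rule exI[of _ P], rule conjI, rule P, rule allI, rule allI, rule refl,
          subst QI[OF P refl], rule Q)
    then show "admits_BA A \<mu>" unfolding admits_BA_def by blast
  qed
qed

subsection \<open>Division by a linear form\<close>

text \<open>\<open>cbil u (perp v)\<close> is the determinant with columns v, u. It therefore
  vanishes exactly for proportional vectors, and for unit vectors it is the sine of the angle from v
  to u.\<close>

definition perp :: "complex^2 \<Rightarrow> complex^2" where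
  "perp v = vector [- (v $ 2), v $ 1]"

lemma cbil_perp_self [simp]: "cbil v (perp v) = 0"
  by (simp add: cbil_def perp_def)

lemma cbil_perp_neq_0:
  assumes "\<not> proportional u v" "cbil v v \<noteq> 0"
  shows "cbil u (perp v) \<noteq> 0"
proof
  assume "cbil u (perp v) = 0"
  then have *: "u $ 2 * v $ 1 = u $ 1 * v $ 2" by (simp add: cbil_def perp_def algebra_simps)
  consider "v $ 1 \<noteq> 0" | "v $ 2 \<noteq> 0" using assms(2) by (cases "v $ 1 = 0") (auto simp: cbil_def)
  then show False
  proof cases
    case 1
    then have "u = (u $ 1 / v $ 1) *s v" using * by (simp add: vec_eq_iff forall_2 field_simps)
    then show False using assms(1) unfolding proportional_def by blast
  next
    case 2
    then have "u = (u $ 2 / v $ 2) *s v" using * by (simp add: vec_eq_iff forall_2 field_simps)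
    then show False using assms(1) unfolding proportional_def by blast
  qed
qed

lemma perp_decomposition:
  "cbil \<alpha> \<alpha> *s v = cbil v \<alpha> *s \<alpha> + cbil v (perp \<alpha>) *s perp \<alpha>"
  by (simp add: vec_eq_iff forall_2 cbil_def perp_def algebra_simps)

lemma orthogonal_imp_perp_multiple:
  assumes "cbil \<alpha> y = 0" "cbil \<alpha> \<alpha> \<noteq> 0"
  shows "\<exists>\<eta>. y = \<eta> *s perp \<alpha>"
proof -
  have "cbil \<alpha> \<alpha> *s y = cbil y (perp \<alpha>) *s perp \<alpha>"
    using perp_decomposition[of \<alpha> y] assms by (simp add: cbil_commute)
  then have "y = (cbil y (perp \<alpha>) / cbil \<alpha> \<alpha>) *s perp \<alpha>"
    using assms(2) by (simp add: vec_eq_iff field_simps)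
  then show ?thesis by blast
qed

text \<open>Replaces arguments by continuity: an identity known for nonzero parameters extends to
  the parameter zero.\<close>

lemma poly_eq_0_off_0:
  fixes p :: "complex poly"
  assumes "\<And>t. t \<noteq> 0 \<Longrightarrow> poly p t = 0"
  shows "p = 0"
proof (rule ccontr)
  assume "p \<noteq> 0"
  then have "finite {x. poly p x = 0}" by (rule poly_roots_finite)
  then have "finite (UNIV - {0::complex})" by (rule finite_subset[rotated]) (use assms in auto)
  then show False by (simp add: infinite_UNIV_char_0)
qed

context
  fixes \<alpha> :: "complex^2"
  assumes nonisotropic: "cbil \<alpha> \<alpha> \<noteq> 0"
begin

private definition proj :: "complex^2 \<Rightarrow> complex^2" where
  "proj x = x - (cbil \<alpha> x / cbil \<alpha> \<alpha>) *s \<alpha>"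

text \<open>Division by (\<alpha>, x) with remainder, the remainder being F pulled back along the
  projection to the line. This form is stable under sums and products, so it reduces to coordinates.
  For \<open>d = 0\<close> the truncated bound \<open>d - 1\<close> would admit a constant quotient,
  hence the separate clause.\<close>

private definition splits :: "nat \<Rightarrow> (complex^2 \<Rightarrow> complex^2 \<Rightarrow> complex) \<Rightarrow> bool" where
  "splits d F \<longleftrightarrow> polyfun_le d F \<and> polyfun_le d (\<lambda>l x. F l (proj x)) \<and>
     (\<exists>G. polyfun_le (d - 1) G \<and> (d = 0 \<longrightarrow> G = (\<lambda>l x. 0)) \<and>
       (\<forall>l x. F l x - F l (proj x) = cbil \<alpha> x * G l x))"

private lemma splits_const: "splits d (\<lambda>l x. c)"
  unfolding splits_def by (auto intro!: polyfun_le_const exI[of _ "\<lambda>l x. 0"])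

private lemma splits_mult:
  assumes "splits d F" "splits e G"
  shows "splits (d + e) (\<lambda>l x. F l x * G l x)"
proof -
  obtain F' where F: "polyfun_le d F" "polyfun_le d (\<lambda>l x. F l (proj x))"
    "polyfun_le (d - 1) F'" "d = 0 \<longrightarrow> F' = (\<lambda>l x. 0)"
    "\<And>l x. F l x - F l (proj x) = cbil \<alpha> x * F' l x"
    using assms(1) unfolding splits_def by blast
  obtain G' where G: "polyfun_le e G" "polyfun_le e (\<lambda>l x. G l (proj x))"
    "polyfun_le (e - 1) G'" "e = 0 \<longrightarrow> G' = (\<lambda>l x. 0)"
    "\<And>l x. G l x - G l (proj x) = cbil \<alpha> x * G' l x"
    using assms(2) unfolding splits_def by blast
  \<comment> \<open>For \<open>d = 0\<close> the bound \<open>(d - 1) + e\<close> is too weak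
    because of truncation; there the quotient is zero.\<close>
  have 1: "polyfun_le (d + e - 1) (\<lambda>l x. F' l x * G l x)"
  proof (cases "d = 0")
    case True
    then show ?thesis using F(4) by (simp add: polyfun.zero)
  next
    case False
    then show ?thesis using polyfun_le_mult[OF F(3) G(1)] by (simp add: Suc_diff_le)
  qed
  have 2: "polyfun_le (d + e - 1) (\<lambda>l x. F l (proj x) * G' l x)"
  proof (cases "e = 0")
    case True
    then show ?thesis using G(4) by (simp add: polyfun.zero)
  next
    case False
    then show ?thesis using polyfun_le_mult[OF F(2) G(3)] by simp
  qed
  have "F l x * G l x - F l (proj x) * G l (proj x) =
      cbil \<alpha> x * (F' l x * G l x + F l (proj x) * G' l x)" for l x
  proof -
    have "F l x * G l x - F l (proj x) * G l (proj x) =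
       (F l x - F l (proj x)) * G l x + F l (proj x) * (G l x - G l (proj x))" by (simp add: algebra_simps)
    then show ?thesis by (simp add: F(5) G(5) algebra_simps)
  qed
  moreover have "d + e = 0 \<longrightarrow> (\<lambda>l x. F' l x * G l x + F l (proj x) * G' l x) = (\<lambda>l x. 0)"
    using F(4) G(4) by simp
  ultimately show ?thesis
    unfolding splits_def
    using polyfun_le_mult[OF F(1) G(1)] polyfun_le_mult[OF F(2) G(2)] polyfun_add[OF 1 2] by blast
qed

private lemma splits_power: "splits d F \<Longrightarrow> splits (k * d) (\<lambda>l x. F l x ^ k)"
  by (induction k) (auto intro: splits_mult splits_const)

private lemma splits_coordinate_l: "splits 1 (\<lambda>l x. l $ i)"
proof -
  have "polyfun_le 1 (\<lambda>l x. cbil (axis i 1) l)"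
    by (rule polyfun_hom_imp_le polyfun_hom_linear_l)+
  then have "polyfun_le 1 (\<lambda>l x. l $ i)"
    by (rule polyfun_cong) (use exhaust_2[of i] in \<open>auto simp: cbil_def axis_def\<close>)
  then show ?thesis
    unfolding splits_def by (auto intro!: polyfun.zero exI[of _ "\<lambda>l x. 0"])
qed

private lemma splits_coordinate_x: "splits 1 (\<lambda>l x. x $ i)"
proof -
  have "polyfun_le 1 (\<lambda>l x. cbil (axis i 1) x)"
    by (rule polyfun_hom_imp_le polyfun_hom_linear_x)+
  then have 1: "polyfun_le 1 (\<lambda>l x. x $ i)"
    by (rule polyfun_cong) (use exhaust_2[of i] in \<open>auto simp: cbil_def axis_def\<close>)
  have "polyfun_le 1 (\<lambda>l x. x $ i - (\<alpha> $ i / cbil \<alpha> \<alpha>) * cbil \<alpha> x)"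
    by (intro polyfun_diff 1 polyfun_cmult polyfun_hom_imp_le polyfun_hom_linear_x)
  then have "polyfun_le 1 (\<lambda>l x. proj x $ i)"
    by (rule polyfun_cong) (simp add: proj_def)
  with 1 show ?thesis
    unfolding splits_def
    by (intro conjI exI[of _ "\<lambda>l x. \<alpha> $ i / cbil \<alpha> \<alpha>"] polyfun_le_const) (auto simp: proj_def)
qed

private lemma splits_mono:
  assumes "splits d F" "d \<le> e"
  shows "splits e F"
proof -
  have "polyfun_le (d - 1) G \<Longrightarrow> polyfun_le (e - 1) G" for G
    by (rule polyfun_le_mono) (use assms(2) in auto)
  moreover have "e = 0 \<Longrightarrow> d = 0" using assms(2) by simp
  ultimately show ?thesis
    using assms polyfun_le_mono[OF _ assms(2)] unfolding splits_def by blast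
qed

private lemma splits_monom4: "splits (total e) (monom4 e)"
proof -
  obtain i j p q where e: "e = (i, j, p, q)" by (cases e)
  have "splits (i * 1 + j * 1 + p * 1 + q * 1) (\<lambda>l x. l $ 1 ^ i * l $ 2 ^ j * x $ 1 ^ p * x $ 2 ^ q)"
    by (intro splits_mult splits_power splits_coordinate_l splits_coordinate_x)
  moreover have "monom4 (i, j, p, q) = (\<lambda>l x. l $ 1 ^ i * l $ 2 ^ j * x $ 1 ^ p * x $ 2 ^ q)"
    by (simp add: monom4_def fun_eq_iff)
  ultimately show ?thesis by (simp add: e total_def)
qed

private lemma splits_add:
  assumes "splits d F" "splits d G"
  shows "splits d (\<lambda>l x. F l x + G l x)"
proof -
  obtain F' where F: "polyfun_le d F" "polyfun_le d (\<lambda>l x. F l (proj x))"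
    "polyfun_le (d - 1) F'" "d = 0 \<longrightarrow> F' = (\<lambda>l x. 0)"
    "\<And>l x. F l x - F l (proj x) = cbil \<alpha> x * F' l x"
    using assms(1) unfolding splits_def by blast
  obtain G' where G: "polyfun_le d G" "polyfun_le d (\<lambda>l x. G l (proj x))"
    "polyfun_le (d - 1) G'" "d = 0 \<longrightarrow> G' = (\<lambda>l x. 0)"
    "\<And>l x. G l x - G l (proj x) = cbil \<alpha> x * G' l x"
    using assms(2) unfolding splits_def by blast
  have "F l x + G l x - (F l (proj x) + G l (proj x)) = cbil \<alpha> x * (F' l x + G' l x)" for l x
    using F(5)[of l x] G(5)[of l x] by (simp add: algebra_simps)
  moreover have "d = 0 \<longrightarrow> (\<lambda>l x. F' l x + G' l x) = (\<lambda>l x. 0)" using F(4) G(4) by simp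
  ultimately show ?thesis
    unfolding splits_def
    using polyfun_add[OF F(1) G(1)] polyfun_add[OF F(2) G(2)] polyfun_add[OF F(3) G(3)] by blast
qed

private lemma polyfun_le_splits: "polyfun_le d F \<Longrightarrow> splits d F"
proof (induction rule: polyfun.induct)
  case zero
  show ?case by (rule splits_const)
next
  case (add_monom F e c)
  have "splits (0 + total e) (\<lambda>l x. c * monom4 e l x)"
    by (intro splits_mult splits_const splits_monom4)
  then have "splits d (\<lambda>l x. c * monom4 e l x)"
    using add_monom(2) by (auto intro: splits_mono)
  then show ?case using add_monom.IH by (rule splits_add[rotated])
qed

text \<open>The projection lands on the line, where F vanishes, so the remainder of the division is
  zero.\<close>

lemma polyfun_le_factor:
  assumes "polyfun_le d F" and zero: "\<And>l x. cbil \<alpha> x = 0 \<Longrightarrow> F l x = 0"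
  shows "\<exists>G. polyfun_le (d - 1) G \<and> (d = 0 \<longrightarrow> G = (\<lambda>l x. 0)) \<and> (\<forall>l x. F l x = cbil \<alpha> x * G l x)"
proof -
  have "F l (proj x) = 0" for l x
    using nonisotropic by (intro zero) (simp add: proj_def cbil_simps)
  then show ?thesis
    using polyfun_le_splits[OF assms(1)] unfolding splits_def by simp
qed

text \<open>On the line through \<open>x\<close> in direction \<alpha> the form (\<alpha>, x)
  becomes a polynomial with leading coefficient (\<alpha>, \<alpha>), hence nonzero. It can be
  cancelled even if it vanishes at \<open>x\<close> itself.\<close>

lemma polyfun_cancel:
  assumes "polyfun S F" "polyfun T G" and eq: "\<And>l x. cbil \<alpha> x * F l x = cbil \<alpha> x * G l x"
  shows "F l x = G l x"
proof -
  have "[:cbil \<alpha> x, cbil \<alpha> \<alpha>:] * line_poly (F l) x \<alpha> = [:cbil \<alpha> x, cbil \<alpha> \<alpha>:] * line_poly (G l) x \<alpha>"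
    using line_poly_mult[OF polyfun_hom_linear_x assms(1), of \<alpha> l x \<alpha>]
      line_poly_mult[OF polyfun_hom_linear_x assms(2), of \<alpha> l x \<alpha>]
    by (simp only: line_poly_cbil eq)
  then have "line_poly (F l) x \<alpha> = line_poly (G l) x \<alpha>"
    using nonisotropic by (subst (asm) mult_left_cancel) auto
  then show ?thesis
    using poly_line_poly[OF assms(1), of l x \<alpha> 0] poly_line_poly[OF assms(2), of l x \<alpha> 0] by simp
qed

end

section \<open>Tangential derivatives, cotangent conditions and the Laplacian in an adapted
  frame\<close>

lemma quasi_invariant_iff:
  "quasi_invariant A \<mu> F \<longleftrightarrow>
     (\<forall>\<alpha>\<in>A. \<forall>k. odd k \<longrightarrow> k < 2 * \<mu> \<alpha> \<longrightarrow> (\<forall>l y. cbil \<alpha> y = 0 \<longrightarrow>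
        fps_nth (line_series F \<alpha> l y) k = 0))"
proof -
  have "(\<forall>s\<in>{1..m}. P (2 * s - 1)) \<longleftrightarrow> (\<forall>k. odd k \<longrightarrow> k < 2 * m \<longrightarrow> P k)" for P :: "nat \<Rightarrow> bool" and m
  proof safe
    fix k assume *: "\<forall>s\<in>{1..m}. P (2 * s - 1)" "odd k" "k < 2 * m"
    then obtain j where "k = 2 * j + 1" by (elim oddE)
    then show "P k" using *(1)[rule_format, of "Suc j"] *(3) by auto
  next
    fix s assume *: "\<forall>k. odd k \<longrightarrow> k < 2 * m \<longrightarrow> P k" "s \<in> {1..m}"
    then show "P (2 * s - 1)" by auto
  qed
  from this[where P = "\<lambda>k. \<forall>l y. cbil \<alpha> y = 0 \<longrightarrow> fps_nth (line_series F \<alpha> l y) k = 0" for \<alpha>]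
  show ?thesis unfolding quasi_invariant_def by blast
qed

lemma tderiv_tangent:
  assumes Z: "polyfun_le d Z" and zero: "\<And>y. cbil \<alpha> y = 0 \<Longrightarrow> Z l y = 0"
    and "cbil \<alpha> \<beta> = 0" "cbil \<alpha> y = 0"
  shows "tderiv \<beta> Z l y = 0"
proof -
  have "(\<lambda>t. Z l (y + t *s \<beta>)) = (\<lambda>t. 0)"
    using assms by (intro ext zero) (simp add: cbil_simps)
  then have "dir_deriv \<beta> (Z l) (y + 0 *s \<beta>) = 0"
    using polyfun_line[OF Z, of l y \<beta> 0] by (metis DERIV_const DERIV_unique)
  then show ?thesis using zero[OF assms(4)] by (simp add: tderiv_def)
qed

text \<open>Tangential derivatives commute with normal ones, and a function that vanishes along the
  whole line has zero tangential derivative there.\<close>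

lemma line_series_tderiv_tangent:
  assumes F: "polyfun_le d F"
    and zero: "\<And>y. cbil \<alpha> y = 0 \<Longrightarrow> fps_nth (line_series F \<alpha> l y) k = 0"
    and "cbil \<alpha> \<beta> = 0" "cbil \<alpha> y = 0"
  shows "fps_nth (line_series (tderiv \<beta> F) \<alpha> l y) k = 0"
proof -
  have "fact k * fps_nth (line_series (tderiv \<beta> F) \<alpha> l y) k = tderiv \<beta> ((tderiv \<alpha> ^^ k) F) l y"
    using tderiv_power_eq_nth[OF polyfun_le_tderiv[OF F]] tderiv_power_commute[OF F] by metis
  also have "\<dots> = 0"
    by (rule tderiv_tangent[OF polyfun_le_tderiv_power[OF F] _ assms(3,4)])
      (simp add: tderiv_power_eq_nth[OF F] zero)
  finally show ?thesis by simp
qed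

lemma fps_linear_inverse:
  fixes a c :: "'a :: field"
  assumes "a \<noteq> 0"
  shows "(fps_const a + fps_const c * fps_X) * Abs_fps (\<lambda>i. (1 / a) * (- (c / a)) ^ i) = 1"
    (is "_ * ?G = 1")
proof (rule fps_ext)
  fix n
  have "(fps_const a + fps_const c * fps_X) * ?G = fps_const a * ?G + fps_const c * (fps_X * ?G)"
    by (simp add: algebra_simps)
  then show "fps_nth ((fps_const a + fps_const c * fps_X) * ?G) n = fps_nth 1 n"
    using assms by (cases n) (simp_all add: field_simps)
qed

text \<open>For unit vectors the numerator and denominator are the cosine and sine of the angle from
  \<alpha> to \<gamma>; the quotient is unaffected by nonzero rescaling of either vector.\<close>

definition cot_conditions :: "(complex^2) set \<Rightarrow> (complex^2 \<Rightarrow> nat) \<Rightarrow> bool" where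
  "cot_conditions A \<mu> \<longleftrightarrow>
     (\<forall>\<alpha>\<in>A. \<forall>k. odd k \<longrightarrow> k < 2 * \<mu> \<alpha> \<longrightarrow>
        (\<Sum>\<gamma>\<in>A - {\<alpha>}. of_nat (\<mu> \<gamma>) * (cbil \<gamma> \<alpha> / cbil \<gamma> (perp \<alpha>)) ^ k) = 0)"

text \<open>The vectors \<open>\<alpha>\<close> and \<open>perp \<alpha>\<close> are orthogonal,
  both of square (\<alpha>, \<alpha>), so they compute the Laplacian up to this factor.\<close>

lemma tderiv_laplacian:
  assumes F: "polyfun_le d F"
  shows "tderiv \<alpha> (tderiv \<alpha> F) l x + tderiv (perp \<alpha>) (tderiv (perp \<alpha>) F) l x =
    cbil \<alpha> \<alpha> * (tderiv (axis 1 1) (tderiv (axis 1 1) F) l x + tderiv (axis 2 1) (tderiv (axis 2 1) F) l x)"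
proof -
  have 1: "\<alpha> = \<alpha> $ 1 *s axis 1 1 + \<alpha> $ 2 *s axis 2 1"
    and 2: "perp \<alpha> = (- \<alpha> $ 2) *s axis 1 1 + \<alpha> $ 1 *s axis 2 1"
    by (simp_all add: vec_eq_iff forall_2 axis_def perp_def)
  have ta: "tderiv \<alpha> G l x = \<alpha> $ 1 * tderiv (axis 1 1) G l x + \<alpha> $ 2 * tderiv (axis 2 1) G l x" for G l x
    using tderiv_linear[of "\<alpha> $ 1" "axis 1 1" "\<alpha> $ 2" "axis 2 1" G l x] by (simp only: 1[symmetric])
  have tb: "tderiv (perp \<alpha>) G l x = (- \<alpha> $ 2) * tderiv (axis 1 1) G l x + \<alpha> $ 1 * tderiv (axis 2 1) G l x" for G l x
    using tderiv_linear[of "- \<alpha> $ 2" "axis 1 1" "\<alpha> $ 1" "axis 2 1" G l x] by (simp only: 2[symmetric])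
  define E1 where "E1 = tderiv (axis 1 1) F"
  define E2 where "E2 = tderiv (axis 2 1) F"
  have E: "polyfun_le (Suc d) E1" "polyfun_le (Suc d) E2"
    unfolding E1_def E2_def by (rule polyfun_le_tderiv F)+
  have a: "tderiv \<alpha> F = (\<lambda>l x. \<alpha> $ 1 * E1 l x + \<alpha> $ 2 * E2 l x)"
    unfolding E1_def E2_def by (simp add: ta fun_eq_iff)
  have b: "tderiv (perp \<alpha>) F = (\<lambda>l x. (- \<alpha> $ 2) * E1 l x + \<alpha> $ 1 * E2 l x)"
    unfolding E1_def E2_def by (simp add: tb fun_eq_iff)
  have "tderiv \<alpha> (tderiv \<alpha> F) l x =
      \<alpha> $ 1 * (\<alpha> $ 1 * tderiv (axis 1 1) E1 l x + \<alpha> $ 2 * tderiv (axis 2 1) E1 l x)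
    + \<alpha> $ 2 * (\<alpha> $ 1 * tderiv (axis 1 1) E2 l x + \<alpha> $ 2 * tderiv (axis 2 1) E2 l x)"
    unfolding a tderiv_add[OF E] ta ..
  moreover have "tderiv (perp \<alpha>) (tderiv (perp \<alpha>) F) l x =
      (- \<alpha> $ 2) * ((- \<alpha> $ 2) * tderiv (axis 1 1) E1 l x + \<alpha> $ 1 * tderiv (axis 2 1) E1 l x)
    + \<alpha> $ 1 * ((- \<alpha> $ 2) * tderiv (axis 1 1) E2 l x + \<alpha> $ 1 * tderiv (axis 2 1) E2 l x)"
    unfolding b tderiv_add[OF E] tb ..
  ultimately show ?thesis
    by (simp add: cbil_def algebra_simps flip: E1_def E2_def)
qed

subsection \<open>Quasi-invariance under the gauged Schroedinger operator\<close>

lemma line_series_add: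
  assumes "polyfun S F" "polyfun T G"
  shows "line_series (\<lambda>l x. F l x + G l x) \<alpha> l y = line_series F \<alpha> l y + line_series G \<alpha> l y"
  using line_series_linear[OF assms, of "\<lambda>_. 1" "\<lambda>_. 1"] by simp

lemma line_series_diff:
  assumes "polyfun S F" "polyfun T G"
  shows "line_series (\<lambda>l x. F l x - G l x) \<alpha> l y = line_series F \<alpha> l y - line_series G \<alpha> l y"
  using line_series_linear[OF assms, of "\<lambda>_. 1" "\<lambda>_. - 1"]
  by (simp del: fps_const_neg add: fps_const_neg[symmetric])

lemma line_series_cmult:
  assumes "polyfun S F"
  shows "line_series (\<lambda>l x. c l * F l x) \<alpha> l y = fps_const (c l) * line_series F \<alpha> l y"
  using line_series_linear[OF assms assms, of c "\<lambda>_. 0"] by simp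

lemma polyfun_le_cbil_self_mult:
  assumes "polyfun_le d F"
  shows "polyfun_le (Suc (Suc d)) (\<lambda>l x. cbil l l * F l x)"
proof -
  have "polyfun_le (Suc (Suc d)) (\<lambda>l x. cbil (axis 1 1) l * (cbil (axis 1 1) l * F l x)
      + cbil (axis 2 1) l * (cbil (axis 2 1) l * F l x))"
    by (intro polyfun_add polyfun_le_linear_mult_l assms)
  then show ?thesis
    by (rule polyfun_cong) (simp add: cbil_def axis_def algebra_simps)
qed

text \<open>
  The coefficient \<open>2 \<mu> \<alpha> + 1\<close>, on which no condition is imposed, does not contribute because
  \<open>2 \<mu> \<alpha> + 1\<close> is an indicial exponent of \<open>\<partial>\<^sub>t\<^sup>2 - 2 \<mu> \<alpha> t\<^sup>-\<^sup>1 \<partial>\<^sub>t\<close>.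
\<close>

lemma quasi_invariant_step:
  fixes A :: "(complex^2) set" and \<mu> :: "complex^2 \<Rightarrow> nat"
  assumes fin: "finite A" and pw: "pairwise (\<lambda>u v. \<not> proportional u v) A"
    and iso: "\<And>\<alpha>. \<alpha> \<in> A \<Longrightarrow> cbil \<alpha> \<alpha> \<noteq> 0"
    and cot: "cot_conditions A \<mu>"
    and F: "polyfun_le d F" and QF: "quasi_invariant A \<mu> F"
    and G: "\<And>\<alpha>. \<alpha> \<in> A \<Longrightarrow> polyfun_le d (G \<alpha>)"
    and FG: "\<And>\<alpha> l x. \<alpha> \<in> A \<Longrightarrow> tderiv \<alpha> F l x = cbil \<alpha> x * G \<alpha> l x"
  shows "quasi_invariant A \<mu> (\<lambda>l x. tderiv (axis 1 1) (tderiv (axis 1 1) F) l x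
           + tderiv (axis 2 1) (tderiv (axis 2 1) F) l x - cbil l l * F l x
           - (\<Sum>\<gamma>\<in>A. 2 * of_nat (\<mu> \<gamma>) * G \<gamma> l x))"
    (is "quasi_invariant A \<mu> ?W")
  unfolding quasi_invariant_iff
proof (intro ballI allI impI)
  fix \<alpha> k l y
  assume \<alpha>: "\<alpha> \<in> A" and k: "odd k" "k < 2 * \<mu> \<alpha>" and y: "cbil \<alpha> y = 0"
  define \<kappa> where "\<kappa> = cbil \<alpha> \<alpha>"
  define \<beta> where "\<beta> = perp \<alpha>"
  define E where "E = (\<lambda>l x. tderiv (axis 1 1) (tderiv (axis 1 1) F) l x + tderiv (axis 2 1) (tderiv (axis 2 1) F) l x)"
  define S where "S = (\<lambda>l x. \<Sum>\<gamma>\<in>A. 2 * of_nat (\<mu> \<gamma>) * G \<gamma> l x)"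
  have \<kappa>: "\<kappa> \<noteq> 0" using iso \<alpha> by (simp add: \<kappa>_def)
  have zeroF: "fps_nth (line_series F \<alpha> l z) j = 0" if "odd j" "j < 2 * \<mu> \<alpha>" "cbil \<alpha> z = 0" for j z l
    using QF \<alpha> that unfolding quasi_invariant_iff by blast
  have E: "polyfun_le (Suc (Suc d)) E"
    unfolding E_def by (intro polyfun_add polyfun_le_tderiv F)
  have L: "polyfun_le (Suc (Suc d)) (\<lambda>l x. cbil l l * F l x)"
    by (rule polyfun_le_cbil_self_mult[OF F])
  have S: "polyfun_le d S"
    unfolding S_def by (intro polyfun_sum polyfun_cmult G)
  have W: "polyfun_le (Suc (Suc d)) ?W"
    using polyfun_diff[OF polyfun_diff[OF E L] polyfun_le_mono[OF S, of "Suc (Suc d)"]]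
    by (simp add: E_def S_def)
  have tt: "polyfun_le (Suc (Suc d)) (tderiv \<gamma> (tderiv \<gamma> F))" for \<gamma>
    by (intro polyfun_le_tderiv F)
  \<comment> \<open>Away from the origin every (\<gamma>, z) with \<gamma> different from \<alpha>
    is nonzero, so the singular terms of the other lines expand into power series in the line
    parameter.\<close>
  have main: "fps_nth (line_series ?W \<alpha> l (\<eta> *s \<beta>)) k = 0" if \<eta>: "\<eta> \<noteq> 0" for \<eta>
  proof -
    define z where "z = \<eta> *s \<beta>"
    have z: "cbil \<alpha> z = 0" by (simp add: z_def \<beta>_def cbil_simps)
    have ab: "cbil \<alpha> \<beta> = 0" by (simp add: \<beta>_def)
    define f where "f = line_series F \<alpha> l z"
    define g where "g = line_series (tderiv \<beta> F) \<alpha> l z"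
    define h where "h = line_series (tderiv \<beta> (tderiv \<beta> F)) \<alpha> l z"
    define q where "q = (\<lambda>\<gamma>. line_series (G \<gamma>) \<alpha> l z)"
    have f0: "fps_nth f j = 0" if "odd j" "j < 2 * \<mu> \<alpha>" for j
      using zeroF[OF that z] by (simp add: f_def)
    have g0': "fps_nth (line_series (tderiv \<beta> F) \<alpha> l w) j = 0"
      if "odd j" "j < 2 * \<mu> \<alpha>" "cbil \<alpha> w = 0" for j w
      using line_series_tderiv_tangent[OF F zeroF[OF that(1,2)] ab that(3)] by simp
    have g0: "fps_nth g j = 0" if "odd j" "j < 2 * \<mu> \<alpha>" for j
      using g0'[OF that z] by (simp add: g_def)
    have h0: "fps_nth h j = 0" if "odd j" "j < 2 * \<mu> \<alpha>" for j
      using line_series_tderiv_tangent[OF polyfun_le_tderiv[OF F] g0'[OF that] ab z] by (simp add: h_def)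
    have lsE: "fps_const \<kappa> * line_series E \<alpha> l z = fps_deriv (fps_deriv f) + h"
    proof -
      have "fps_const \<kappa> * line_series E \<alpha> l z = line_series (\<lambda>l x. \<kappa> * E l x) \<alpha> l z"
        using line_series_cmult[OF E, of "\<lambda>_. \<kappa>"] by simp
      also have "(\<lambda>l x. \<kappa> * E l x) = (\<lambda>l x. tderiv \<alpha> (tderiv \<alpha> F) l x + tderiv \<beta> (tderiv \<beta> F) l x)"
        by (simp add: \<kappa>_def \<beta>_def E_def tderiv_laplacian[OF F])
      also have "line_series \<dots> \<alpha> l z = fps_deriv (fps_deriv f) + h"
        by (simp add: line_series_add[OF tt tt] h_def f_def line_series_tderiv[OF polyfun_le_tderiv[OF F]]
            line_series_tderiv[OF F])
      finally show ?thesis .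
    qed
    have lsS: "line_series S \<alpha> l z = (\<Sum>\<gamma>\<in>A. fps_const (2 * of_nat (\<mu> \<gamma>)) * q \<gamma>)"
    proof -
      have "line_series S \<alpha> l z = (\<Sum>\<gamma>\<in>A. line_series (\<lambda>l x. 2 * of_nat (\<mu> \<gamma>) * G \<gamma> l x) \<alpha> l z)"
        unfolding S_def by (rule line_series_sum) (rule polyfun_cmult G, assumption?)+
      also have "\<dots> = (\<Sum>\<gamma>\<in>A. fps_const (2 * of_nat (\<mu> \<gamma>)) * q \<gamma>)"
        unfolding q_def by (rule sum.cong) (use line_series_cmult[OF G] in auto)
      finally show ?thesis .
    qed
    have lsW: "line_series ?W \<alpha> l z = line_series E \<alpha> l z - fps_const (cbil l l) * f - line_series S \<alpha> l z"
      using line_series_diff[OF polyfun_diff[OF E L] S, of \<alpha> l z] line_series_diff[OF E L, of \<alpha> l z]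
        line_series_cmult[OF F, of "\<lambda>l. cbil l l" \<alpha> l z]
      by (simp add: E_def S_def f_def)
    have q_line: "(fps_const (cbil \<gamma> z) + fps_const (cbil \<gamma> \<alpha>) * fps_X) * q \<gamma> = line_series (tderiv \<gamma> F) \<alpha> l z"
      if "\<gamma> \<in> A" for \<gamma>
    proof -
      have "tderiv \<gamma> F = (\<lambda>l x. cbil \<gamma> x * G \<gamma> l x)" using FG[OF that] by (simp add: fun_eq_iff)
      then show ?thesis by (simp add: q_def line_series_cbil_mult[OF G[OF that]])
    qed
    \<comment> \<open>Along this line (\<alpha>, x) is \<kappa> t, so the term of \<alpha> itself is
      f'(t) / (\<kappa> t), which moves coefficient \<open>k + 2\<close> of \<open>f\<close> to
      position \<open>k\<close>.\<close>
    have qa: "\<kappa> * fps_nth (q \<alpha>) k = of_nat (k + 2) * fps_nth f (k + 2)"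
    proof -
      have "fps_const \<kappa> * (fps_X * q \<alpha>) = fps_deriv f"
        using q_line[OF \<alpha>] by (simp add: z \<kappa>_def f_def line_series_tderiv[OF F] mult.assoc)
      then have "fps_nth (fps_const \<kappa> * (fps_X * q \<alpha>)) (Suc k) = fps_nth (fps_deriv f) (Suc k)" by simp
      then show ?thesis by simp
    qed
    define u where "u = (\<lambda>\<gamma>. cbil \<gamma> \<alpha>)"
    define v where "v = (\<lambda>\<gamma>. cbil \<gamma> \<beta>)"
    define iv where "iv = (\<lambda>\<gamma>. Abs_fps (\<lambda>i. (1 / (\<eta> * v \<gamma>)) * (- (u \<gamma> / (\<eta> * v \<gamma>))) ^ i))"
    have v: "v \<gamma> \<noteq> 0" if "\<gamma> \<in> A - {\<alpha>}" for \<gamma>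
      using that \<alpha> pw iso unfolding v_def \<beta>_def by (intro cbil_perp_neq_0) (auto simp: pairwise_def)
    \<comment> \<open>Here (\<gamma>, x) = \<eta> v + u t, inverted by the geometric series
      \<open>iv\<close>, and the derivative along \<gamma> is split into its normal part
      \<open>f'\<close> and its tangential part \<open>g\<close>.\<close>
    have q\<gamma>: "fps_const \<kappa> * q \<gamma> = (fps_const (u \<gamma>) * fps_deriv f + fps_const (v \<gamma>) * g) * iv \<gamma>"
      if \<gamma>: "\<gamma> \<in> A - {\<alpha>}" for \<gamma>
    proof -
      have "(\<lambda>l x. \<kappa> * tderiv \<gamma> F l x) = (\<lambda>l x. u \<gamma> * tderiv \<alpha> F l x + v \<gamma> * tderiv \<beta> F l x)"
      proof (intro ext)
        fix l x
        have "\<kappa> *s \<gamma> + 0 *s \<gamma> = u \<gamma> *s \<alpha> + v \<gamma> *s \<beta>"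
          unfolding \<kappa>_def u_def v_def \<beta>_def perp_decomposition[symmetric] by (simp add: vec_eq_iff)
        then have "\<kappa> * tderiv \<gamma> F l x + 0 * tderiv \<gamma> F l x = u \<gamma> * tderiv \<alpha> F l x + v \<gamma> * tderiv \<beta> F l x"
          by (simp only: tderiv_linear[symmetric])
        then show "\<kappa> * tderiv \<gamma> F l x = u \<gamma> * tderiv \<alpha> F l x + v \<gamma> * tderiv \<beta> F l x" by simp
      qed
      then have "fps_const \<kappa> * line_series (tderiv \<gamma> F) \<alpha> l z = fps_const (u \<gamma>) * fps_deriv f + fps_const (v \<gamma>) * g"
        using line_series_cmult[OF polyfun_le_tderiv[OF F], of "\<lambda>_. \<kappa>" \<gamma> \<alpha> l z]
          line_series_linear[OF polyfun_le_tderiv[OF F] polyfun_le_tderiv[OF F], of "\<lambda>_. u \<gamma>" \<alpha> "\<lambda>_. v \<gamma>" \<beta> \<alpha> l z]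
        by (simp add: f_def g_def line_series_tderiv[OF F])
      moreover have "cbil \<gamma> z = \<eta> * v \<gamma>" by (simp add: z_def v_def cbil_simps)
      ultimately have "(fps_const (\<eta> * v \<gamma>) + fps_const (u \<gamma>) * fps_X) * (fps_const \<kappa> * q \<gamma>) =
          fps_const (u \<gamma>) * fps_deriv f + fps_const (v \<gamma>) * g"
        using q_line[of \<gamma>] \<gamma>
        by (subst mult.left_commute) (simp only: u_def DiffD1)
      then have "((fps_const (\<eta> * v \<gamma>) + fps_const (u \<gamma>) * fps_X) * iv \<gamma>) * (fps_const \<kappa> * q \<gamma>) =
          (fps_const (u \<gamma>) * fps_deriv f + fps_const (v \<gamma>) * g) * iv \<gamma>"
        by (metis (no_types, lifting) mult.assoc mult.commute)
      moreover have "(fps_const (\<eta> * v \<gamma>) + fps_const (u \<gamma>) * fps_X) * iv \<gamma> = 1"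
        unfolding iv_def by (rule fps_linear_inverse) (use v[OF \<gamma>] \<eta> in simp)
      ultimately show ?thesis by (simp only: mult_1_left)
    qed
    have cotk: "(\<Sum>\<gamma>\<in>A - {\<alpha>}. of_nat (\<mu> \<gamma>) * (u \<gamma> / v \<gamma>) ^ j) = 0" if "odd j" "j < 2 * \<mu> \<alpha>" for j
      using cot \<alpha> that unfolding cot_conditions_def u_def v_def \<beta>_def by blast
    \<comment> \<open>Parity: coefficient \<open>i\<close> of \<open>iv \<gamma>\<close> carries
      cot^i / v. Paired with u f' it gives cot^(i+1), paired with v g it gives cot^i. As
      \<open>k\<close> is odd, the pairing with an even power of the cotangent always meets a
      vanishing coefficient of f' or g, and the odd powers sum to zero.\<close>
    have rest: "(\<Sum>\<gamma>\<in>A - {\<alpha>}. of_nat (\<mu> \<gamma>) * fps_nth (fps_const \<kappa> * q \<gamma>) k) = 0"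
    proof -
      have iv: "fps_nth (iv \<gamma>) i = (- 1) ^ i / \<eta> ^ Suc i * ((u \<gamma> / v \<gamma>) ^ i / v \<gamma>)" for \<gamma> i
        by (simp add: iv_def power_divide power_mult_distrib power_minus[of "u \<gamma> / _"])
      have "(\<Sum>\<gamma>\<in>A - {\<alpha>}. of_nat (\<mu> \<gamma>) * fps_nth (fps_const \<kappa> * q \<gamma>) k) =
        (\<Sum>\<gamma>\<in>A - {\<alpha>}. \<Sum>i=0..k. of_nat (\<mu> \<gamma>) *
           ((u \<gamma> * fps_nth (fps_deriv f) (k - i) + v \<gamma> * fps_nth g (k - i)) * fps_nth (iv \<gamma>) i))"
      proof (rule sum.cong[OF refl])
        fix \<gamma> assume \<gamma>: "\<gamma> \<in> A - {\<alpha>}"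
        have "fps_nth (fps_const \<kappa> * q \<gamma>) k =
            (\<Sum>i=0..k. fps_nth (iv \<gamma>) i * (u \<gamma> * fps_nth (fps_deriv f) (k - i) + v \<gamma> * fps_nth g (k - i)))"
          unfolding q\<gamma>[OF \<gamma>] by (subst mult.commute, subst fps_mult_nth) (simp del: fps_deriv_nth)
        then show "of_nat (\<mu> \<gamma>) * fps_nth (fps_const \<kappa> * q \<gamma>) k = (\<Sum>i=0..k. of_nat (\<mu> \<gamma>) *
           ((u \<gamma> * fps_nth (fps_deriv f) (k - i) + v \<gamma> * fps_nth g (k - i)) * fps_nth (iv \<gamma>) i))"
          by (simp add: sum_distrib_left mult.commute del: fps_deriv_nth)
      qed
      also have "\<dots> = (\<Sum>i=0..k. \<Sum>\<gamma>\<in>A - {\<alpha>}. of_nat (\<mu> \<gamma>) *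
           ((u \<gamma> * fps_nth (fps_deriv f) (k - i) + v \<gamma> * fps_nth g (k - i)) * fps_nth (iv \<gamma>) i))"
        by (rule sum.swap)
      also have "\<dots> = 0"
      proof (rule sum.neutral, rule ballI)
        fix i assume i: "i \<in> {0..k}"
        define c where "c = (- 1) ^ i / \<eta> ^ Suc i"
        show "(\<Sum>\<gamma>\<in>A - {\<alpha>}. of_nat (\<mu> \<gamma>) *
           ((u \<gamma> * fps_nth (fps_deriv f) (k - i) + v \<gamma> * fps_nth g (k - i)) * fps_nth (iv \<gamma>) i)) = 0"
        proof (cases "even i")
          case True
          then have "i < k" using i k(1) by (cases "i = k") auto
          then have "odd (k - i)" "odd (Suc i)" "Suc i < 2 * \<mu> \<alpha>" using True k by auto
          then have g': "fps_nth g (k - i) = 0"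
            and c0: "(\<Sum>\<gamma>\<in>A - {\<alpha>}. of_nat (\<mu> \<gamma>) * (u \<gamma> / v \<gamma>) ^ Suc i) = 0"
            using g0[of "k - i"] cotk[of "Suc i"] k by auto
          have "(\<Sum>\<gamma>\<in>A - {\<alpha>}. of_nat (\<mu> \<gamma>) *
             ((u \<gamma> * fps_nth (fps_deriv f) (k - i) + v \<gamma> * fps_nth g (k - i)) * fps_nth (iv \<gamma>) i)) =
             (\<Sum>\<gamma>\<in>A - {\<alpha>}. (c * fps_nth (fps_deriv f) (k - i)) * (of_nat (\<mu> \<gamma>) * (u \<gamma> / v \<gamma>) ^ Suc i))"
            by (intro sum.cong refl) (simp add: g' iv c_def del: fps_deriv_nth)
          then show ?thesis using c0 by (simp only: sum_distrib_left[symmetric] mult_zero_right)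
        next
          case False
          then have "odd (Suc (k - i))" using k i by auto
          moreover have "Suc (k - i) \<le> k" using False i by (cases i) auto
          ultimately have f': "fps_nth (fps_deriv f) (k - i) = 0" using f0[of "Suc (k - i)"] k by simp
          have c0: "(\<Sum>\<gamma>\<in>A - {\<alpha>}. of_nat (\<mu> \<gamma>) * (u \<gamma> / v \<gamma>) ^ i) = 0"
            using cotk[OF False] i k by auto
          have "(\<Sum>\<gamma>\<in>A - {\<alpha>}. of_nat (\<mu> \<gamma>) *
             ((u \<gamma> * fps_nth (fps_deriv f) (k - i) + v \<gamma> * fps_nth g (k - i)) * fps_nth (iv \<gamma>) i)) =
             (\<Sum>\<gamma>\<in>A - {\<alpha>}. (c * fps_nth g (k - i)) * (of_nat (\<mu> \<gamma>) * (u \<gamma> / v \<gamma>) ^ i))"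
            using v by (intro sum.cong refl) (simp add: f' iv c_def del: fps_deriv_nth)
          then show ?thesis using c0 by (simp only: sum_distrib_left[symmetric] mult_zero_right)
        qed
      qed
      finally show ?thesis .
    qed
    have fk: "(of_nat (k + 1) - 2 * of_nat (\<mu> \<alpha>)) * (of_nat (k + 2) * fps_nth f (k + 2)) = 0"
    proof (cases "k + 1 = 2 * \<mu> \<alpha>")
      case True
      then have "of_nat (k + 1) = (of_nat (2 * \<mu> \<alpha>) :: complex)" by (simp only:)
      then show ?thesis by simp
    next
      case False
      then have "k + 2 < 2 * \<mu> \<alpha>" using k by presburger
      then show ?thesis using f0[of "k + 2"] k by simp
    qed
    have "\<kappa> * fps_nth (line_series ?W \<alpha> l z) k =
        fps_nth (fps_const \<kappa> * line_series E \<alpha> l z) k - \<kappa> * (cbil l l * fps_nth f k)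
        - (\<Sum>\<gamma>\<in>A. 2 * of_nat (\<mu> \<gamma>) * (\<kappa> * fps_nth (q \<gamma>) k))"
      unfolding lsW lsS by (simp add: fps_sum_nth right_diff_distrib sum_distrib_left mult.left_commute)
    also have "\<dots> = of_nat (k + 1) * (of_nat (k + 2) * fps_nth f (k + 2))
        - (\<Sum>\<gamma>\<in>A. 2 * of_nat (\<mu> \<gamma>) * (\<kappa> * fps_nth (q \<gamma>) k))"
      using f0[OF k] h0[OF k] by (simp add: lsE)
    also have "(\<Sum>\<gamma>\<in>A. 2 * of_nat (\<mu> \<gamma>) * (\<kappa> * fps_nth (q \<gamma>) k)) =
        2 * of_nat (\<mu> \<alpha>) * (\<kappa> * fps_nth (q \<alpha>) k)
        + 2 * (\<Sum>\<gamma>\<in>A - {\<alpha>}. of_nat (\<mu> \<gamma>) * fps_nth (fps_const \<kappa> * q \<gamma>) k)"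
      by (subst sum.remove[OF fin \<alpha>]) (simp add: sum_distrib_left algebra_simps)
    also have "of_nat (k + 1) * (of_nat (k + 2) * fps_nth f (k + 2)) - \<dots> = 0"
      unfolding rest qa using fk by (simp add: algebra_simps)
    finally show ?thesis using \<kappa> by (simp add: z_def)
  qed
  \<comment> \<open>The origin is the one point of the line not yet covered; the coefficient is
    polynomial along the line.\<close>
  have pp: "polyfun_le (Suc (Suc d) + k) ((tderiv \<alpha> ^^ k) ?W)" by (rule polyfun_le_tderiv_power[OF W])
  have "line_poly ((tderiv \<alpha> ^^ k) ?W l) 0 \<beta> = 0"
    by (rule poly_eq_0_off_0) (simp add: poly_line_poly[OF pp] tderiv_power_eq_nth[OF W] main)
  then have "(tderiv \<alpha> ^^ k) ?W l (\<eta> *s \<beta>) = 0" for \<eta>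
    using poly_line_poly[OF pp, of l 0 \<beta> \<eta>] by simp
  moreover obtain \<eta> where "y = \<eta> *s \<beta>"
    using orthogonal_imp_perp_multiple[OF y] \<kappa> unfolding \<kappa>_def \<beta>_def by blast
  ultimately show "fps_nth (line_series ?W \<alpha> l y) k = 0"
    by (simp add: tderiv_power_eq_nth[OF W])
qed

subsection \<open>Existence of the Baker-Akhiezer function\<close>

lemma coeff_mult_degree_le:
  fixes p q :: "'a :: comm_semiring_0 poly"
  assumes "Polynomial.degree p \<le> a" "Polynomial.degree q \<le> b"
  shows "coeff (p * q) (a + b) = coeff p a * coeff q b"
proof -
  have "coeff (p * q) (a + b) = (\<Sum>i\<le>a + b. coeff p i * coeff q (a + b - i))"
    by (rule coeff_mult)
  also have "\<dots> = (\<Sum>i\<le>a + b. if i = a then coeff p a * coeff q b else 0)"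
  proof (rule sum.cong[OF refl])
    fix i assume "i \<in> {..a + b}"
    show "coeff p i * coeff q (a + b - i) = (if i = a then coeff p a * coeff q b else 0)"
    proof (cases i a rule: linorder_cases)
      case less
      then have "coeff q (a + b - i) = 0" using assms(2) by (intro coeff_eq_0) auto
      then show ?thesis using less by simp
    next
      case greater
      then have "coeff p i = 0" using assms(1) by (intro coeff_eq_0) auto
      then show ?thesis using greater by simp
    qed simp
  qed
  also have "\<dots> = coeff p a * coeff q b" by simp
  finally show ?thesis .
qed

lemma coeff_linear_power:
  fixes b c :: "'a :: comm_semiring_1"
  shows "Polynomial.degree ([:b, c:] ^ n) \<le> n \<and> coeff ([:b, c:] ^ n) n = c ^ n"
proof (induction n)
  case (Suc n)
  have d1: "Polynomial.degree [:b, c:] \<le> 1" by simp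
  have "Polynomial.degree ([:b, c:] * [:b, c:] ^ n) \<le> 1 + n"
    by (rule order.trans[OF degree_mult_le add_mono[OF d1]]) (use Suc in simp)
  moreover have "coeff ([:b, c:] * [:b, c:] ^ n) (1 + n) = coeff [:b, c:] 1 * coeff ([:b, c:] ^ n) n"
    by (rule coeff_mult_degree_le[OF d1]) (use Suc in simp)
  ultimately show ?case using Suc by simp
qed simp

text \<open>Degree bounds instead of degrees, since some of the \<open>c i\<close> may be
  zero.\<close>

lemma coeff_prod_linear_power:
  fixes b c :: "'i \<Rightarrow> 'a :: comm_semiring_1"
  assumes "finite I"
  shows "Polynomial.degree (\<Prod>i\<in>I. [:b i, c i:] ^ m i) \<le> sum m I \<and>
         coeff (\<Prod>i\<in>I. [:b i, c i:] ^ m i) (sum m I) = (\<Prod>i\<in>I. c i ^ m i)"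
  using assms
proof (induction I rule: finite_induct)
  case (insert i I)
  note l = coeff_linear_power[of "b i" "c i" "m i"]
  have "Polynomial.degree ([:b i, c i:] ^ m i * (\<Prod>i\<in>I. [:b i, c i:] ^ m i)) \<le> m i + sum m I"
    by (rule order.trans[OF degree_mult_le add_mono]) (use l insert.IH in auto)
  then show ?case
    using insert.hyps insert.IH l coeff_mult_degree_le[of "[:b i, c i:] ^ m i" "m i" "\<Prod>i\<in>I. [:b i, c i:] ^ m i" "sum m I"]
    by simp
qed simp

text \<open>A derivative along \<open>l\<close> trades one power of x for one of l, so the total
  degree does not rise. Positivity of \<open>d\<close> is what makes \<open>Suc (d - 1)\<close>
  equal to \<open>d\<close>.\<close>

lemma polyfun_le_dir_deriv_diag:
  assumes "polyfun_le d F" "0 < d"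
  shows "polyfun_le d (\<lambda>l x. dir_deriv l (F l) x)"
proof -
  have "polyfun_le (Suc (d - 1)) (\<lambda>l x. cbil (axis 1 1) l * dir_deriv (axis 1 1) (F l) x
      + cbil (axis 2 1) l * dir_deriv (axis 2 1) (F l) x)"
    by (intro polyfun_add polyfun_le_linear_mult_l polyfun_le_dir_deriv assms)
  then have "polyfun_le d (\<lambda>l x. cbil (axis 1 1) l * dir_deriv (axis 1 1) (F l) x
      + cbil (axis 2 1) l * dir_deriv (axis 2 1) (F l) x)"
    using assms(2) by simp
  then show ?thesis
  proof (rule polyfun_cong)
    fix l x
    have "l = cbil (axis 1 1) l *s axis 1 1 + cbil (axis 2 1) l *s axis 2 1"
      by (simp add: vec_eq_iff forall_2 axis_def cbil_def)
    then show "cbil (axis 1 1) l * dir_deriv (axis 1 1) (F l) x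
      + cbil (axis 2 1) l * dir_deriv (axis 2 1) (F l) x = dir_deriv l (F l) x"
      using dir_deriv_linear[of "cbil (axis 1 1) l" "axis 1 1" "cbil (axis 2 1) l" "axis 2 1" "F l" x] by simp
  qed
qed

text \<open>Supplies a point where the highest term is nonzero, as its definition demands;
  \<open>t\<close> avoids the finitely many roots of a product of linear polynomials.\<close>

lemma exists_nonorthogonal_vector:
  assumes "finite A" "\<And>\<alpha>. \<alpha> \<in> A \<Longrightarrow> \<alpha> \<noteq> 0"
  shows "\<exists>v. \<forall>\<alpha>\<in>A. cbil \<alpha> v \<noteq> 0"
proof -
  define p where "p = (\<Prod>\<alpha>\<in>A. [:\<alpha> $ 1, \<alpha> $ 2:])"
  have "p \<noteq> 0"
    using assms by (auto simp: p_def prod_zero_iff vec_eq_iff forall_2)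
  then have "finite {t. poly p t = 0}" by (rule poly_roots_finite)
  then obtain t where "poly p t \<noteq> 0"
    using ex_new_if_finite[OF infinite_UNIV_char_0, of "{t. poly p t = 0}"] by auto
  then have "\<forall>\<alpha>\<in>A. cbil \<alpha> (vector [1, t]) \<noteq> 0"
    using assms(1) by (auto simp: p_def poly_prod prod_zero_iff cbil_def mult.commute)
  then show ?thesis by blast
qed

lemma dir_deriv_prod_power:
  assumes "finite A"
  shows "dir_deriv v (\<lambda>x. \<Prod>\<gamma>\<in>A. cbil \<gamma> x ^ \<mu> \<gamma>) x =
     (\<Sum>\<gamma>\<in>A. of_nat (\<mu> \<gamma>) * cbil \<gamma> v * (cbil \<gamma> x ^ (\<mu> \<gamma> - 1) * (\<Prod>\<delta>\<in>A - {\<gamma>}. cbil \<delta> x ^ \<mu> \<delta>)))"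
proof -
  have lin: "((\<lambda>x. cbil \<gamma> x) has_derivative (\<lambda>h. cbil \<gamma> h)) (at x)" for \<gamma>
    unfolding cbil_def by (auto intro!: derivative_eq_intros)
  have "((\<lambda>x. \<Prod>\<gamma>\<in>A. cbil \<gamma> x ^ \<mu> \<gamma>) has_derivative
     (\<lambda>h. \<Sum>\<gamma>\<in>A. (of_nat (\<mu> \<gamma>) * cbil \<gamma> h * cbil \<gamma> x ^ (\<mu> \<gamma> - 1)) * (\<Prod>\<delta>\<in>A - {\<gamma>}. cbil \<delta> x ^ \<mu> \<delta>))) (at x)"
    by (rule has_derivative_prod) (rule has_derivative_power[OF lin])
  moreover have "(\<lambda>h. \<Sum>\<gamma>\<in>A. (of_nat (\<mu> \<gamma>) * cbil \<gamma> h * cbil \<gamma> x ^ (\<mu> \<gamma> - 1)) * (\<Prod>\<delta>\<in>A - {\<gamma>}. cbil \<delta> x ^ \<mu> \<delta>))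
     = (\<lambda>h. cbil (\<Sum>\<gamma>\<in>A. (of_nat (\<mu> \<gamma>) * cbil \<gamma> x ^ (\<mu> \<gamma> - 1) * (\<Prod>\<delta>\<in>A - {\<gamma>}. cbil \<delta> x ^ \<mu> \<delta>)) *s \<gamma>) h)"
    by (simp add: cbil_def sum.distrib[symmetric] sum_distrib_left sum_distrib_right algebra_simps)
  ultimately have "dir_deriv v (\<lambda>x. \<Prod>\<gamma>\<in>A. cbil \<gamma> x ^ \<mu> \<gamma>) x =
      cbil v (\<Sum>\<gamma>\<in>A. (of_nat (\<mu> \<gamma>) * cbil \<gamma> x ^ (\<mu> \<gamma> - 1) * (\<Prod>\<delta>\<in>A - {\<gamma>}. cbil \<delta> x ^ \<mu> \<delta>)) *s \<gamma>)"
    using dir_deriv_eqI by simp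
  also have "\<dots> = (\<Sum>\<gamma>\<in>A. of_nat (\<mu> \<gamma>) * cbil \<gamma> v * (cbil \<gamma> x ^ (\<mu> \<gamma> - 1) * (\<Prod>\<delta>\<in>A - {\<gamma>}. cbil \<delta> x ^ \<mu> \<delta>)))"
    by (simp add: cbil_def sum.distrib[symmetric] sum_distrib_left sum_distrib_right algebra_simps)
  finally show ?thesis .
qed

text \<open>Subtracting (l, l) removes the only part that raises the total degree by two.\<close>

lemma tderiv_laplacian_expand:
  assumes F: "polyfun_le d F"
  shows "tderiv (axis 1 1) (tderiv (axis 1 1) F) l x + tderiv (axis 2 1) (tderiv (axis 2 1) F) l x - cbil l l * F l x =
    dir_deriv (axis 1 1) (\<lambda>x. dir_deriv (axis 1 1) (F l) x) x
    + dir_deriv (axis 2 1) (\<lambda>x. dir_deriv (axis 2 1) (F l) x) x + 2 * dir_deriv l (F l) x"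
proof -
  have D: "polyfun_le d (\<lambda>l x. dir_deriv \<gamma> (F l) x)" for \<gamma>
    by (rule polyfun_le_dir_deriv' F)+
  have L: "polyfun_le (Suc d) (\<lambda>l x. cbil \<gamma> l * F l x)" for \<gamma>
    by (rule polyfun_le_linear_mult_l F)+
  have t: "tderiv \<gamma> (tderiv \<gamma> F) l x = dir_deriv \<gamma> (\<lambda>x. dir_deriv \<gamma> (F l) x) x
     + 2 * (cbil \<gamma> l * dir_deriv \<gamma> (F l) x) + cbil \<gamma> l * cbil \<gamma> l * F l x" for \<gamma>
    by (simp add: tderiv_def dir_deriv_add[OF D L] dir_deriv_cmult[OF F] algebra_simps)
  have D_l: "dir_deriv l (F l) x = l $ 1 * dir_deriv (axis 1 1) (F l) x + l $ 2 * dir_deriv (axis 2 1) (F l) x"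
  proof -
    have "l = l $ 1 *s axis 1 1 + l $ 2 *s axis 2 1"
      by (simp add: vec_eq_iff forall_2 axis_def)
    then show ?thesis
      using dir_deriv_linear[of "l $ 1" "axis 1 1" "l $ 2" "axis 2 1" "F l" x] by simp
  qed
  have c: "cbil (axis 1 1) l = l $ 1" "cbil (axis 2 1) l = l $ 2" "cbil l l = l $ 1 * l $ 1 + l $ 2 * l $ 2"
    by (simp_all add: cbil_def axis_def)
  show ?thesis unfolding t D_l c by (simp add: algebra_simps)
qed

lemma quasi_invariant_cmult:
  assumes "polyfun S F" "quasi_invariant A \<mu> F"
  shows "quasi_invariant A \<mu> (\<lambda>l x. c * F l x)"
  using assms(2) line_series_cmult[OF assms(1), of "\<lambda>_. c"] by (simp add: quasi_invariant_def)

text \<open>Modulo lower total degree, one step replaces A(x) M(l, x) by 2 A(x) \<partial>_l M(l,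
  x): the derivative of the factor A(x) is cancelled by the first-order terms of L. After N steps
  the other copy of A has been differentiated N times along l, which leaves 2^N N! A(x)
  A(l).\<close>

lemma cot_conditions_imp_admits_BA:
  assumes conf: "configuration A \<mu>" and "A \<noteq> {}" and cot: "cot_conditions A \<mu>"
  shows "admits_BA A \<mu>"
proof -
  have fin: "finite A" and pw: "pairwise (\<lambda>u v. \<not> proportional u v) A"
    and iso: "\<And>\<alpha>. \<alpha> \<in> A \<Longrightarrow> cbil \<alpha> \<alpha> \<noteq> 0" and pos: "\<And>\<alpha>. \<alpha> \<in> A \<Longrightarrow> 0 < \<mu> \<alpha>"
    using conf by (auto simp: configuration_def)
  define N where "N = sum \<mu> A"
  have N: "0 < N"
    unfolding N_def using fin \<open>A \<noteq> {}\<close> pos by (intro sum_pos) auto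
  define a :: "complex^2 \<Rightarrow> complex^2 \<Rightarrow> complex" where "a = (\<lambda>l x. \<Prod>\<gamma>\<in>A. cbil \<gamma> x ^ \<mu> \<gamma>)"
  \<comment> \<open>\<open>b \<gamma>\<close> is A(x) / (\<gamma>, x), written without
    division.\<close>
  define b where "b = (\<lambda>\<gamma> (l :: complex^2) x. cbil \<gamma> x ^ (\<mu> \<gamma> - 1) * (\<Prod>\<delta>\<in>A - {\<gamma>}. cbil \<delta> x ^ \<mu> \<delta>))"
  have pow_hom: "polyfun_hom k (\<lambda>l x. cbil \<gamma> x ^ k)" for \<gamma> k
    using polyfun_hom_power[OF polyfun_hom_linear_x, of k \<gamma>] by simp
  have pow_hom_l: "polyfun_hom k (\<lambda>l x. cbil \<gamma> l ^ k)" for \<gamma> k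
    using polyfun_hom_power[OF polyfun_hom_linear_l, of k \<gamma>] by simp
  have a_hom: "polyfun_hom N a"
    unfolding a_def N_def by (rule polyfun_hom_prod[OF fin pow_hom])
  have b_hom: "polyfun_hom (N - 1) (b \<gamma>)" if "\<gamma> \<in> A" for \<gamma>
  proof -
    have "polyfun_hom ((\<mu> \<gamma> - 1) + sum \<mu> (A - {\<gamma>})) (b \<gamma>)"
      unfolding b_def using fin by (intro polyfun_hom_mult polyfun_hom_prod pow_hom) auto
    moreover have "(\<mu> \<gamma> - 1) + sum \<mu> (A - {\<gamma>}) = N - 1"
      unfolding N_def using pos[OF that] sum.remove[OF fin that, of \<mu>] by simp
    ultimately show ?thesis by simp
  qed
  have ab: "cbil \<gamma> x * b \<gamma> l x = a l x" if "\<gamma> \<in> A" for \<gamma> l x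
    unfolding a_def b_def by (subst prod.remove[OF fin that]) (use pos[OF that] in \<open>simp add: power_eq_if\<close>)
  have a_le: "polyfun_le N a" by (rule polyfun_hom_imp_le[OF a_hom])
  define M where "M = (\<lambda>k. ((\<lambda>F l x. 2 * dir_deriv l (F l) x) ^^ k) a)"
  have M_Suc: "M (Suc k) = (\<lambda>l x. 2 * dir_deriv l (M k l) x)" and M_0: "M 0 = a" for k
    by (simp_all add: M_def)
  have M_le: "polyfun_le N (M k)" for k
    by (induction k) (auto simp: M_0 M_Suc a_le N intro!: polyfun_cmult polyfun_le_dir_deriv_diag)
  have M_line: "line_poly (M k l) x l = smult (2 ^ k) ((pderiv ^^ k) (line_poly (a l) x l))" for k l x
  proof (induction k)
    case (Suc k)
    have "line_poly (M (Suc k) l) x l = line_poly (\<lambda>x. 2 * dir_deriv l (M k l) x + 0 * dir_deriv l (M k l) x) x l"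
      by (simp add: M_Suc)
    also have "\<dots> = smult 2 (pderiv (line_poly (M k l) x l))"
      using line_poly_linear[OF polyfun_le_dir_deriv[OF M_le, of l] polyfun_le_dir_deriv[OF M_le, of l], of 2 k l 0 k x l]
      by (simp add: line_poly_dir_deriv[OF M_le])
    finally show ?case by (simp add: Suc pderiv_smult)
  qed (simp add: M_0)
  \<comment> \<open>A(x + t l) has degree at most N in t, and its coefficient at t^N is A(l); N
    derivatives along l leave N! times it.\<close>
  have M_N: "M N l x = 2 ^ N * fact N * (\<Prod>\<gamma>\<in>A. cbil \<gamma> l ^ \<mu> \<gamma>)" for l x
  proof -
    have la: "line_poly (a l) x l = (\<Prod>\<gamma>\<in>A. [:cbil \<gamma> x, cbil \<gamma> l:] ^ \<mu> \<gamma>)"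
      by (rule line_poly_eqI) (simp add: a_def poly_prod cbil_simps)
    have "M N l x = poly (line_poly (M N l) x l) 0"
      by (simp add: poly_line_poly[OF M_le])
    also have "\<dots> = 2 ^ N * (pochhammer 1 N * coeff (line_poly (a l) x l) N)"
      by (simp add: M_line poly_0_coeff_0 coeff_higher_pderiv)
    also have "coeff (line_poly (a l) x l) N = (\<Prod>\<gamma>\<in>A. cbil \<gamma> l ^ \<mu> \<gamma>)"
      unfolding la N_def by (rule conjunct2[OF coeff_prod_linear_power[OF fin]])
    finally show ?thesis by (simp add: pochhammer_fact)
  qed
  define H where "H = (\<lambda>k l x. a l x * M k l x)"
  have H_le: "polyfun_le (2 * N) (H k)" for k
    using polyfun_le_mult[OF a_le M_le] by (simp add: H_def mult_2)
  \<comment> \<open>Only the part of total degree 2N is tracked. The start A(x)^2 vanishes to order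
    \<open>2 * \<mu> \<alpha>\<close> on each line, which kills every coefficient in
    question.\<close>
  have ex: "\<exists>P. polyfun_le (2 * N) P \<and> quasi_invariant A \<mu> P \<and> polyfun_le (2 * N - 1) (\<lambda>l x. P l x - H k l x)" for k
  proof (induction k)
    case 0
    have "quasi_invariant A \<mu> (H 0)"
      unfolding quasi_invariant_iff
    proof (intro ballI allI impI)
      fix \<alpha> k l y assume \<alpha>: "\<alpha> \<in> A" and k: "k < 2 * \<mu> \<alpha>" and y: "cbil \<alpha> y = 0"
      define R where "R = (\<Prod>\<gamma>\<in>A - {\<alpha>}. [:cbil \<gamma> y, cbil \<gamma> \<alpha>:] ^ \<mu> \<gamma>)"
      have "line_poly (H 0 l) y \<alpha> = monom 1 (2 * \<mu> \<alpha>) * (smult (cbil \<alpha> \<alpha> ^ (2 * \<mu> \<alpha>)) (R * R))"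
        unfolding H_def M_0 a_def R_def
        by (rule line_poly_eqI, subst (1 2) prod.remove[OF fin \<alpha>])
          (simp add: y poly_prod poly_monom cbil_simps mult_2 mult_2_right power_add power_mult_distrib algebra_simps)
      then have "line_series (H 0) \<alpha> l y = fps_X ^ (2 * \<mu> \<alpha>) * (fps_of_poly (smult (cbil \<alpha> \<alpha> ^ (2 * \<mu> \<alpha>)) (R * R)) * fps_exp (cbil \<alpha> l))"
        by (simp add: line_series_def fps_of_poly_mult fps_of_poly_monom' mult.assoc)
      then show "fps_nth (line_series (H 0) \<alpha> l y) k = 0"
        using k by (simp add: fps_X_power_mult_nth)
    qed
    then show ?case
      using H_le[of 0] by (intro exI[of _ "H 0"]) (simp add: polyfun.zero)
  next
    case (Suc k)
    then obtain P where P: "polyfun_le (2 * N) P" and QP: "quasi_invariant A \<mu> P"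
      and PH: "polyfun_le (2 * N - 1) (\<lambda>l x. P l x - H k l x)" by blast
    have "\<exists>G. polyfun_le (2 * N) G \<and> (\<forall>l x. tderiv \<alpha> P l x = cbil \<alpha> x * G l x)" if \<alpha>: "\<alpha> \<in> A" for \<alpha>
    proof -
      have z: "tderiv \<alpha> P l x = 0" if "cbil \<alpha> x = 0" for l x
      proof -
        have "fps_nth (line_series P \<alpha> l x) 1 = 0"
          using QP \<alpha> pos[OF \<alpha>] that unfolding quasi_invariant_iff by auto
        then show ?thesis using tderiv_power_eq_nth[OF P, of 1 \<alpha> l x] by simp
      qed
      show ?thesis
        using polyfun_le_factor[OF iso[OF \<alpha>] polyfun_le_tderiv[OF P, of \<alpha>] z] by auto
    qed
    then obtain G where G: "\<And>\<alpha>. \<alpha> \<in> A \<Longrightarrow> polyfun_le (2 * N) (G \<alpha>)"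
      and PG: "\<And>\<alpha> l x. \<alpha> \<in> A \<Longrightarrow> tderiv \<alpha> P l x = cbil \<alpha> x * G \<alpha> l x" by metis
    define W where "W = (\<lambda>l x. tderiv (axis 1 1) (tderiv (axis 1 1) P) l x
           + tderiv (axis 2 1) (tderiv (axis 2 1) P) l x - cbil l l * P l x
           - (\<Sum>\<gamma>\<in>A. 2 * of_nat (\<mu> \<gamma>) * G \<gamma> l x))"
    have QW: "quasi_invariant A \<mu> W"
      unfolding W_def by (rule quasi_invariant_step[OF fin pw iso cot P QP G PG])
    define D2 where "D2 = (\<lambda>l x. dir_deriv (axis 1 1) (\<lambda>x. dir_deriv (axis 1 1) (P l) x) x
      + dir_deriv (axis 2 1) (\<lambda>x. dir_deriv (axis 2 1) (P l) x) x)"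
    have W_eq: "W l x = D2 l x + 2 * dir_deriv l (P l) x - (\<Sum>\<gamma>\<in>A. 2 * of_nat (\<mu> \<gamma>) * G \<gamma> l x)" for l x
      unfolding W_def D2_def tderiv_laplacian_expand[OF P] ..
    have D2: "polyfun_le (2 * N - 1) D2"
      unfolding D2_def by (intro polyfun_add polyfun_le_dir_deriv' polyfun_le_dir_deriv P)
    have W: "polyfun_le (2 * N) W"
    proof (rule polyfun_cong)
      show "polyfun_le (2 * N) (\<lambda>l x. D2 l x + 2 * dir_deriv l (P l) x - (\<Sum>\<gamma>\<in>A. 2 * of_nat (\<mu> \<gamma>) * G \<gamma> l x))"
        using N by (intro polyfun_diff polyfun_add polyfun_cmult polyfun_sum polyfun_le_mono[OF D2]
            polyfun_le_dir_deriv_diag P G) auto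
    qed (simp add: W_eq)
    define K where "K = (\<lambda>\<gamma> l x. b \<gamma> l x * M k l x)"
    \<comment> \<open>Determines the part of degree 2N of \<open>G \<gamma>\<close>: after removal
      of the expected term, the numerator \<open>Q\<close> still has degree at most 2N, so its
      quotient by (\<gamma>, x) has degree at most 2N - 1, and cancellation identifies this
      quotient.\<close>
    have GK: "polyfun_le (2 * N - 1) (\<lambda>l x. G \<gamma> l x - cbil \<gamma> l * K \<gamma> l x)" if \<gamma>: "\<gamma> \<in> A" for \<gamma>
    proof -
      define Q where "Q = (\<lambda>l x. dir_deriv \<gamma> (P l) x + cbil \<gamma> l * (P l x - H k l x))"
      have "polyfun_le (Suc (2 * N - 1)) Q"
        unfolding Q_def using N
        by (intro polyfun_add polyfun_le_linear_mult_l PH polyfun_le_mono[OF polyfun_le_dir_deriv'[OF P]]) auto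
      then have Q: "polyfun_le (2 * N) Q" using N by simp
      have K: "polyfun_le (2 * N) (\<lambda>l x. cbil \<gamma> l * K \<gamma> l x)"
        using polyfun_le_linear_mult_l[OF polyfun_le_mult[OF polyfun_hom_imp_le[OF b_hom[OF \<gamma>]] M_le[of k]], of \<gamma>] N
        by (simp add: K_def mult_2)
      have Q_eq: "Q l x = cbil \<gamma> x * (G \<gamma> l x - cbil \<gamma> l * K \<gamma> l x)" for l x
        using PG[OF \<gamma>, of l x] ab[OF \<gamma>, of x l]
        by (simp add: Q_def tderiv_def H_def K_def algebra_simps)
      obtain G' where G': "polyfun_le (2 * N - 1) G'" "\<And>l x. Q l x = cbil \<gamma> x * G' l x"
        using polyfun_le_factor[OF iso[OF \<gamma>] Q] Q_eq by auto
      have "G' l x = G \<gamma> l x - cbil \<gamma> l * K \<gamma> l x" for l x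
        by (rule polyfun_cancel[OF iso[OF \<gamma>] G'(1) polyfun_diff[OF G[OF \<gamma>] K]])
          (simp add: G'(2)[symmetric] Q_eq)
      with G'(1) show ?thesis by (rule polyfun_cong)
    qed
    \<comment> \<open>Product rule: the derivative of A(x) produces precisely the top part of the
      sum over \<open>G\<close>, and the derivative of \<open>M k\<close> produces
      \<open>H (Suc k)\<close>.\<close>
    have dH: "2 * dir_deriv l (H k l) x = 2 * (\<Sum>\<gamma>\<in>A. of_nat (\<mu> \<gamma>) * (cbil \<gamma> l * K \<gamma> l x)) + H (Suc k) l x" for l x
    proof -
      have "dir_deriv l (H k l) x = dir_deriv l (a l) x * M k l x + a l x * dir_deriv l (M k l) x"
        unfolding H_def by (rule dir_deriv_polyfun_mult[OF a_le M_le])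
      moreover have "dir_deriv l (a l) x = (\<Sum>\<gamma>\<in>A. of_nat (\<mu> \<gamma>) * cbil \<gamma> l * b \<gamma> l x)"
        unfolding a_def b_def by (rule dir_deriv_prod_power[OF fin])
      ultimately show ?thesis
        by (simp add: H_def M_Suc K_def sum_distrib_right sum_distrib_left algebra_simps)
    qed
    have "polyfun_le (2 * N - 1) (\<lambda>l x. D2 l x + 2 * dir_deriv l (\<lambda>x. P l x - H k l x) x
        - (\<Sum>\<gamma>\<in>A. 2 * of_nat (\<mu> \<gamma>) * (G \<gamma> l x - cbil \<gamma> l * K \<gamma> l x)))"
      using N by (intro polyfun_diff polyfun_add D2 polyfun_cmult polyfun_sum polyfun_le_dir_deriv_diag PH GK) auto
    then have "polyfun_le (2 * N - 1) (\<lambda>l x. W l x - H (Suc k) l x)"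
    proof (rule polyfun_cong)
      fix l x
      have "dir_deriv l (\<lambda>x. P l x - H k l x) x = dir_deriv l (P l) x - dir_deriv l (H k l) x"
        using dir_deriv_add[OF P polyfun_cmult[OF H_le, of "-1"], of l l k x] dir_deriv_cmult[OF H_le, of l "-1" k l x]
        by simp
      then have P_split: "2 * dir_deriv l (P l) x = 2 * dir_deriv l (\<lambda>x. P l x - H k l x) x +
          (2 * (\<Sum>\<gamma>\<in>A. of_nat (\<mu> \<gamma>) * (cbil \<gamma> l * K \<gamma> l x)) + H (Suc k) l x)"
        unfolding dH[symmetric] by simp
      show "D2 l x + 2 * dir_deriv l (\<lambda>x. P l x - H k l x) x
        - (\<Sum>\<gamma>\<in>A. 2 * of_nat (\<mu> \<gamma>) * (G \<gamma> l x - cbil \<gamma> l * K \<gamma> l x)) = W l x - H (Suc k) l x"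
        by (simp add: W_eq P_split sum_subtractf sum_distrib_left algebra_simps)
    qed
    with W QW show ?case by blast
  qed
  obtain P where P: "polyfun_le (2 * N) P" and QP: "quasi_invariant A \<mu> P"
    and PH: "polyfun_le (2 * N - 1) (\<lambda>l x. P l x - H N l x)" using ex by blast
  define c :: complex where "c = 1 / (2 ^ N * fact N)"
  have c: "c * (2 ^ N * fact N) = 1" by (simp add: c_def)
  define h where "h = (\<lambda>l x. \<Prod>\<alpha>\<in>A. cbil \<alpha> l ^ \<mu> \<alpha> * cbil \<alpha> x ^ \<mu> \<alpha>)"
  have cH: "c * H N l x = h l x" for l x
  proof -
    have "c * H N l x = (c * (2 ^ N * fact N)) * (a l x * (\<Prod>\<gamma>\<in>A. cbil \<gamma> l ^ \<mu> \<gamma>))"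
      by (simp add: H_def M_N)
    then show ?thesis by (simp add: c h_def a_def prod.distrib)
  qed
  have h_hom: "polyfun_hom (2 * N) h"
  proof -
    have "polyfun_hom (\<Sum>\<alpha>\<in>A. \<mu> \<alpha> + \<mu> \<alpha>) h"
      unfolding h_def by (intro polyfun_hom_prod fin polyfun_hom_mult pow_hom pow_hom_l)
    then show ?thesis by (simp add: N_def sum.distrib mult_2)
  qed
  obtain v where v: "\<And>\<alpha>. \<alpha> \<in> A \<Longrightarrow> cbil \<alpha> v \<noteq> 0"
    using exists_nonorthogonal_vector[OF fin] iso by (metis cbil_smult_left mult_zero_left vector_smult_lzero)
  have "polynomial_with_highest_term (\<lambda>l x. c * P l x) h"
  proof (rule polynomial_with_highest_termI)
    show "h v v \<noteq> 0" using v fin by (simp add: h_def)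
    show "polyfun_hom (Suc (2 * N - 1)) h" using h_hom N by simp
    have "polyfun_le (2 * N - 1) (\<lambda>l x. c * (P l x - H N l x))" by (rule polyfun_cmult[OF PH])
    then show "polyfun_le (2 * N - 1) (\<lambda>l x. c * P l x - h l x)"
      by (rule polyfun_cong) (simp add: cH[symmetric] algebra_simps)
  qed
  moreover have "quasi_invariant A \<mu> (\<lambda>l x. c * P l x)"
    by (rule quasi_invariant_cmult[OF P QP])
  ultimately show ?thesis
    unfolding admits_BA_iff h_def by blast
qed

subsection \<open>Vanishing orders and factorisation\<close>

definition deg_l :: "nat \<times> nat \<times> nat \<times> nat \<Rightarrow> nat" where
  "deg_l = (\<lambda>(i, j, p, q). i + j)"

definition deg_x :: "nat \<times> nat \<times> nat \<times> nat \<Rightarrow> nat" where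
  "deg_x = (\<lambda>(i, j, p, q). p + q)"

lemma total_eq_deg: "total e = deg_l e + deg_x e"
  by (cases e) (simp add: total_def deg_l_def deg_x_def)

lemma monom4_scale: "monom4 e (\<tau> *s l) (\<rho> *s x) = \<tau> ^ deg_l e * \<rho> ^ deg_x e * monom4 e l x"
  by (cases e) (simp add: monom4_def deg_l_def deg_x_def power_mult_distrib power_add algebra_simps)

lemma monom4_scale_l: "monom4 e (\<tau> *s l) x = \<tau> ^ deg_l e * monom4 e l x"
  using monom4_scale[of e \<tau> l 1 x] by simp

lemma polyfun_monom4: "polyfun UNIV (monom4 e)"
  using polyfun_monom[of e UNIV 1] by simp

lemma polyfun_line_l:
  assumes "polyfun S F"
  shows "\<exists>p. \<forall>t. F (l + t *s v) x = poly p t"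
  using assms
proof (induction rule: polyfun.induct)
  case zero
  show ?case by (rule exI[of _ 0]) simp
next
  case (add_monom F e c)
  then obtain r where "\<forall>t. F (l + t *s v) x = poly r t" by blast
  moreover obtain i j p q where "e = (i, j, p, q)" by (cases e)
  ultimately show ?case
    by (intro exI[of _ "r + [:c * x $ 1 ^ p * x $ 2 ^ q:] * [:l $ 1, v $ 1:] ^ i * [:l $ 2, v $ 2:] ^ j"])
      (simp add: monom4_def algebra_simps)
qed

lemma polyfun_le_fix_l: "polyfun_le d F \<Longrightarrow> polyfun_le d (\<lambda>l. F v)"
proof (induction rule: polyfun.induct)
  case zero
  show ?case by (rule polyfun.zero)
next
  case (add_monom F e c)
  obtain i j p q where e: "e = (i, j, p, q)" by (cases e)
  have "polyfun_le d (\<lambda>l x. F v x + (c * v $ 1 ^ i * v $ 2 ^ j) * monom4 (0, 0, p, q) l x)"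
    using add_monom by (intro polyfun.add_monom) (auto simp: total_def e)
  then show ?case by (rule polyfun_cong) (simp add: e monom4_def)
qed

text \<open>The exponential is invariant under (\<tau> l, x / \<tau>), while the line parameter is
  multiplied by \<tau>. The power \<open>\<tau> ^ deg_x e\<close> stands on the left to avoid
  negative exponents.\<close>

lemma line_series_monom4_scale:
  assumes "\<tau> \<noteq> 0"
  shows "\<tau> ^ deg_x e * fps_nth (line_series (monom4 e) \<alpha> (\<tau> *s l) (inverse \<tau> *s y)) k =
         \<tau> ^ (deg_l e + k) * fps_nth (line_series (monom4 e) \<alpha> l y) k"
proof -
  define p where "p = line_poly (monom4 e l) y \<alpha>"
  define c where "c = \<tau> ^ deg_l e * inverse \<tau> ^ deg_x e"
  have "line_poly (monom4 e (\<tau> *s l)) (inverse \<tau> *s y) \<alpha> = smult c (pcompose p [:0, \<tau>:])"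
  proof (rule line_poly_eqI)
    fix t
    have "inverse \<tau> *s y + t *s \<alpha> = inverse \<tau> *s (y + (t * \<tau>) *s \<alpha>)"
      using assms by (simp add: vec_eq_iff field_simps)
    show "monom4 e (\<tau> *s l) (inverse \<tau> *s y + t *s \<alpha>) = poly (smult c (pcompose p [:0, \<tau>:])) t"
      unfolding \<open>inverse \<tau> *s y + t *s \<alpha> = _\<close> monom4_scale
      by (simp add: poly_pcompose p_def c_def poly_line_poly[OF polyfun_monom4])
  qed
  then have "fps_nth (line_series (monom4 e) \<alpha> (\<tau> *s l) (inverse \<tau> *s y)) k =
      (\<Sum>i=0..k. c * (\<tau> ^ i * coeff p i) * ((\<tau> * cbil \<alpha> l) ^ (k - i) / fact (k - i)))"
    by (simp add: line_series_def fps_mult_nth coeff_pcompose_linear cbil_simps)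
  also have "\<dots> = (\<Sum>i=0..k. c * \<tau> ^ k * (coeff p i * (cbil \<alpha> l ^ (k - i) / fact (k - i))))"
  proof (rule sum.cong[OF refl])
    fix i assume "i \<in> {0..k}"
    then have "\<tau> ^ k = \<tau> ^ i * \<tau> ^ (k - i)" by (simp flip: power_add)
    then show "c * (\<tau> ^ i * coeff p i) * ((\<tau> * cbil \<alpha> l) ^ (k - i) / fact (k - i)) =
        c * \<tau> ^ k * (coeff p i * (cbil \<alpha> l ^ (k - i) / fact (k - i)))"
      by (simp add: power_mult_distrib)
  qed
  also have "\<dots> = c * \<tau> ^ k * fps_nth (line_series (monom4 e) \<alpha> l y) k"
    by (simp add: line_series_def fps_mult_nth sum_distrib_left p_def)
  finally show ?thesis
    using assms by (simp add: c_def power_add field_simps)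
qed

lemma coeff_sum_monom:
  assumes "finite I"
  shows "coeff (\<Sum>i\<in>I. monom (f i) (d i)) n = (\<Sum>i | i \<in> I \<and> d i = n. f i)"
proof -
  have "coeff (\<Sum>i\<in>I. monom (f i) (d i)) n = (\<Sum>i\<in>I. if d i = n then f i else 0)"
    by (simp add: coeff_sum)
  also have "\<dots> = (\<Sum>i | i \<in> I \<and> d i = n. f i)"
    using assms by (simp add: sum.If_cases Int_def)
  finally show ?thesis .
qed

text \<open>
  The induction step replaces the function \<open>f(t)\<close> with vanishing odd coefficients by \<open>f'(t) / t\<close>,
  which multiplies the top coefficient in \<open>\<theta>\<close> by \<open>a / t\<close>.
\<close>

lemma low_coeffs_top_zero:
  fixes q :: "nat \<Rightarrow> complex poly"
  assumes "a \<noteq> 0"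
    and "\<And>\<theta> k. odd k \<Longrightarrow> k < 2 * m \<Longrightarrow>
      fps_nth (fps_of_poly (\<Sum>i\<le>K. smult (\<theta> ^ i) (q i)) * fps_exp (\<theta> * a)) k = 0"
    and "j < m"
  shows "coeff (q K) j = 0"
  using assms(2,3)
proof (induction m arbitrary: q K j)
  case (Suc m)
  \<comment> \<open>Padding by zero beyond \<open>K\<close> gives
    \<open>r (Suc K) = smult a (q K)\<close>: differentiation raises the degree in \<theta> by one
    and multiplies the top coefficient by \<open>a\<close>.\<close>
  define q' where "q' = (\<lambda>i. if i \<le> K then q i else 0)"
  define r where "r = (\<lambda>i. pderiv (q' i) + (if i = 0 then 0 else smult a (q' (i - 1))))"
  define p where "p = (\<lambda>\<theta>. \<Sum>i\<le>K. smult (\<theta> ^ i) (q i))"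
  define f where "f = (\<lambda>\<theta>. fps_of_poly (p \<theta>) * fps_exp (\<theta> * a))"
  have f0: "fps_nth (f \<theta>) k = 0" if "odd k" "k < 2 * Suc m" for \<theta> k
    using Suc.prems(1)[OF that] by (simp add: f_def p_def)
  have p: "(\<Sum>i\<le>Suc K. smult (\<theta> ^ i) (r i)) = pderiv (p \<theta>) + smult (\<theta> * a) (p \<theta>)" for \<theta>
  proof -
    have "p \<theta> = (\<Sum>i\<le>Suc K. smult (\<theta> ^ i) (q' i))" by (simp add: p_def q'_def)
    then have 1: "pderiv (p \<theta>) = (\<Sum>i\<le>Suc K. smult (\<theta> ^ i) (pderiv (q' i)))"
      using higher_pderiv_sum[of 1 "\<lambda>i. smult (\<theta> ^ i) (q' i)" "{..Suc K}"] by (simp add: pderiv_smult del: sum.atMost_Suc)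
    have "smult (\<theta> * a) (p \<theta>) = (\<Sum>i\<le>K. smult (\<theta> ^ Suc i) (smult a (q' i)))"
      unfolding p_def by (rule poly_eqI) (simp add: q'_def coeff_sum sum_distrib_left ac_simps)
    also have "\<dots> = (\<Sum>i\<le>Suc K. smult (\<theta> ^ i) (if i = 0 then 0 else smult a (q' (i - 1))))"
      by (subst sum.atMost_Suc_shift) simp
    finally show ?thesis
      using 1 by (simp only: r_def smult_add_right sum.distrib)
  qed
  have f': "fps_deriv (f \<theta>) = fps_of_poly (\<Sum>i\<le>Suc K. smult (\<theta> ^ i) (r i)) * fps_exp (\<theta> * a)" for \<theta>
    unfolding p by (simp add: f_def fps_of_poly_add fps_of_poly_smult fps_of_poly_pderiv algebra_simps)
  \<comment> \<open>f'(0) vanishes for all \<theta>, so each of its coefficients in \<theta> does,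
    and every \<open>r i\<close> is divisible by t.\<close>
  have r0: "coeff (r i) 0 = 0" if "i \<le> Suc K" for i
  proof -
    have "poly (\<Sum>i\<le>Suc K. monom (coeff (r i) 0) i) \<theta> = 0" for \<theta>
    proof -
      have "0 = fps_nth (fps_deriv (f \<theta>)) 0" using f0[of 1 \<theta>] by simp
      also have "\<dots> = (\<Sum>i\<le>Suc K. \<theta> ^ i * coeff (r i) 0)"
        unfolding f' by (simp add: coeff_sum del: sum.atMost_Suc)
      finally show ?thesis by (simp add: poly_sum poly_monom mult.commute del: sum.atMost_Suc)
    qed
    then have "(\<Sum>i\<le>Suc K. monom (coeff (r i) 0) i) = 0"
      by (simp add: poly_all_0_iff_0[symmetric] del: sum.atMost_Suc)
    then have "coeff (\<Sum>i\<le>Suc K. monom (coeff (r i) 0) i) i = 0" by simp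
    moreover have "{j. j \<in> {..Suc K} \<and> j = i} = {i}" using that by auto
    ultimately show ?thesis by (subst (asm) coeff_sum_monom) (simp_all del: sum.atMost_Suc)
  qed
  define s where "s = (\<lambda>i. poly_shift 1 (r i))"
  have rs: "r i = [:0, 1:] * s i" if "i \<le> Suc K" for i
    using r0[OF that] by (intro poly_eqI) (auto simp: s_def coeff_poly_shift coeff_pCons split: nat.splits)
  have "coeff (s (Suc K)) i = 0" if "i < m" for i
  proof (rule Suc.IH[OF _ that])
    fix \<theta> k assume k: "odd k" "k < 2 * m"
    have "(\<Sum>i\<le>Suc K. smult (\<theta> ^ i) (r i)) = [:0, 1:] * (\<Sum>i\<le>Suc K. smult (\<theta> ^ i) (s i))"
      unfolding sum_distrib_left by (rule sum.cong) (use rs in auto)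
    then have "fps_deriv (f \<theta>) = fps_X * (fps_of_poly (\<Sum>i\<le>Suc K. smult (\<theta> ^ i) (s i)) * fps_exp (\<theta> * a))"
      unfolding f' by (simp only: fps_of_poly_mult fps_of_poly_fps_X mult.assoc)
    then have "fps_nth (fps_of_poly (\<Sum>i\<le>Suc K. smult (\<theta> ^ i) (s i)) * fps_exp (\<theta> * a)) k =
        fps_nth (fps_deriv (f \<theta>)) (Suc k)" by (simp del: fps_deriv_nth)
    also have "\<dots> = 0" using f0[of "k + 2" \<theta>] k by simp
    finally show "fps_nth (fps_of_poly (\<Sum>i\<le>Suc K. smult (\<theta> ^ i) (s i)) * fps_exp (\<theta> * a)) k = 0" .
  qed
  \<comment> \<open>Multiplying back by t shifts the \<open>m\<close> vanishing coefficients up by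
    one and adds a further one at zero.\<close>
  then have "coeff (r (Suc K)) j = 0"
    using r0[of "Suc K"] Suc.prems(2) by (cases j) (auto simp: rs)
  then show ?case using \<open>a \<noteq> 0\<close> by (simp add: r_def q'_def)
qed simp

text \<open>A factor that does not vanish at zero leaves the order of vanishing unchanged.\<close>

lemma coeff_linear_mult_eq_0:
  fixes p :: "'a :: field poly"
  assumes "b \<noteq> 0" "\<And>j. j < m \<Longrightarrow> coeff ([:b, c:] * p) j = 0" "j < m"
  shows "coeff p j = 0"
  using assms(3)
proof (induction j)
  case 0
  then show ?case using assms(1) assms(2)[of 0] by simp
next
  case (Suc j)
  then show ?case using assms(1) assms(2)[of "Suc j"] by simp
qed

text \<open>The linear forms are split off one at a time. Dividing by (\<gamma>, x) lowers the order
  on the line of \<gamma> by one and keeps it on the others, where (\<gamma>, y) is nonzero for y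
  off the origin. Since the degree is at most the sum of the orders, a constant remains.\<close>

lemma polyfun_factorisation:
  fixes S :: "(complex^2) set" and \<nu> :: "complex^2 \<Rightarrow> nat"
  assumes fin: "finite S" and pw: "pairwise (\<lambda>u v. \<not> proportional u v) S"
    and iso: "\<And>\<gamma>. \<gamma> \<in> S \<Longrightarrow> cbil \<gamma> \<gamma> \<noteq> 0"
    and f: "polyfun_le (sum \<nu> S) (\<lambda>l. f)"
    and zero: "\<And>\<gamma> y j. \<gamma> \<in> S \<Longrightarrow> y \<noteq> 0 \<Longrightarrow> cbil \<gamma> y = 0 \<Longrightarrow> j < \<nu> \<gamma> \<Longrightarrow> coeff (line_poly f y \<gamma>) j = 0"
  shows "\<exists>c. \<forall>x. f x = c * (\<Prod>\<gamma>\<in>S. cbil \<gamma> x ^ \<nu> \<gamma>)"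
  using f zero
proof (induction "sum \<nu> S" arbitrary: \<nu> f)
  case 0
  have \<nu>: "\<nu> \<gamma> = 0" if "\<gamma> \<in> S" for \<gamma> using 0(1) that fin by simp
  have "\<exists>c. F = (\<lambda>l x. c)" if "polyfun_le 0 F" for F
    using that
  proof (induction rule: polyfun.induct)
    case (add_monom F e c)
    then obtain b where "F = (\<lambda>l x. b)" by blast
    moreover have "e = (0, 0, 0, 0)" using add_monom(2) by (cases e) (simp add: total_def)
    ultimately show ?case by (auto simp: monom4_def)
  qed auto
  moreover have "polyfun_le 0 (\<lambda>l. f)" using 0(1,2) by simp
  ultimately obtain c where "(\<lambda>l::complex^2. f) = (\<lambda>l x. c)" by blast
  then have "f = (\<lambda>x. c)" by (rule fun_cong)
  then show ?case using \<nu> by (intro exI[of _ c]) simp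
next
  case (Suc d)
  obtain \<gamma> where \<gamma>: "\<gamma> \<in> S" "\<nu> \<gamma> \<noteq> 0"
    using Suc.hyps(2) by (metis nat.distinct(1) sum.neutral)
  define \<kappa> where "\<kappa> = cbil \<gamma> \<gamma>"
  have \<kappa>: "\<kappa> \<noteq> 0" using iso \<gamma> by (simp add: \<kappa>_def)
  have f: "polyfun_le (Suc d) (\<lambda>l. f)" using Suc.prems(1) Suc.hyps(2) by simp
  have f_zero: "f y = 0" if y: "cbil \<gamma> y = 0" for y
  proof -
    \<comment> \<open>The assumption on orders leaves out the origin, where all lines meet; it is
      recovered from the restriction to the line.\<close>
    have nz: "f z = 0" if "cbil \<gamma> z = 0" "z \<noteq> 0" for z
    proof -
      have "coeff (line_poly f z \<gamma>) 0 = 0" using Suc.prems(2)[OF \<gamma>(1) that(2,1)] \<gamma>(2) by simp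
      then show ?thesis using poly_line_poly[OF f, of z \<gamma> 0] by (simp add: poly_0_coeff_0)
    qed
    have pz: "perp \<gamma> \<noteq> 0" using \<kappa> unfolding \<kappa>_def by (auto simp: vec_eq_iff forall_2 perp_def cbil_def)
    have "line_poly f 0 (perp \<gamma>) = 0"
    proof (rule poly_eq_0_off_0)
      fix t :: complex assume "t \<noteq> 0"
      then have "t *s perp \<gamma> \<noteq> 0" using pz by (simp add: vec_eq_iff)
      then show "poly (line_poly f 0 (perp \<gamma>)) t = 0"
        using poly_line_poly[OF f, of 0 "perp \<gamma>" t] by (simp add: nz cbil_simps)
    qed
    moreover obtain \<eta> where "y = \<eta> *s perp \<gamma>"
      using orthogonal_imp_perp_multiple[OF y] \<kappa> unfolding \<kappa>_def by blast
    ultimately show ?thesis using poly_line_poly[OF f, of 0 "perp \<gamma>" \<eta>] by simp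
  qed
  obtain G where G: "polyfun_le d G" "\<And>l x. f x = cbil \<gamma> x * G l x"
    using polyfun_le_factor[OF iso[OF \<gamma>(1)] f f_zero] by auto
  define g where "g = G 0"
  have g: "polyfun_le d (\<lambda>l. g)" unfolding g_def by (rule polyfun_le_fix_l[OF G(1)])
  have fg: "f = (\<lambda>x. cbil \<gamma> x * g x)" using G(2) by (auto simp: g_def)
  define \<nu>' where "\<nu>' = \<nu>(\<gamma> := \<nu> \<gamma> - 1)"
  have "sum \<nu>' (S - {\<gamma>}) = sum \<nu> (S - {\<gamma>})" by (rule sum.cong) (auto simp: \<nu>'_def)
  then have sum': "d = sum \<nu>' S"
    using Suc.hyps(2) \<gamma>(2) sum.remove[OF fin \<gamma>(1), of \<nu>] sum.remove[OF fin \<gamma>(1), of \<nu>']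
    by (simp add: \<nu>'_def)
  have line: "line_poly f y \<delta> = [:cbil \<gamma> y, cbil \<gamma> \<delta>:] * line_poly g y \<delta>" for y \<delta>
    unfolding fg line_poly_mult[OF polyfun_hom_linear_x g] line_poly_cbil ..
  have "\<exists>c. \<forall>x. g x = c * (\<Prod>\<gamma>\<in>S. cbil \<gamma> x ^ \<nu>' \<gamma>)"
  proof (rule Suc.hyps(1)[OF sum'])
    show "polyfun_le (sum \<nu>' S) (\<lambda>l. g)" using g sum' by simp
    fix \<delta> y j assume \<delta>: "\<delta> \<in> S" and y: "y \<noteq> 0" "cbil \<delta> y = 0" and j: "j < \<nu>' \<delta>"
    show "coeff (line_poly g y \<delta>) j = 0"
    proof (cases "\<delta> = \<gamma>")
      case True
      then have "coeff (line_poly f y \<gamma>) (Suc j) = 0"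
        using j y Suc.prems(2)[OF \<gamma>(1)] by (simp add: \<nu>'_def)
      then show ?thesis using True y \<kappa> line[of y \<gamma>] by (simp add: \<kappa>_def)
    next
      case False
      obtain \<eta> where \<eta>: "y = \<eta> *s perp \<delta>"
        using orthogonal_imp_perp_multiple[OF y(2) iso[OF \<delta>]] by blast
      have "cbil \<gamma> (perp \<delta>) \<noteq> 0"
        using pw False \<delta> \<gamma> iso by (intro cbil_perp_neq_0) (auto simp: pairwise_def)
      then have b: "cbil \<gamma> y \<noteq> 0" using \<eta> y(1) by (auto simp: cbil_simps)
      show ?thesis
        by (rule coeff_linear_mult_eq_0[OF b, of "\<nu> \<delta>" "cbil \<gamma> \<delta>"])
          (use False j Suc.prems(2)[OF \<delta> y] line[of y \<delta>] in \<open>auto simp: \<nu>'_def\<close>)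
    qed
  qed
  then obtain c where c: "\<And>x. g x = c * (\<Prod>\<gamma>\<in>S. cbil \<gamma> x ^ \<nu>' \<gamma>)" by blast
  have "f x = c * (\<Prod>\<gamma>\<in>S. cbil \<gamma> x ^ \<nu> \<gamma>)" for x
  proof -
    have 1: "(\<Prod>\<delta>\<in>S - {\<gamma>}. cbil \<delta> x ^ \<nu>' \<delta>) = (\<Prod>\<delta>\<in>S - {\<gamma>}. cbil \<delta> x ^ \<nu> \<delta>)"
      by (rule prod.cong) (auto simp: \<nu>'_def)
    have 2: "cbil \<gamma> x * cbil \<gamma> x ^ \<nu>' \<gamma> = cbil \<gamma> x ^ \<nu> \<gamma>"
      using \<gamma>(2) by (cases "\<nu> \<gamma>") (simp_all add: \<nu>'_def)
    have "f x = c * (cbil \<gamma> x * (\<Prod>\<delta>\<in>S. cbil \<delta> x ^ \<nu>' \<delta>))"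
      unfolding fg c by (rule mult.left_commute)
    also have "(\<Prod>\<delta>\<in>S. cbil \<delta> x ^ \<nu>' \<delta>) = cbil \<gamma> x ^ \<nu>' \<gamma> * (\<Prod>\<delta>\<in>S - {\<gamma>}. cbil \<delta> x ^ \<nu> \<delta>)"
      unfolding 1[symmetric] by (rule prod.remove[OF fin \<gamma>(1)])
    also have "cbil \<gamma> x * \<dots> = cbil \<gamma> x ^ \<nu> \<gamma> * (\<Prod>\<delta>\<in>S - {\<gamma>}. cbil \<delta> x ^ \<nu> \<delta>)"
      by (simp only: mult.assoc[symmetric] 2)
    also have "\<dots> = (\<Prod>\<delta>\<in>S. cbil \<delta> x ^ \<nu> \<delta>)"
      by (rule prod.remove[OF fin \<gamma>(1), symmetric])
    finally show ?thesis .
  qed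
  then show ?case by blast
qed

subsection \<open>Necessary conditions\<close>

lemma line_series_sum_monom4:
  "line_series (\<lambda>l x. \<Sum>e\<in>I. c e * monom4 e l x) \<alpha> l y =
     (\<Sum>e\<in>I. fps_const (c e) * line_series (monom4 e) \<alpha> l y)"
proof -
  have "polyfun UNIV (\<lambda>l x. c e * monom4 e l x)" for e
    by (rule polyfun_monom) simp
  then show ?thesis
    by (simp add: line_series_sum[of _ UNIV] line_series_cmult[OF polyfun_monom4, of "\<lambda>_. c e" e for e])
qed

text \<open>
  Rescaling \<open>(l, x)\<close> to \<open>(\<tau> l, x / \<tau>)\<close> preserves quasi-invariance, so the part of weight
  zero of a quasi-invariant polynomial is quasi-invariant.
\<close>

lemma quasi_invariant_weight_zero:
  assumes QI: "quasi_invariant A \<mu> P"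
    and P: "P = (\<lambda>l x. \<Sum>e | total e \<le> d. c e * monom4 e l x)"
  shows "quasi_invariant A \<mu> (\<lambda>l x. \<Sum>e | total e \<le> d \<and> deg_l e = deg_x e. c e * monom4 e l x)"
  unfolding quasi_invariant_iff
proof (intro ballI allI impI)
  fix \<alpha> k l y assume \<alpha>: "\<alpha> \<in> A" and k: "odd k" "k < 2 * \<mu> \<alpha>" and y: "cbil \<alpha> y = 0"
  define z where "z = (\<lambda>e. fps_nth (line_series (monom4 e) \<alpha> l y) k)"
  define I where "I = {e. total e \<le> d}"
  have fin: "finite I" by (simp add: I_def finite_total)
  \<comment> \<open>The condition at the rescaled point, cleared of negative powers by the factor
    \<open>\<tau> ^ d\<close>; weight zero then sits at exponent \<open>d\<close>. The subtraction
    is not truncated because \<open>deg_x e\<close> is at most \<open>d\<close>.\<close>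
  have "(\<Sum>e\<in>I. monom (c e * z e) (d + deg_l e - deg_x e)) = 0"
  proof (rule poly_eq_0_off_0)
    fix \<tau> :: complex assume \<tau>: "\<tau> \<noteq> 0"
    have "cbil \<alpha> (inverse \<tau> *s y) = 0" using y by (simp add: cbil_simps)
    then have "fps_nth (line_series P \<alpha> (\<tau> *s l) (inverse \<tau> *s y)) k = 0"
      using QI \<alpha> k unfolding quasi_invariant_iff by blast
    then have "0 = \<tau> ^ d * (\<Sum>e\<in>I. c e * fps_nth (line_series (monom4 e) \<alpha> (\<tau> *s l) (inverse \<tau> *s y)) k)"
      unfolding P line_series_sum_monom4 by (simp add: fps_sum_nth I_def)
    also have "\<dots> = (\<Sum>e\<in>I. \<tau> ^ k * (c e * z e * \<tau> ^ (d + deg_l e - deg_x e)))"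
      unfolding sum_distrib_left
    proof (rule sum.cong[OF refl])
      fix e assume "e \<in> I"
      then have e: "deg_x e \<le> d" by (simp add: I_def total_eq_deg)
      then have "\<tau> ^ d = \<tau> ^ (d - deg_x e) * \<tau> ^ deg_x e" by (simp flip: power_add)
      moreover have "\<tau> ^ (d + deg_l e - deg_x e) = \<tau> ^ (d - deg_x e) * \<tau> ^ deg_l e"
        using e by (simp flip: power_add)
      ultimately show "\<tau> ^ d * (c e * fps_nth (line_series (monom4 e) \<alpha> (\<tau> *s l) (inverse \<tau> *s y)) k) =
          \<tau> ^ k * (c e * z e * \<tau> ^ (d + deg_l e - deg_x e))"
        using line_series_monom4_scale[OF \<tau>, of e \<alpha> l y k]
        by (simp add: z_def power_add)
    qed
    finally have "\<tau> ^ k * (\<Sum>e\<in>I. c e * z e * \<tau> ^ (d + deg_l e - deg_x e)) = 0"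
      by (simp only: sum_distrib_left)
    then show "poly (\<Sum>e\<in>I. monom (c e * z e) (d + deg_l e - deg_x e)) \<tau> = 0"
      using \<tau> by (simp add: poly_sum poly_monom)
  qed
  then have "coeff (\<Sum>e\<in>I. monom (c e * z e) (d + deg_l e - deg_x e)) d = 0" by simp
  then have "(\<Sum>e | e \<in> I \<and> d + deg_l e - deg_x e = d. c e * z e) = 0"
    by (simp only: coeff_sum_monom[OF fin])
  moreover have "{e. e \<in> I \<and> d + deg_l e - deg_x e = d} = {e. total e \<le> d \<and> deg_l e = deg_x e}"
    by (auto simp: I_def total_eq_deg)
  ultimately show "fps_nth (line_series (\<lambda>l x. \<Sum>e | total e \<le> d \<and> deg_l e = deg_x e. c e * monom4 e l x) \<alpha> l y) k = 0"
    unfolding line_series_sum_monom4 by (simp add: fps_sum_nth z_def)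
qed

text \<open>The delicate point is that the multiple \<open>C\<close> of A(x) / (\<alpha>, x) is
  nonzero. It follows from the power \<theta>^N of the condition on the line of \<alpha> for general
  l, which ties D_(N-1) to the highest term and gives D_(N-1)(\<beta>, \<beta>) = - (\<alpha>,
  \<alpha>) b(\<beta>)^2.\<close>

lemma admits_BA_imp_cot_sum:
  assumes conf: "configuration A \<mu>" and BA: "admits_BA A \<mu>" and \<alpha>: "\<alpha> \<in> A" "\<mu> \<alpha> = 1"
  shows "(\<Sum>\<gamma>\<in>A - {\<alpha>}. of_nat (\<mu> \<gamma>) * (cbil \<gamma> \<alpha> / cbil \<gamma> (perp \<alpha>))) = 0"
proof -
  have fin: "finite A" and pw: "pairwise (\<lambda>u v. \<not> proportional u v) A"
    and iso: "\<And>\<alpha>. \<alpha> \<in> A \<Longrightarrow> cbil \<alpha> \<alpha> \<noteq> 0" and pos: "\<And>\<alpha>. \<alpha> \<in> A \<Longrightarrow> 0 < \<mu> \<alpha>"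
    using conf by (auto simp: configuration_def)
  define S where "S = A - {\<alpha>}"
  have finS: "finite S" using fin by (simp add: S_def)
  define N where "N = sum \<mu> A"
  have N: "N = Suc (sum \<mu> S)"
    unfolding N_def S_def using sum.remove[OF fin \<alpha>(1), of \<mu>] \<alpha>(2) by simp
  define \<beta> where "\<beta> = perp \<alpha>"
  define \<kappa> where "\<kappa> = cbil \<alpha> \<alpha>"
  have \<kappa>: "\<kappa> \<noteq> 0" using iso \<alpha> by (simp add: \<kappa>_def)
  have ab: "cbil \<alpha> \<beta> = 0" by (simp add: \<beta>_def)
  have gb: "cbil \<gamma> \<beta> \<noteq> 0" if "\<gamma> \<in> S" for \<gamma>
    using that \<alpha> pw iso unfolding S_def \<beta>_def by (intro cbil_perp_neq_0) (auto simp: pairwise_def)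
  define a where "a = (\<lambda>x. \<Prod>\<gamma>\<in>A. cbil \<gamma> x ^ \<mu> \<gamma>)"
  define b where "b = (\<lambda>x. \<Prod>\<gamma>\<in>S. cbil \<gamma> x ^ \<mu> \<gamma>)"
  have ab_eq: "a x = cbil \<alpha> x * b x" for x
    unfolding a_def b_def S_def prod.remove[OF fin \<alpha>(1)] by (simp add: \<alpha>(2))
  have pow_hom: "polyfun_hom k (\<lambda>l x. cbil \<gamma> x ^ k)" for \<gamma> k
    using polyfun_hom_power[OF polyfun_hom_linear_x, of k \<gamma>] by simp
  have pow_hom_l: "polyfun_hom k (\<lambda>l x. cbil \<gamma> l ^ k)" for \<gamma> k
    using polyfun_hom_power[OF polyfun_hom_linear_l, of k \<gamma>] by simp
  have b_hom: "polyfun_hom (sum \<mu> S) (\<lambda>l. b)"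
    unfolding b_def by (rule polyfun_hom_prod[OF finS pow_hom])
  have b_hom_l: "polyfun_hom (sum \<mu> S) (\<lambda>l x. b l)"
    unfolding b_def by (rule polyfun_hom_prod[OF finS pow_hom_l])
  have b\<beta>: "b \<beta> \<noteq> 0" using gb finS by (simp add: b_def)
  define H where "H = (\<lambda>l x. \<Prod>\<alpha>\<in>A. cbil \<alpha> l ^ \<mu> \<alpha> * cbil \<alpha> x ^ \<mu> \<alpha>)"
  have H_eq: "H l x = a l * a x" for l x by (simp add: H_def a_def prod.distrib)
  have a_scale: "a (\<tau> *s x) = \<tau> ^ N * a x" for \<tau> x
    by (simp add: a_def N_def cbil_simps power_mult_distrib prod.distrib power_sum)
  obtain P where PH: "polynomial_with_highest_term P H" and QP: "quasi_invariant A \<mu> P"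
    using BA unfolding admits_BA_iff H_def by blast
  then obtain d c where "\<forall>l x. P l x = (\<Sum>e | total e \<le> d. c e * monom4 e l x)"
    and "\<forall>l x. H l x = (\<Sum>e | total e = d. c e * monom4 e l x)"
    and ex: "\<exists>l x. H l x \<noteq> 0"
    unfolding polynomial_with_highest_term_iff by blast
  then have P: "P = (\<lambda>l x. \<Sum>e | total e \<le> d. c e * monom4 e l x)"
    and H: "\<And>l x. H l x = (\<Sum>e | total e = d. c e * monom4 e l x)"
    by (simp_all add: fun_eq_iff)
  from ex obtain l0 x0 where H0: "H l0 x0 \<noteq> 0" by blast
  \<comment> \<open>The degree in the definition of the highest term is only existential; doubling
    both arguments identifies it.\<close>
  have d: "d = 2 * N"
  proof -
    have "H (2 *s l0) (2 *s x0) = 2 ^ d * H l0 x0"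
      unfolding H by (simp add: monom4_scale total_eq_deg sum_distrib_left power_add[symmetric] algebra_simps)
    moreover have "H (2 *s l0) (2 *s x0) = 2 ^ (2 * N) * H l0 x0"
      by (simp add: H_eq a_scale mult_2 power_add)
    ultimately have "(2 :: complex) ^ d = 2 ^ (2 * N)" using H0 by simp
    then have "norm ((2 :: complex) ^ d) = norm ((2 :: complex) ^ (2 * N))" by simp
    then have "(2 :: real) ^ d = 2 ^ (2 * N)" by (simp only: norm_power norm_numeral)
    then show ?thesis by (simp only: power_inject_exp)
  qed
  define D where "D = (\<lambda>k l x. \<Sum>e | deg_l e = k \<and> deg_x e = k. c e * monom4 e l x)"
  have fin_k: "finite {e. deg_l e = k \<and> deg_x e = k}" for k
    by (rule finite_subset[OF _ finite_total(1)[of "2 * k"]]) (auto simp: total_eq_deg)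
  have D_le: "polyfun_le (2 * k) (D k)" for k
    unfolding D_def by (intro polyfun_sum polyfun_monom) (auto simp: total_eq_deg)
  have D_scale: "D k (\<theta> *s l) x = \<theta> ^ k * D k l x" for k \<theta> l x
    unfolding D_def sum_distrib_left by (rule sum.cong) (auto simp: monom4_scale_l)
  have D_fix: "polyfun_le k (\<lambda>l. D k v)" for k v
  proof -
    have "polyfun_le k (\<lambda>l x. c e * monom4 e v x)" if "deg_x e = k" for e
    proof -
      obtain i j p q where e: "e = (i, j, p, q)" by (cases e)
      have "polyfun_le k (\<lambda>l x. (c e * v $ 1 ^ i * v $ 2 ^ j) * monom4 (0, 0, p, q) l x)"
        using that by (intro polyfun_monom) (simp add: e total_def deg_x_def)
      then show ?thesis by (rule polyfun_cong) (simp add: e monom4_def)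
    qed
    then show ?thesis unfolding D_def by (intro polyfun_sum) auto
  qed
  \<comment> \<open>The highest term scales by \<tau>^N in l alone, so the exponents of other
    degrees in l sum to zero.\<close>
  have D_N: "D N l x = H l x" for l x
  proof -
    have "(\<Sum>e | total e = d. monom (c e * monom4 e l x) (deg_l e)) = monom (H l x) N"
    proof -
      have "poly (\<Sum>e | total e = d. monom (c e * monom4 e l x) (deg_l e)) \<tau> = poly (monom (H l x) N) \<tau>" for \<tau>
      proof -
        have "poly (\<Sum>e | total e = d. monom (c e * monom4 e l x) (deg_l e)) \<tau> = H (\<tau> *s l) x"
          unfolding H by (simp add: poly_sum poly_monom monom4_scale_l mult.commute mult.left_commute)
        also have "\<dots> = poly (monom (H l x) N) \<tau>" by (simp add: H_eq a_scale poly_monom)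
        finally show ?thesis .
      qed
      then show ?thesis by (simp add: poly_eq_poly_eq_iff[symmetric] fun_eq_iff)
    qed
    then have "coeff (\<Sum>e | total e = d. monom (c e * monom4 e l x) (deg_l e)) N = H l x" by simp
    moreover have "{e. e \<in> {e. total e = d} \<and> deg_l e = N} = {e. deg_l e = N \<and> deg_x e = N}"
      by (auto simp: d total_eq_deg)
    ultimately show ?thesis
      by (simp only: coeff_sum_monom[OF finite_total(2)] D_def)
  qed
  define Q where "Q = (\<lambda>l x. \<Sum>k\<le>N. D k l x)"
  have QQ: "quasi_invariant A \<mu> Q"
  proof -
    have "(\<Sum>e | total e \<le> d \<and> deg_l e = deg_x e. c e * monom4 e l x) = Q l x" for l x
    proof -
      have fin': "finite {e. total e \<le> d \<and> deg_l e = deg_x e}"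
        by (rule finite_subset[OF _ finite_total(1)[of d]]) auto
      have "Q l x = (\<Sum>k\<le>N. \<Sum>e\<in>{e \<in> {e. total e \<le> d \<and> deg_l e = deg_x e}. deg_l e = k}. c e * monom4 e l x)"
        unfolding Q_def D_def by (intro sum.cong refl) (auto simp: total_eq_deg d)
      also have "\<dots> = (\<Sum>e | total e \<le> d \<and> deg_l e = deg_x e. c e * monom4 e l x)"
        by (rule sum.group[OF fin']) (auto simp: d total_eq_deg)
      finally show ?thesis by simp
    qed
    then show ?thesis using quasi_invariant_weight_zero[OF QP P] by simp
  qed
  have QI: "fps_nth (fps_of_poly (\<Sum>k\<le>N. smult (\<theta> ^ k) (line_poly (D k l) y \<gamma>)) * fps_exp (\<theta> * cbil \<gamma> l)) j = 0"
    if "\<gamma> \<in> A" "odd j" "j < 2 * \<mu> \<gamma>" "cbil \<gamma> y = 0" for \<gamma> j y l \<theta>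
  proof -
    have "line_poly (Q (\<theta> *s l)) y \<gamma> = (\<Sum>k\<le>N. smult (\<theta> ^ k) (line_poly (D k l) y \<gamma>))"
      by (rule line_poly_eqI) (simp add: Q_def D_scale poly_sum poly_line_poly[OF D_le])
    moreover have "fps_nth (line_series Q \<gamma> (\<theta> *s l) y) j = 0"
      using QQ that unfolding quasi_invariant_iff by blast
    ultimately show ?thesis by (simp add: line_series_def cbil_simps)
  qed
  \<comment> \<open>The coefficient of \<theta>^k in the first normal Taylor coefficient at \<beta>;
    the shifted index comes from the term \<theta> (\<alpha>, l) of the exponential.\<close>
  have rel: "coeff (line_poly (D k l) \<beta> \<alpha>) 1 + (if k = 0 then 0 else cbil \<alpha> l * coeff (line_poly (D (k - 1) l) \<beta> \<alpha>) 0) = 0"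
    if k: "k \<le> N" for k l
  proof -
    define u where "u = (\<lambda>k. coeff (line_poly (D k l) \<beta> \<alpha>) 1)"
    define v where "v = (\<lambda>k. cbil \<alpha> l * coeff (line_poly (D k l) \<beta> \<alpha>) 0)"
    have "poly ((\<Sum>k\<le>N. monom (u k) k) + (\<Sum>k\<le>N. monom (v k) (Suc k))) \<theta> = 0" for \<theta>
    proof -
      have "0 = fps_nth (fps_of_poly (\<Sum>k\<le>N. smult (\<theta> ^ k) (line_poly (D k l) \<beta> \<alpha>)) * fps_exp (\<theta> * cbil \<alpha> l)) 1"
        using QI[OF \<alpha>(1) _ _ ab, of 1] \<alpha>(2) by simp
      also have "\<dots> = (\<Sum>k\<le>N. \<theta> ^ k * u k) + \<theta> * (\<Sum>k\<le>N. \<theta> ^ k * v k)"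
        by (simp add: fps_mult_nth coeff_sum u_def v_def sum_distrib_left sum_distrib_right algebra_simps)
      finally show ?thesis
        by (simp add: poly_sum poly_monom sum_distrib_left algebra_simps)
    qed
    then have "(\<Sum>k\<le>N. monom (u k) k) + (\<Sum>k\<le>N. monom (v k) (Suc k)) = 0"
      by (rule poly_eq_0_off_0)
    then have "coeff ((\<Sum>k\<le>N. monom (u k) k) + (\<Sum>k\<le>N. monom (v k) (Suc k))) k = 0" by simp
    then have "(\<Sum>i | i \<in> {..N} \<and> i = k. u i) + (\<Sum>i | i \<in> {..N} \<and> Suc i = k. v i) = 0"
      by (simp add: coeff_sum_monom)
    moreover have "{i. i \<in> {..N} \<and> i = k} = {k}" using k by auto
    moreover have "{i. i \<in> {..N} \<and> Suc i = k} = (if k = 0 then {} else {k - 1})" using k by auto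
    ultimately show ?thesis by (simp add: u_def v_def split: if_splits)
  qed
  \<comment> \<open>As (\<alpha>, \<beta>) = 0, the highest term vanishes at l = \<beta>, so on l =
    \<theta> \<beta> the top power of \<theta> drops to N - 1, with coefficient
    \<open>f\<close>.\<close>
  define f where "f = D (N - 1) \<beta>"
  have f_le: "polyfun_le (sum \<mu> S) (\<lambda>l. f)" using D_fix[of "N - 1" \<beta>] N by (simp add: f_def)
  have "\<exists>C. \<forall>x. f x = C * (\<Prod>\<gamma>\<in>S. cbil \<gamma> x ^ \<mu> \<gamma>)"
  proof (rule polyfun_factorisation[OF finS _ _ f_le])
    show "pairwise (\<lambda>u v. \<not> proportional u v) S" using pw unfolding S_def by (rule pairwise_subset) auto
    show "cbil \<gamma> \<gamma> \<noteq> 0" if "\<gamma> \<in> S" for \<gamma> using that iso by (simp add: S_def)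
    fix \<gamma> y j assume \<gamma>: "\<gamma> \<in> S" and y: "cbil \<gamma> y = 0" and j: "j < \<mu> \<gamma>"
    have top: "line_poly (D N \<beta>) y \<gamma> = 0"
      by (rule line_poly_eqI) (simp add: D_N H_eq ab_eq ab)
    show "coeff (line_poly f y \<gamma>) j = 0"
      unfolding f_def
    proof (rule low_coeffs_top_zero[where K = "N - 1" and q = "\<lambda>k. line_poly (D k \<beta>) y \<gamma>", OF gb[OF \<gamma>] _ j])
      fix \<theta> k assume "odd k" "k < 2 * \<mu> \<gamma>"
      then have "fps_nth (fps_of_poly (\<Sum>k\<le>N. smult (\<theta> ^ k) (line_poly (D k \<beta>) y \<gamma>)) * fps_exp (\<theta> * cbil \<gamma> \<beta>)) k = 0"
        using QI[of \<gamma>] \<gamma> y by (simp add: S_def)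
      then show "fps_nth (fps_of_poly (\<Sum>k\<le>N - 1. smult (\<theta> ^ k) (line_poly (D k \<beta>) y \<gamma>)) * fps_exp (\<theta> * cbil \<gamma> \<beta>)) k = 0"
        using top N by simp
    qed
  qed
  then obtain C where C: "\<And>x. f x = C * b x" unfolding b_def by blast
  \<comment> \<open>In \<open>rel\<close> with \<open>k = N\<close> both terms contain (\<alpha>,
    l), which is divided out where it is nonzero.\<close>
  have bracket: "b l * \<kappa> * b \<beta> + D (N - 1) l \<beta> = 0" if "cbil \<alpha> l \<noteq> 0" for l
  proof -
    have "line_poly (D N l) \<beta> \<alpha> = smult (a l) ([:0, \<kappa>:] * line_poly b \<beta> \<alpha>)"
      by (rule line_poly_eqI)
        (simp add: D_N H_eq ab_eq cbil_simps ab \<kappa>_def poly_line_poly[OF polyfun_hom_imp_le[OF b_hom]] algebra_simps)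
    moreover have "coeff (line_poly b \<beta> \<alpha>) 0 = b \<beta>"
      using poly_line_poly[OF polyfun_hom_imp_le[OF b_hom], of \<beta> \<alpha> 0] by (simp add: poly_0_coeff_0)
    ultimately have "coeff (line_poly (D N l) \<beta> \<alpha>) 1 = cbil \<alpha> l * (b l * \<kappa> * b \<beta>)"
      by (simp add: ab_eq algebra_simps)
    moreover have "coeff (line_poly (D (N - 1) l) \<beta> \<alpha>) 0 = D (N - 1) l \<beta>"
      using poly_line_poly[OF D_le, of "N - 1" l \<beta> \<alpha> 0] by (simp add: poly_0_coeff_0)
    ultimately have "cbil \<alpha> l * (b l * \<kappa> * b \<beta> + D (N - 1) l \<beta>) = 0"
      using rel[of N l] N by (simp add: algebra_simps)
    then show ?thesis using that by simp
  qed
  \<comment> \<open>The value needed is at l = \<beta>, where (\<alpha>, l) vanishes; it is reached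
    along l = \<beta> + t \<alpha>.\<close>
  have "b \<beta> * \<kappa> * b \<beta> + D (N - 1) \<beta> \<beta> = 0"
  proof -
    have "polyfun UNIV (\<lambda>l x. (\<kappa> * b \<beta>) * b l + D (N - 1) l x)"
      by (intro polyfun_add polyfun_cmult polyfun_mono[OF b_hom_l] polyfun_mono[OF D_le]) auto
    from polyfun_line_l[OF this, of \<beta> \<alpha> \<beta>] obtain p
      where p: "\<And>t. (\<kappa> * b \<beta>) * b (\<beta> + t *s \<alpha>) + D (N - 1) (\<beta> + t *s \<alpha>) \<beta> = poly p t" by blast
    have "p = 0"
    proof (rule poly_eq_0_off_0)
      fix t :: complex assume "t \<noteq> 0"
      then have "cbil \<alpha> (\<beta> + t *s \<alpha>) \<noteq> 0" using \<kappa> ab by (simp add: cbil_simps \<kappa>_def)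
      from bracket[OF this] show "poly p t = 0" by (simp add: p[symmetric] algebra_simps)
    qed
    then show ?thesis using p[of 0] by (simp add: algebra_simps)
  qed
  then have "f \<beta> \<noteq> 0" using b\<beta> \<kappa> by (auto simp: f_def)
  then have C0: "C \<noteq> 0" using C by auto
  \<comment> \<open>At l = \<beta> the second term of \<open>rel\<close> disappears, so the normal
    derivative of \<open>f\<close> vanishes at \<beta>.\<close>
  have "coeff (line_poly f \<beta> \<alpha>) 1 = 0"
    using rel[of "N - 1" \<beta>] ab by (simp add: f_def split: if_splits)
  moreover have "line_poly f \<beta> \<alpha> = smult C (line_poly b \<beta> \<alpha>)"
    by (rule line_poly_eqI) (simp add: C poly_line_poly[OF polyfun_hom_imp_le[OF b_hom]])
  ultimately have "coeff (pderiv (line_poly b \<beta> \<alpha>)) 0 = 0" using C0 by (simp add: coeff_pderiv)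
  then have "poly (line_poly (\<lambda>x. dir_deriv \<alpha> b x) \<beta> \<alpha>) 0 = 0"
    using line_poly_dir_deriv[OF b_hom, of \<alpha> \<beta>] by (simp add: poly_0_coeff_0)
  then have "dir_deriv \<alpha> b \<beta> = 0"
    using poly_line_poly[OF polyfun_le_dir_deriv[OF polyfun_hom_imp_le[OF b_hom], of \<alpha>], of \<beta> \<alpha> 0] by simp
  \<comment> \<open>Taking out \<open>b \<beta>\<close> leaves the logarithmic derivative of
    \<open>b\<close>, whose terms are the cotangents.\<close>
  then have "0 = (\<Sum>\<gamma>\<in>S. of_nat (\<mu> \<gamma>) * cbil \<gamma> \<alpha> * (cbil \<gamma> \<beta> ^ (\<mu> \<gamma> - 1) * (\<Prod>\<delta>\<in>S - {\<gamma>}. cbil \<delta> \<beta> ^ \<mu> \<delta>)))"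
    unfolding b_def dir_deriv_prod_power[OF finS] by simp
  also have "\<dots> = (\<Sum>\<gamma>\<in>S. b \<beta> * (of_nat (\<mu> \<gamma>) * (cbil \<gamma> \<alpha> / cbil \<gamma> \<beta>)))"
  proof (rule sum.cong[OF refl])
    fix \<gamma> assume \<gamma>: "\<gamma> \<in> S"
    then have "0 < \<mu> \<gamma>" using pos by (simp add: S_def)
    then have "cbil \<gamma> \<beta> * cbil \<gamma> \<beta> ^ (\<mu> \<gamma> - 1) = cbil \<gamma> \<beta> ^ \<mu> \<gamma>" by (cases "\<mu> \<gamma>") auto
    then have "b \<beta> = cbil \<gamma> \<beta> * (cbil \<gamma> \<beta> ^ (\<mu> \<gamma> - 1) * (\<Prod>\<delta>\<in>S - {\<gamma>}. cbil \<delta> \<beta> ^ \<mu> \<delta>))"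
      unfolding b_def prod.remove[OF finS \<gamma>] by (simp only: mult.assoc[symmetric])
    then show "of_nat (\<mu> \<gamma>) * cbil \<gamma> \<alpha> * (cbil \<gamma> \<beta> ^ (\<mu> \<gamma> - 1) * (\<Prod>\<delta>\<in>S - {\<gamma>}. cbil \<delta> \<beta> ^ \<mu> \<delta>)) =
      b \<beta> * (of_nat (\<mu> \<gamma>) * (cbil \<gamma> \<alpha> / cbil \<gamma> \<beta>))"
      using gb[OF \<gamma>] by simp
  qed
  also have "\<dots> = b \<beta> * (\<Sum>\<gamma>\<in>S. of_nat (\<mu> \<gamma>) * (cbil \<gamma> \<alpha> / cbil \<gamma> \<beta>))"
    by (simp only: sum_distrib_left)
  finally show ?thesis using b\<beta> by (simp add: S_def \<beta>_def)
qed

subsection \<open>Roots of hypergeometric polynomials\<close>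

text \<open>For positive \<open>m\<close> and \<open>k \<le> n\<close>, the coefficient of z^k in
  the hypergeometric polynomial 2F1(-n, m; 1 - m - n; z).\<close>

definition binomial_ratio :: "nat \<Rightarrow> nat \<Rightarrow> nat \<Rightarrow> complex" where
  "binomial_ratio m n k = of_nat (n choose k) * of_nat ((m + k - 1) choose k) / of_nat ((m + n - 1) choose k)"

lemma binomial_ratio_recurrence:
  assumes "1 \<le> m" "k < n"
  shows "(of_nat n - of_nat k) * (of_nat k + of_nat m) * binomial_ratio m n k =
         of_nat (Suc k) * (of_nat m + of_nat n - 1 - of_nat k) * binomial_ratio m n (Suc k)"
proof -
  have up: "Suc k * (a choose Suc k) = (a - k) * (a choose k)" for a :: nat
    using binomial_absorption[of k a] binomial_absorb_comp[of a k] by simp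
  have A: "of_nat (Suc k) * of_nat (n choose Suc k) = (of_nat n - of_nat k) * (of_nat (n choose k) :: complex)"
    using arg_cong[OF up[of n], of "of_nat :: nat \<Rightarrow> complex"] assms
    by (simp only: of_nat_mult of_nat_diff less_imp_le)
  have B: "of_nat (Suc k) * of_nat ((m + k) choose Suc k) = (of_nat k + of_nat m) * (of_nat ((m + k - 1) choose k) :: complex)"
    using arg_cong[OF binomial_absorption[of k "m + k"], of "of_nat :: nat \<Rightarrow> complex"]
    by (simp only: of_nat_mult of_nat_add add.commute)
  have C: "of_nat (Suc k) * of_nat ((m + n - 1) choose Suc k) =
      (of_nat m + of_nat n - 1 - of_nat k) * (of_nat ((m + n - 1) choose k) :: complex)"
  proof -
    have "of_nat (m + n - 1 - k) = (of_nat m + of_nat n - 1 - of_nat k :: complex)"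
      using assms by (simp add: of_nat_diff)
    then show ?thesis
      using arg_cong[OF up[of "m + n - 1"], of "of_nat :: nat \<Rightarrow> complex"] by (simp only: of_nat_mult)
  qed
  have nz: "of_nat ((m + n - 1) choose k) \<noteq> (0 :: complex)" "of_nat ((m + n - 1) choose Suc k) \<noteq> (0 :: complex)"
    "of_nat (Suc k) \<noteq> (0 :: complex)"
    using assms by (simp_all del: of_nat_Suc)
  define s where "s = (of_nat (Suc k) :: complex)"
  define b1 where "b1 = (of_nat ((m + n - 1) choose k) :: complex)"
  define b2 where "b2 = (of_nat ((m + n - 1) choose Suc k) :: complex)"
  define t where "t = (of_nat m + of_nat n - 1 - of_nat k :: complex)"
  have r2: "binomial_ratio m n (Suc k) = of_nat (n choose Suc k) * of_nat ((m + k) choose Suc k) / b2"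
    using assms by (simp add: binomial_ratio_def b2_def)
  have "s * s * (b1 * (s * t * binomial_ratio m n (Suc k))) =
      s * t * b1 * ((s * of_nat (n choose Suc k)) * (s * of_nat ((m + k) choose Suc k))) / b2"
    unfolding r2 by simp
  also have "\<dots> = s * (s * b2) * ((s * of_nat (n choose Suc k)) * (s * of_nat ((m + k) choose Suc k))) / b2"
    using C by (simp add: s_def t_def b1_def b2_def mult.assoc del: of_nat_Suc)
  also have "\<dots> = s * s * (((of_nat n - of_nat k) * of_nat (n choose k)) * ((of_nat k + of_nat m) * of_nat ((m + k - 1) choose k)))"
    using nz(2) A B by (simp add: b2_def s_def del: of_nat_Suc)
  also have "\<dots> = s * s * (b1 * ((of_nat n - of_nat k) * (of_nat k + of_nat m) * binomial_ratio m n k))"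
    using nz(1) by (simp add: binomial_ratio_def b1_def)
  finally show ?thesis using nz(1,3) by (simp add: s_def b1_def t_def del: of_nat_Suc)
qed

lemma binomial_ratio_top:
  assumes "1 \<le> m"
  shows "binomial_ratio m n n = 1"
  using assms by (simp add: binomial_ratio_def)

text \<open>With M = m - 1 the ratio is n! (M + k)! (M + n - k)! / (k! (n - k)! M! (M + n)!),
  symmetric in k and n - k. This is the origin of the symmetry of the configuration.\<close>

lemma binomial_ratio_sym:
  assumes "1 \<le> m" "k \<le> n"
  shows "binomial_ratio m n (n - k) = binomial_ratio m n k"
proof -
  obtain M where M: "m = Suc M" using assms(1) by (cases m) auto
  obtain j where n: "n = k + j" using assms(2) le_Suc_ex by blast
  have "k + j - (k + j - k) = k" "k + j - k = j" by auto
  then show ?thesis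
    by (simp add: binomial_ratio_def M n binomial_fact field_simps)
qed

text \<open>Vieta's formula, by expanding the product over subsets.\<close>

lemma coeff_prod_linear_elem_sym:
  assumes "k \<le> n"
  shows "coeff (\<Prod>i\<in>{1..n}. [:- z i, 1:]) (n - k) = (- 1) ^ k * elem_sym n k z"
proof -
  have "(\<Prod>i\<in>{1..n}. [:- z i, 1:]) = (\<Prod>i\<in>{1..n}. [:- z i:] + [:0, 1:])" by simp
  also have "\<dots> = (\<Sum>X\<in>Pow {1..n}. (\<Prod>i\<in>X. [:- z i:]) * (\<Prod>i\<in>{1..n} - X. [:0, 1:]))"
    by (rule prod_add) simp
  also have "\<dots> = (\<Sum>X\<in>Pow {1..n}. monom ((- 1) ^ card X * (\<Prod>i\<in>X. z i)) (n - card X))"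
  proof (rule sum.cong[OF refl])
    fix X assume X: "X \<in> Pow {1..n}"
    then have fin: "finite X" using finite_subset by blast
    have "(\<Prod>i\<in>X. [:- z i:]) = [:\<Prod>i\<in>X. - z i:]"
      using fin by (induction X rule: finite_induct) auto
    moreover have "(\<Prod>i\<in>X. - z i) = (- 1) ^ card X * (\<Prod>i\<in>X. z i)"
      using prod.distrib[of "\<lambda>_. - 1" z X] by simp
    moreover have "card ({1..n} - X) = n - card X"
      using X fin by (subst card_Diff_subset) auto
    ultimately show "(\<Prod>i\<in>X. [:- z i:]) * (\<Prod>i\<in>{1..n} - X. [:0, 1:]) =
        monom ((- 1) ^ card X * (\<Prod>i\<in>X. z i)) (n - card X)"
      by (simp add: monom_altdef)
  qed
  finally have "coeff (\<Prod>i\<in>{1..n}. [:- z i, 1:]) (n - k) =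
      (\<Sum>X | X \<in> Pow {1..n} \<and> n - card X = n - k. (- 1) ^ card X * (\<Prod>i\<in>X. z i))"
    by (simp only: coeff_sum_monom finite_Pow_iff finite_atLeastAtMost)
  also have "{X. X \<in> Pow {1..n} \<and> n - card X = n - k} = {X. X \<subseteq> {1..n} \<and> card X = k}"
  proof -
    have "n - card X = n - k \<longleftrightarrow> card X = k" if "X \<subseteq> {1..n}" for X
      using card_mono[OF _ that] assms by auto
    then show ?thesis by blast
  qed
  also have "(\<Sum>X | X \<subseteq> {1..n} \<and> card X = k. (- 1) ^ card X * (\<Prod>i\<in>X. z i)) = (- 1) ^ k * elem_sym n k z"
    unfolding elem_sym_def sum_distrib_left by (rule sum.cong[OF refl]) simp
  finally show ?thesis .
qed

text \<open>The cotangent equations of the vectors of multiplicity one, divided by the imaginary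
  unit: a charge \<open>m\<close> at z = 1, the place of \<alpha>0, and unit charges at the
  \<open>z j\<close>.\<close>

definition equilibrium :: "nat \<Rightarrow> nat \<Rightarrow> (nat \<Rightarrow> complex) \<Rightarrow> bool" where
  "equilibrium m n z \<longleftrightarrow> (\<forall>i\<in>{1..n}. of_nat m * ((1 + z i) / (1 - z i))
     + (\<Sum>j\<in>{1..n} - {i}. (z j + z i) / (z j - z i)) = 0)"

text \<open>
  Stieltjes: the roots are in equilibrium iff the polynomial with these roots is annihilated
  by this hypergeometric operator.
\<close>

definition hypergeometric_op :: "nat \<Rightarrow> nat \<Rightarrow> complex poly \<Rightarrow> complex poly" where
  "hypergeometric_op m n p = [:0, 1, -1:] * pderiv (pderiv p)
     - [:of_nat m + of_nat n - 1, of_nat m - of_nat n + 1:] * pderiv p + smult (of_nat n * of_nat m) p"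

lemma coeff_hypergeometric_op:
  "coeff (hypergeometric_op m n p) k =
     of_nat (Suc k) * (of_nat k - of_nat m - of_nat n + 1) * coeff p (Suc k)
     - (of_nat k - of_nat n) * (of_nat k + of_nat m) * coeff p k"
proof (cases k)
  case 0
  then show ?thesis by (simp add: hypergeometric_op_def coeff_pderiv algebra_simps)
next
  case (Suc i)
  have "coeff ([:0, 1, -1:] * pderiv (pderiv p)) k =
      of_nat k * of_nat (Suc k) * coeff p (Suc k) - of_nat (k - 1) * of_nat k * coeff p k"
    unfolding Suc by (cases i) (simp_all add: coeff_pderiv)
  moreover have "coeff ([:a, b:] * pderiv p) k = a * (of_nat (Suc k) * coeff p (Suc k)) + b * (of_nat k * coeff p k)" for a b
    unfolding Suc by (simp add: coeff_pderiv)
  ultimately have "coeff (hypergeometric_op m n p) k =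
      of_nat k * of_nat (Suc k) * coeff p (Suc k) - of_nat (k - 1) * of_nat k * coeff p k
      - ((of_nat m + of_nat n - 1) * (of_nat (Suc k) * coeff p (Suc k))
         + (of_nat m - of_nat n + 1) * (of_nat k * coeff p k)) + of_nat n * of_nat m * coeff p k"
    by (simp only: hypergeometric_op_def coeff_diff coeff_add coeff_smult)
  moreover have "of_nat (k - 1) = (of_nat k - 1 :: complex)" by (simp add: Suc)
  ultimately show ?thesis by (simp only: of_nat_Suc) (simp add: algebra_simps)
qed

text \<open>At a simple root p'' / p' is twice the sum of 1 / (z_i - z_j), and (z_j + z_i) / (z_j -
  z_i) = 1 - 2 z_i / (z_i - z_j). So the operator at \<open>z i\<close> is the equilibrium
  expression times - p'(z_i) (1 - z_i), which is nonzero.\<close>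

lemma poly_hypergeometric_op_root:
  assumes inj: "inj_on z {1..n}" and i: "i \<in> {1..n}" and "z i \<noteq> 1"
  shows "poly (hypergeometric_op m n (\<Prod>i\<in>{1..n}. [:- z i, 1:])) (z i) = 0 \<longleftrightarrow>
    of_nat m * ((1 + z i) / (1 - z i)) + (\<Sum>j\<in>{1..n} - {i}. (z j + z i) / (z j - z i)) = 0"
proof -
  define p where "p = (\<Prod>i\<in>{1..n}. [:- z i, 1:])"
  define J where "J = {1..n} - {i}"
  define r where "r = (\<Prod>j\<in>J. [:- z j, 1:])"
  define w where "w = poly r (z i)"
  define s where "s = (\<Sum>j\<in>J. 1 / (z i - z j))"
  have J: "finite J" "card J = n - 1" "\<And>j. j \<in> J \<Longrightarrow> z i - z j \<noteq> 0"
  proof -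
    show "finite J" by (simp add: J_def)
    show "card J = n - 1" using i by (simp add: J_def)
    show "z i - z j \<noteq> 0" if "j \<in> J" for j
      using that inj_on_eq_iff[OF inj i, of j] by (auto simp: J_def)
  qed
  have p: "p = [:- z i, 1:] * r"
    unfolding p_def r_def J_def by (rule prod.remove[OF _ i]) simp
  have w_eq: "w = (\<Prod>j\<in>J. z i - z j)" by (simp add: w_def r_def poly_prod)
  have w: "w \<noteq> 0" unfolding w_eq prod_zero_iff[OF J(1)] using J(3) by blast
  have r': "poly (pderiv r) (z i) = w * s"
  proof -
    have "poly (pderiv r) (z i) = (\<Sum>j\<in>J. \<Prod>k\<in>J - {j}. z i - z k)"
      by (simp add: r_def pderiv_prod poly_sum poly_prod pderiv_pCons)
    also have "\<dots> = (\<Sum>j\<in>J. w * (1 / (z i - z j)))"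
    proof (rule sum.cong[OF refl])
      fix j assume j: "j \<in> J"
      have "w = (z i - z j) * (\<Prod>k\<in>J - {j}. z i - z k)" unfolding w_eq by (rule prod.remove[OF J(1) j])
      then show "(\<Prod>k\<in>J - {j}. z i - z k) = w * (1 / (z i - z j))" using J(3)[OF j] by simp
    qed
    finally show ?thesis by (simp add: s_def sum_distrib_left)
  qed
  have l: "pderiv [:- z i, 1:] = 1" "poly [:- z i, 1:] (z i) = 0" by (simp_all add: pderiv_pCons)
  have dp: "pderiv p = [:- z i, 1:] * pderiv r + r"
    unfolding p by (simp only: pderiv_mult l mult_1_right)
  have ddp: "pderiv (pderiv p) = [:- z i, 1:] * pderiv (pderiv r) + pderiv r + pderiv r"
    unfolding dp by (simp only: pderiv_add pderiv_mult l mult_1_right)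
  have p': "poly (pderiv p) (z i) = w" "poly (pderiv (pderiv p)) (z i) = 2 * (w * s)" "poly p (z i) = 0"
    unfolding ddp unfolding dp unfolding p by (simp_all only: poly_mult poly_add l r' w_def) simp_all
  have "(\<Sum>j\<in>J. (z j + z i) / (z j - z i)) = (\<Sum>j\<in>J. 1 - 2 * z i * (1 / (z i - z j)))"
  proof (rule sum.cong[OF refl])
    fix j assume "j \<in> J"
    then have "z i - z j \<noteq> 0" using J(3) by blast
    then have "z i - z j \<noteq> 0" "z j - z i \<noteq> 0" by auto
    then show "(z j + z i) / (z j - z i) = 1 - 2 * z i * (1 / (z i - z j))"
      by (simp add: field_simps)
  qed
  also have "\<dots> = of_nat n - 1 - 2 * z i * s"
    using i by (simp add: sum_subtractf s_def sum_distrib_left J(2) of_nat_diff)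
  finally have sum: "(\<Sum>j\<in>J. (z j + z i) / (z j - z i)) = of_nat n - 1 - 2 * z i * s" .
  have "poly (hypergeometric_op m n p) (z i) = - w * (1 - z i) *
      (of_nat m * ((1 + z i) / (1 - z i)) + (\<Sum>j\<in>J. (z j + z i) / (z j - z i)))"
  proof -
    have "(1 - z i) * (of_nat m * ((1 + z i) / (1 - z i))) = of_nat m * (1 + z i)"
      using assms(3) by simp
    then have "- w * (1 - z i) * (of_nat m * ((1 + z i) / (1 - z i)) + (\<Sum>j\<in>J. (z j + z i) / (z j - z i))) =
        - w * (of_nat m * (1 + z i) + (1 - z i) * (of_nat n - 1 - 2 * z i * s))"
      unfolding sum by (simp only: mult.assoc distrib_left)
    also have "\<dots> = poly (hypergeometric_op m n p) (z i)"
      by (simp add: hypergeometric_op_def p' algebra_simps)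
    finally show ?thesis ..
  qed
  then show ?thesis using w assms(3) by (simp add: p_def J_def)
qed

text \<open>The constant n m in the operator is chosen so that the coefficient of z^n cancels. The
  image thus has degree below n and vanishes as soon as it has the n distinct roots
  \<open>z i\<close>. The resulting two-term recurrence is solved downwards from the leading
  coefficient 1, the factor (n - k) (k + m) being nonzero for k < n.\<close>

lemma equilibrium_iff_coeffs:
  assumes m: "1 \<le> m" and inj: "inj_on z {1..n}" and z1: "\<And>i. i \<in> {1..n} \<Longrightarrow> z i \<noteq> 1"
  shows "equilibrium m n z \<longleftrightarrow> (\<forall>k\<le>n. coeff (\<Prod>i\<in>{1..n}. [:- z i, 1:]) k = binomial_ratio m n k)"
proof -
  define p where "p = (\<Prod>i\<in>{1..n}. [:- z i, 1:])"
  define E where "E = hypergeometric_op m n p"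
  have deg: "Polynomial.degree p = n" unfolding p_def by (subst degree_prod_eq_sum_degree) auto
  have top: "coeff p n = 1"
    using coeff_prod_linear_power[of "{1..n}" "\<lambda>i. - z i" "\<lambda>_. 1" "\<lambda>_. 1"] by (simp add: p_def)
  have high: "coeff E k = 0" if "n \<le> k" for k
    using that deg by (cases "k = n") (simp_all add: E_def coeff_hypergeometric_op coeff_eq_0)
  have E0: "(\<forall>i\<in>{1..n}. poly E (z i) = 0) \<longleftrightarrow> E = 0"
  proof
    assume roots: "\<forall>i\<in>{1..n}. poly E (z i) = 0"
    show "E = 0"
    proof (rule ccontr)
      assume "E \<noteq> 0"
      then have "Polynomial.degree E < n" using high leading_coeff_0_iff not_less by blast
      moreover have "card (z ` {1..n}) \<le> card {x. poly E x = 0}"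
        using roots \<open>E \<noteq> 0\<close> by (intro card_mono poly_roots_finite) auto
      moreover have "card {x. poly E x = 0} \<le> Polynomial.degree E"
        using \<open>E \<noteq> 0\<close> by (rule card_poly_roots_bound)
      ultimately show False using inj by (simp add: card_image)
    qed
  qed simp
  have rec: "coeff E k = 0 \<longleftrightarrow>
      (of_nat n - of_nat k) * (of_nat k + of_nat m) * coeff p k =
      of_nat (Suc k) * (of_nat m + of_nat n - 1 - of_nat k) * coeff p (Suc k)" for k
    unfolding E_def coeff_hypergeometric_op by (auto simp: algebra_simps)
  have "E = 0 \<longleftrightarrow> (\<forall>k\<le>n. coeff p k = binomial_ratio m n k)"
  proof
    assume "E = 0"
    show "\<forall>k\<le>n. coeff p k = binomial_ratio m n k"
    proof (intro allI impI)
      fix k assume "k \<le> n"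
      then show "coeff p k = binomial_ratio m n k"
      proof (induction k rule: inc_induct)
        case base
        show ?case by (simp add: top binomial_ratio_top[OF m])
      next
        case (step k)
        have nz: "(of_nat n - of_nat k) * (of_nat k + of_nat m) \<noteq> (0 :: complex)"
          using step(2) m by (simp flip: of_nat_add)
        have "(of_nat n - of_nat k) * (of_nat k + of_nat m) * coeff p k =
            (of_nat n - of_nat k) * (of_nat k + of_nat m) * binomial_ratio m n k"
          using rec[of k] \<open>E = 0\<close> binomial_ratio_recurrence[OF m step(2)] step(3) by simp
        then show ?case by (rule mult_left_cancel[OF nz, THEN iffD1])
      qed
    qed
  next
    assume *: "\<forall>k\<le>n. coeff p k = binomial_ratio m n k"
    have "coeff E k = 0" for k
    proof (cases "k < n")
      case True
      then show ?thesis unfolding rec using * binomial_ratio_recurrence[OF m True] by simp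
    qed (simp add: high)
    then show "E = 0" by (simp add: poly_eq_iff)
  qed
  moreover have "equilibrium m n z \<longleftrightarrow> (\<forall>i\<in>{1..n}. poly E (z i) = 0)"
    unfolding equilibrium_def E_def p_def
    using poly_hypergeometric_op_root[OF inj _ z1] by blast
  ultimately show ?thesis using E0 by (simp add: p_def)
qed

text \<open>Vieta relates e_k to coefficient n - k, and the symmetry of the ratios returns the index
  to k. The case k = 0 is the leading coefficient and holds automatically.\<close>

lemma equilibrium_iff_elem_sym:
  assumes m: "1 \<le> m" and inj: "inj_on z {1..n}" and z1: "\<And>i. i \<in> {1..n} \<Longrightarrow> z i \<noteq> 1"
  shows "equilibrium m n z \<longleftrightarrow> (\<forall>k\<in>{1..n}. elem_sym n k z =
      (- 1) ^ k * of_nat (n choose k) * of_nat ((m + k - 1) choose k) / of_nat ((m + n - 1) choose k))"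
proof -
  define p where "p = (\<Prod>i\<in>{1..n}. [:- z i, 1:])"
  have e: "elem_sym n k z = (- 1) ^ k * of_nat (n choose k) * of_nat ((m + k - 1) choose k) / of_nat ((m + n - 1) choose k)
      \<longleftrightarrow> coeff p (n - k) = binomial_ratio m n (n - k)" if "k \<le> n" for k
  proof -
    have s: "(- 1) ^ k * (- 1) ^ k = (1 :: complex)" by (simp flip: power_mult_distrib)
    have "coeff p (n - k) = binomial_ratio m n (n - k) \<longleftrightarrow> (- 1) ^ k * elem_sym n k z = binomial_ratio m n k"
      unfolding p_def coeff_prod_linear_elem_sym[OF that] binomial_ratio_sym[OF m that] ..
    also have "\<dots> \<longleftrightarrow> (- 1) ^ k * ((- 1) ^ k * elem_sym n k z) = (- 1) ^ k * binomial_ratio m n k"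
      by (rule mult_left_cancel[symmetric]) simp
    also have "\<dots> \<longleftrightarrow> elem_sym n k z = (- 1) ^ k * of_nat (n choose k) * of_nat ((m + k - 1) choose k) / of_nat ((m + n - 1) choose k)"
      by (simp add: mult.assoc[symmetric] s binomial_ratio_def)
    finally show ?thesis ..
  qed
  have "(\<forall>k\<le>n. coeff p k = binomial_ratio m n k) \<longleftrightarrow> (\<forall>k\<in>{1..n}. coeff p (n - k) = binomial_ratio m n (n - k))"
  proof (intro iffI ballI allI impI)
    fix k assume *: "\<forall>k\<in>{1..n}. coeff p (n - k) = binomial_ratio m n (n - k)" and k: "k \<le> n"
    show "coeff p k = binomial_ratio m n k"
    proof (cases "k = n")
      case True
      have "coeff p n = 1"
        using coeff_prod_linear_power[of "{1..n}" "\<lambda>i. - z i" "\<lambda>_. 1" "\<lambda>_. 1"] by (simp add: p_def)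
      then show ?thesis using True by (simp add: binomial_ratio_top[OF m])
    next
      case False
      then have "n - k \<in> {1..n}" "n - (n - k) = k" using k by auto
      then show ?thesis using * by metis
    qed
  qed auto
  then show ?thesis
    using equilibrium_iff_coeffs[OF m inj z1] e by (simp add: p_def)
qed

text \<open>The polynomial is palindromic, so inversion permutes its roots, and (w + 1) / (w - 1)
  changes sign under inversion.\<close>

lemma equilibrium_odd_power_sum:
  assumes m: "1 \<le> m" and inj: "inj_on z {1..n}"
    and z01: "\<And>i. i \<in> {1..n} \<Longrightarrow> z i \<noteq> 1 \<and> z i \<noteq> 0"
    and eq: "equilibrium m n z" and "odd k"
  shows "(\<Sum>i\<in>{1..n}. ((z i + 1) / (z i - 1)) ^ k) = 0"
proof -
  define p where "p = (\<Prod>i\<in>{1..n}. [:- z i, 1:])"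
  define Z where "Z = z ` {1..n}"
  define g where "g = (\<lambda>w::complex. ((w + 1) / (w - 1)) ^ k)"
  have deg: "Polynomial.degree p = n" unfolding p_def by (subst degree_prod_eq_sum_degree) auto
  have coeffs: "coeff p j = binomial_ratio m n j" if "j \<le> n" for j
    using equilibrium_iff_coeffs[OF m inj] z01 eq that by (auto simp: p_def)
  have "reflect_poly p = p"
    by (rule poly_eqI) (auto simp: coeff_reflect_poly deg coeffs binomial_ratio_sym[OF m] coeff_eq_0)
  then have palindromic: "poly p w = w ^ n * poly p (inverse w)" if "w \<noteq> 0" for w
    using poly_reflect_poly_nz[OF that, of p] deg by simp
  have roots: "w \<in> Z \<longleftrightarrow> poly p w = 0" for w
    by (auto simp: Z_def p_def poly_prod prod_zero_iff)
  have Z0: "w \<noteq> 0" "w \<noteq> 1" if "w \<in> Z" for w using that z01 by (auto simp: Z_def)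
  have inv: "inverse w \<in> Z" if "w \<in> Z" for w
    using that Z0[OF that] palindromic[of w] by (simp add: roots)
  have "bij_betw inverse Z Z"
    by (rule bij_betwI[where g = inverse]) (use inv in auto)
  then have "sum g Z = (\<Sum>w\<in>Z. g (inverse w))"
    by (rule sum.reindex_bij_betw[symmetric])
  also have "\<dots> = (\<Sum>w\<in>Z. - g w)"
  proof (rule sum.cong[OF refl])
    fix w assume "w \<in> Z"
    then have w: "w \<noteq> 0" "w - 1 \<noteq> 0" "1 - w \<noteq> 0" using Z0 by auto
    have "(inverse w + 1) / (inverse w - 1) = - ((w + 1) / (w - 1))"
      using w by (simp add: divide_simps) (simp add: algebra_simps)
    then show "g (inverse w) = - g w" using \<open>odd k\<close> by (simp add: g_def)
  qed
  also have "\<dots> = - sum g Z" by (rule sum_negf)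
  finally have "sum g Z = 0" by simp
  then show ?thesis unfolding Z_def g_def sum.reindex[OF inj] comp_def .
qed

subsection \<open>Normal form of the configuration\<close>

lemma perp_smult: "perp (c *s v) = c *s perp v"
  by (simp add: perp_def vec_eq_iff forall_2)

lemma proportional_imp_cbil_perp:
  assumes "proportional u v"
  shows "cbil u (perp v) = 0"
  using assms unfolding proportional_def by (auto simp: perp_smult cbil_simps)

lemma cbil_unit_vec:
  "cbil (unit_vec b) (unit_vec a) = cos (b - a)"
  "cbil (unit_vec b) (perp (unit_vec a)) = sin (b - a)"
  by (simp_all add: cbil_def unit_vec_def perp_def cos_diff sin_diff)

lemma exp_2_ii: "exp (2 * \<i> * c) = exp (\<i> * c) * exp (\<i> * c)"
  by (simp add: mult.assoc flip: exp_add)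

lemma exp_ii_diff:
  "exp (\<i> * (b - a)) = exp (\<i> * b) / exp (\<i> * a)"
  "exp (- (\<i> * (b - a))) = exp (\<i> * a) / exp (\<i> * b)"
  by (simp_all add: right_diff_distrib exp_diff exp_minus)

lemma cot_unit_vec:
  "cbil (unit_vec b) (unit_vec a) / cbil (unit_vec b) (perp (unit_vec a)) =
     \<i> * ((exp (2 * \<i> * b) + exp (2 * \<i> * a)) / (exp (2 * \<i> * b) - exp (2 * \<i> * a)))"
proof -
  define u where "u = exp (\<i> * a)"
  define v where "v = exp (\<i> * b)"
  have nz: "u \<noteq> 0" "v \<noteq> 0" by (simp_all add: u_def v_def)
  have "cos (b - a) = (v / u + u / v) / 2"
    unfolding cos_exp_eq exp_ii_diff u_def v_def ..
  also have "\<dots> = (v * v + u * u) / (2 * u * v)"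
    using nz by (simp add: field_simps)
  finally have 1: "cos (b - a) = (v * v + u * u) / (2 * u * v)" .
  have "sin (b - a) = (v / u - u / v) / (2 * \<i>)"
    unfolding sin_exp_eq exp_ii_diff u_def v_def ..
  also have "\<dots> = (v * v - u * u) / (2 * \<i> * u * v)"
    using nz by (simp add: field_simps)
  finally have 2: "sin (b - a) = (v * v - u * u) / (2 * \<i> * u * v)" .
  have "(v * v + u * u) / (2 * u * v) / ((v * v - u * u) / (2 * \<i> * u * v)) =
      \<i> * ((v * v + u * u) / (v * v - u * u))"
    using nz by simp
  then show ?thesis
    unfolding cbil_unit_vec 1 2 exp_2_ii u_def v_def .
qed

lemma exp_neq_of_cbil_perp:
  assumes "cbil (unit_vec b) (perp (unit_vec a)) \<noteq> 0"
  shows "exp (2 * \<i> * b) \<noteq> exp (2 * \<i> * a)"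
proof
  assume "exp (2 * \<i> * b) = exp (2 * \<i> * a)"
  then have "exp (\<i> * b) / exp (\<i> * a) = exp (\<i> * a) / exp (\<i> * b)"
    unfolding exp_2_ii by (simp add: frac_eq_eq)
  then have "sin (b - a) = 0" unfolding sin_exp_eq exp_ii_diff by simp
  then show False using assms by (simp add: cbil_unit_vec)
qed

lemma exp_eq_1_of_unit_vec:
  assumes "unit_vec \<theta> = vector [1, 0]"
  shows "exp (2 * \<i> * \<theta>) = 1"
proof -
  have "cos \<theta> = 1" "sin \<theta> = 0"
    using assms by (auto simp: unit_vec_def vec_eq_iff forall_2)
  then have "exp (\<i> * \<theta>) = 1" by (simp add: exp_Euler)
  then show ?thesis by (simp only: exp_2_ii mult_1_right)
qed

text \<open>The two factors of v_1^2 + v_2^2 = 1 over the complex numbers are inverse to each other,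
  so a logarithm of the first one gives a complex angle.\<close>

lemma exists_unit_vec:
  assumes "cbil v v = 1"
  shows "\<exists>\<theta>. unit_vec \<theta> = v"
proof -
  define w where "w = v $ 1 + \<i> * v $ 2"
  have "w * (v $ 1 - \<i> * v $ 2) = 1"
    using assms by (simp add: w_def cbil_def algebra_simps)
  then have w: "w \<noteq> 0" "inverse w = v $ 1 - \<i> * v $ 2" by (auto intro: inverse_unique)
  define \<theta> where "\<theta> = - \<i> * Ln w"
  have "exp (\<i> * \<theta>) = v $ 1 + \<i> * v $ 2" "exp (- (\<i> * \<theta>)) = v $ 1 - \<i> * v $ 2"
    using w(1) by (simp_all add: \<theta>_def exp_minus w(2)) (simp add: w_def)
  then have "cos \<theta> = v $ 1" "sin \<theta> = v $ 2"
    by (simp_all add: cos_exp_eq sin_exp_eq)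
  then show ?thesis by (intro exI[of _ \<theta>]) (simp add: unit_vec_def vec_eq_iff forall_2)
qed

text \<open>Translates a cotangent sum into an equilibrium expression; index 0 contributes the
  charge \<open>m\<close> at z = 1.\<close>

lemma unit_vec_cot_sum:
  fixes n i :: nat
  assumes z: "\<And>i. z i = exp (2 * \<i> * \<theta> i)" and z0: "z 0 = 1"
    and M: "M 0 = m" "\<And>j. j \<in> {1..n} \<Longrightarrow> M j = 1" and i: "i \<in> {1..n}"
  shows "(\<Sum>j\<in>{0..n} - {i}. of_nat (M j) *
      (cbil (unit_vec (\<theta> j)) (unit_vec (\<theta> i)) / cbil (unit_vec (\<theta> j)) (perp (unit_vec (\<theta> i))))) =
    \<i> * (of_nat m * ((1 + z i) / (1 - z i)) + (\<Sum>j\<in>{1..n} - {i}. (z j + z i) / (z j - z i)))"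
proof -
  have "{0..n} - {i} = insert 0 ({1..n} - {i})" using i by auto
  then have "(\<Sum>j\<in>{0..n} - {i}. of_nat (M j) * (\<i> * ((z j + z i) / (z j - z i)))) =
     of_nat m * (\<i> * ((1 + z i) / (1 - z i))) + (\<Sum>j\<in>{1..n} - {i}. of_nat (M j) * (\<i> * ((z j + z i) / (z j - z i))))"
    by (simp add: M(1) z0)
  also have "(\<Sum>j\<in>{1..n} - {i}. of_nat (M j) * (\<i> * ((z j + z i) / (z j - z i)))) =
     (\<Sum>j\<in>{1..n} - {i}. \<i> * ((z j + z i) / (z j - z i)))"
    by (rule sum.cong) (use M(2) in auto)
  finally show ?thesis
    by (simp only: cot_unit_vec z[symmetric] sum_distrib_left[symmetric] distrib_left mult.left_commute)
qed

section \<open>Invariance of the cotangent conditions under equivalence\<close>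

lemma cbil_orthogonal_matrix:
  fixes T :: "complex^2^2"
  assumes "orthogonal_matrix T"
  shows "cbil (T *v u) (T *v v) = cbil u v"
    and "cbil (T *v u) (perp (T *v v)) = det T * cbil u (perp v)"
    and "det T * det T = 1"
proof -
  have o: "T $ 1 $ 1 * T $ 1 $ 1 + T $ 2 $ 1 * T $ 2 $ 1 = 1"
    "T $ 1 $ 1 * T $ 1 $ 2 + T $ 2 $ 1 * T $ 2 $ 2 = 0"
    "T $ 1 $ 2 * T $ 1 $ 2 + T $ 2 $ 2 * T $ 2 $ 2 = 1"
    using assms unfolding orthogonal_matrix_def
    by (auto simp: vec_eq_iff forall_2 matrix_matrix_mult_def transpose_def mat_def sum_2)
  have "cbil (T *v u) (T *v v) =
      (T $ 1 $ 1 * T $ 1 $ 1 + T $ 2 $ 1 * T $ 2 $ 1) * (u $ 1 * v $ 1)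
      + (T $ 1 $ 1 * T $ 1 $ 2 + T $ 2 $ 1 * T $ 2 $ 2) * (u $ 1 * v $ 2 + u $ 2 * v $ 1)
      + (T $ 1 $ 2 * T $ 1 $ 2 + T $ 2 $ 2 * T $ 2 $ 2) * (u $ 2 * v $ 2)"
    by (simp add: cbil_def matrix_vector_mult_def sum_2 algebra_simps)
  then show "cbil (T *v u) (T *v v) = cbil u v" by (simp add: o cbil_def)
  show "cbil (T *v u) (perp (T *v v)) = det T * cbil u (perp v)"
    by (simp add: cbil_def perp_def matrix_vector_mult_def sum_2 det_2 algebra_simps)
  have "det T * det T = det (transpose T ** T)" by (simp add: det_mul det_transpose)
  then show "det T * det T = 1" using assms by (simp add: orthogonal_matrix_def)
qed

text \<open>Scalars cancel, and the determinant of T is its own inverse: a reflection reverses all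
  angles and changes the sign of every cotangent, which does not affect vanishing sums.\<close>

lemma cot_orthogonal_matrix:
  assumes "orthogonal_matrix T" "a \<noteq> 0" "b \<noteq> 0"
  shows "cbil (a *s (T *v u)) (b *s (T *v v)) / cbil (a *s (T *v u)) (perp (b *s (T *v v))) =
    det T * (cbil u v / cbil u (perp v))"
proof -
  have "det T \<noteq> 0" using cbil_orthogonal_matrix(3)[OF assms(1)] by auto
  then have D: "1 / det T = det T"
    using cbil_orthogonal_matrix(3)[OF assms(1)] by (simp add: divide_eq_eq)
  have "cbil (a *s (T *v u)) (b *s (T *v v)) / cbil (a *s (T *v u)) (perp (b *s (T *v v))) =
      (a * b * cbil u v) / (a * b * (det T * cbil u (perp v)))"
    by (simp only: perp_smult cbil_simps cbil_orthogonal_matrix(1,2)[OF assms(1)] mult.assoc mult.left_commute[of b])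
  also have "\<dots> = (1 / det T) * (cbil u v / cbil u (perp v))"
    using assms(2,3) by simp
  finally show ?thesis unfolding D .
qed

lemma cot_conditions_equivalent:
  assumes eq: "equivalent_configurations A \<mu> B \<nu>" and B: "cot_conditions B \<nu>"
  shows "cot_conditions A \<mu>"
proof -
  obtain T :: "complex^2^2" and r where T: "orthogonal_matrix T" and r: "\<And>\<alpha>. \<alpha> \<in> A \<Longrightarrow> r \<alpha> \<noteq> 0"
    and bij: "bij_betw (\<lambda>\<alpha>. r \<alpha> *s (T *v \<alpha>)) A B"
    and \<nu>: "\<And>\<alpha>. \<alpha> \<in> A \<Longrightarrow> \<nu> (r \<alpha> *s (T *v \<alpha>)) = \<mu> \<alpha>"
    using eq unfolding equivalent_configurations_def by blast
  define h where "h = (\<lambda>\<alpha>. r \<alpha> *s (T *v \<alpha>))"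
  show ?thesis
    unfolding cot_conditions_def
  proof (intro ballI allI impI)
    fix \<alpha> k assume \<alpha>: "\<alpha> \<in> A" and k: "odd k" "k < 2 * \<mu> \<alpha>"
    have hB: "h \<alpha> \<in> B" using bij \<alpha> unfolding h_def bij_betw_def by blast
    have bij': "bij_betw h (A - {\<alpha>}) (B - {h \<alpha>})"
      using bij \<alpha> unfolding h_def by (intro bij_betw_DiffI) (auto simp: bij_betw_def)
    have "0 = (\<Sum>b\<in>B - {h \<alpha>}. of_nat (\<nu> b) * (cbil b (h \<alpha>) / cbil b (perp (h \<alpha>))) ^ k)"
      using B hB k \<nu>[OF \<alpha>] unfolding cot_conditions_def by (simp add: h_def)
    also have "\<dots> = (\<Sum>\<gamma>\<in>A - {\<alpha>}. of_nat (\<nu> (h \<gamma>)) * (cbil (h \<gamma>) (h \<alpha>) / cbil (h \<gamma>) (perp (h \<alpha>))) ^ k)"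
      by (rule sum.reindex_bij_betw[OF bij', symmetric])
    also have "\<dots> = (\<Sum>\<gamma>\<in>A - {\<alpha>}. det T ^ k * (of_nat (\<mu> \<gamma>) * (cbil \<gamma> \<alpha> / cbil \<gamma> (perp \<alpha>)) ^ k))"
    proof (rule sum.cong[OF refl])
      fix \<gamma> assume \<gamma>: "\<gamma> \<in> A - {\<alpha>}"
      have "cbil (h \<gamma>) (h \<alpha>) / cbil (h \<gamma>) (perp (h \<alpha>)) = det T * (cbil \<gamma> \<alpha> / cbil \<gamma> (perp \<alpha>))"
        unfolding h_def by (rule cot_orthogonal_matrix[OF T]) (use r \<alpha> \<gamma> in auto)
      then show "of_nat (\<nu> (h \<gamma>)) * (cbil (h \<gamma>) (h \<alpha>) / cbil (h \<gamma>) (perp (h \<alpha>))) ^ k =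
          det T ^ k * (of_nat (\<mu> \<gamma>) * (cbil \<gamma> \<alpha> / cbil \<gamma> (perp \<alpha>)) ^ k)"
        using \<nu>[of \<gamma>] \<gamma> by (simp only: h_def[symmetric] power_mult_distrib) (simp add: h_def)
    qed
    also have "\<dots> = det T ^ k * (\<Sum>\<gamma>\<in>A - {\<alpha>}. of_nat (\<mu> \<gamma>) * (cbil \<gamma> \<alpha> / cbil \<gamma> (perp \<alpha>)) ^ k)"
      by (simp only: sum_distrib_left)
    finally show "(\<Sum>\<gamma>\<in>A - {\<alpha>}. of_nat (\<mu> \<gamma>) * (cbil \<gamma> \<alpha> / cbil \<gamma> (perp \<alpha>)) ^ k) = 0"
      using cbil_orthogonal_matrix(3)[OF T] by auto
  qed
qed

text \<open>The vector (1, 0) requires odd powers up to 2m - 1, supplied by the symmetry of the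
  roots; every other vector requires only the first power, which is its equilibrium
  equation.\<close>

lemma is_A_m1n_cot_conditions:
  assumes m: "1 \<le> m" and B: "is_A_m1n m n B \<nu>"
  shows "cot_conditions B \<nu>"
proof -
  obtain \<theta> :: "nat \<Rightarrow> complex" where conf: "configuration_of_type m n B \<nu>"
    and \<theta>0: "unit_vec (\<theta> 0) = vector [1, 0]" and B_eq: "B = (\<lambda>s. unit_vec (\<theta> s)) ` {0..n}"
    and \<nu>0: "\<nu> (unit_vec (\<theta> 0)) = m" and \<nu>1: "\<And>s. s \<in> {1..n} \<Longrightarrow> \<nu> (unit_vec (\<theta> s)) = 1"
    and es: "\<forall>k\<in>{1..n}. elem_sym n k (\<lambda>s. exp (2 * \<i> * \<theta> s)) =
           (-1) ^ k * of_nat (n choose k) * of_nat ((m + k - 1) choose k) / of_nat ((m + n - 1) choose k)"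
    using B unfolding is_A_m1n_def by blast
  define U where "U = (\<lambda>s. unit_vec (\<theta> s))"
  define z where "z = (\<lambda>s. exp (2 * \<i> * \<theta> s))"
  \<comment> \<open>The cardinality n + 1 forces the vectors listed by the angles to be
    distinct.\<close>
  have "card (U ` {0..n}) = card {0..n}"
    using conf B_eq by (simp add: configuration_of_type_def U_def)
  then have injU: "inj_on U {0..n}" by (rule eq_card_imp_inj_on[rotated]) simp
  have pw: "pairwise (\<lambda>u v. \<not> proportional u v) B" and iso: "\<And>b. b \<in> B \<Longrightarrow> cbil b b \<noteq> 0"
    using conf by (auto simp: configuration_of_type_def configuration_def)
  have zne: "z j \<noteq> z i" if "i \<in> {0..n}" "j \<in> {0..n}" "i \<noteq> j" for i j
  proof -
    have "U j \<noteq> U i" using injU that by (auto dest: inj_onD)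
    then have "cbil (U j) (perp (U i)) \<noteq> 0"
      using pw iso that by (intro cbil_perp_neq_0) (auto simp: B_eq U_def pairwise_def)
    then show ?thesis unfolding U_def z_def by (rule exp_neq_of_cbil_perp)
  qed
  have z0: "z 0 = 1" unfolding z_def by (rule exp_eq_1_of_unit_vec[OF \<theta>0])
  have inj: "inj_on z {1..n}"
  proof (rule inj_onI, rule ccontr)
    fix i j assume "i \<in> {1..n}" "j \<in> {1..n}" "z i = z j" "i \<noteq> j"
    then show False using zne[of j i] by simp
  qed
  have z1: "z i \<noteq> 1" if "i \<in> {1..n}" for i using zne[of 0 i] that z0 by auto
  have znz: "z i \<noteq> 0" for i by (simp add: z_def)
  have equi: "equilibrium m n z"
    using equilibrium_iff_elem_sym[OF m inj z1] es by (simp add: z_def)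
  have sum_eq: "(\<Sum>\<gamma>\<in>B - {U i}. of_nat (\<nu> \<gamma>) * (cbil \<gamma> (U i) / cbil \<gamma> (perp (U i))) ^ k) =
      (\<Sum>j\<in>{0..n} - {i}. of_nat (\<nu> (U j)) * (cbil (U j) (U i) / cbil (U j) (perp (U i))) ^ k)"
    if "i \<in> {0..n}" for i k
  proof -
    have "B - {U i} = U ` ({0..n} - {i})"
      using inj_on_image_set_diff[OF injU, of "{0..n}" "{i}"] that by (simp add: B_eq U_def)
    moreover have "inj_on U ({0..n} - {i})" using injU by (rule inj_on_subset) auto
    ultimately show ?thesis by (simp add: sum.reindex)
  qed
  show ?thesis
    unfolding cot_conditions_def
  proof (intro ballI allI impI)
    fix \<alpha> k assume "\<alpha> \<in> B" and k: "odd k" "k < 2 * \<nu> \<alpha>"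
    then obtain i where i: "i \<in> {0..n}" "\<alpha> = U i" by (auto simp: B_eq U_def)
    show "(\<Sum>\<gamma>\<in>B - {\<alpha>}. of_nat (\<nu> \<gamma>) * (cbil \<gamma> \<alpha> / cbil \<gamma> (perp \<alpha>)) ^ k) = 0"
    proof (cases "i = 0")
      case True
      have "{0..n} - {0} = {1..n}" by auto
      then have "(\<Sum>\<gamma>\<in>B - {\<alpha>}. of_nat (\<nu> \<gamma>) * (cbil \<gamma> \<alpha> / cbil \<gamma> (perp \<alpha>)) ^ k) =
          (\<Sum>j\<in>{1..n}. of_nat (\<nu> (U j)) * (cbil (U j) (U 0) / cbil (U j) (perp (U 0))) ^ k)"
        using sum_eq[of 0 k] i True by simp
      also have "\<dots> = (\<Sum>j\<in>{1..n}. \<i> ^ k * ((z j + 1) / (z j - 1)) ^ k)"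
      proof (rule sum.cong[OF refl])
        fix j assume j: "j \<in> {1..n}"
        have "cbil (U j) (U 0) / cbil (U j) (perp (U 0)) = \<i> * ((z j + 1) / (z j - 1))"
          unfolding U_def cot_unit_vec z0[symmetric] unfolding z_def ..
        then show "of_nat (\<nu> (U j)) * (cbil (U j) (U 0) / cbil (U j) (perp (U 0))) ^ k =
            \<i> ^ k * ((z j + 1) / (z j - 1)) ^ k"
          using \<nu>1[OF j] by (simp only: power_mult_distrib U_def of_nat_1 mult_1_left)
      qed
      also have "\<dots> = \<i> ^ k * (\<Sum>j\<in>{1..n}. ((z j + 1) / (z j - 1)) ^ k)"
        by (simp only: sum_distrib_left)
      also have "\<dots> = 0"
        using equilibrium_odd_power_sum[OF m inj _ equi k(1)] z1 znz by simp
      finally show ?thesis .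
    next
      case False
      then have i1: "i \<in> {1..n}" using i by auto
      \<comment> \<open>Multiplicity one leaves a single odd exponent below 2.\<close>
      then have "k = 1" using k i \<nu>1[OF i1] by (simp add: U_def) presburger
      then have "(\<Sum>\<gamma>\<in>B - {\<alpha>}. of_nat (\<nu> \<gamma>) * (cbil \<gamma> \<alpha> / cbil \<gamma> (perp \<alpha>)) ^ k) =
          (\<Sum>j\<in>{0..n} - {i}. of_nat (\<nu> (U j)) * (cbil (U j) (U i) / cbil (U j) (perp (U i))))"
        using sum_eq[OF i(1), of 1] i(2) by simp
      also have "\<dots> = \<i> * (of_nat m * ((1 + z i) / (1 - z i)) + (\<Sum>j\<in>{1..n} - {i}. (z j + z i) / (z j - z i)))"
        unfolding U_def
        by (rule unit_vec_cot_sum[where M = "\<lambda>j. \<nu> (unit_vec (\<theta> j))"]) (use z0 \<nu>0 \<nu>1 i1 in \<open>auto simp: z_def\<close>)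
      also have "\<dots> = 0" using equi i1 unfolding equilibrium_def by simp
      finally show ?thesis .
    qed
  qed
qed

text \<open>Normalising all vectors to square 1 and rotating the distinguished one to (1, 0) gives
  complex angles, for which the cotangent sums are the equilibrium equations and therefore fix the
  elementary symmetric polynomials.\<close>

lemma cot_sums_imp_equivalent:
  assumes m: "1 \<le> m" and conf: "configuration A \<mu>" and cA: "card A = n + 1"
    and \<alpha>0: "\<alpha>0 \<in> A" "\<mu> \<alpha>0 = m" and \<mu>1: "\<And>\<alpha>. \<alpha> \<in> A - {\<alpha>0} \<Longrightarrow> \<mu> \<alpha> = 1"
    and cot: "\<And>\<alpha>. \<alpha> \<in> A - {\<alpha>0} \<Longrightarrow>
      (\<Sum>\<gamma>\<in>A - {\<alpha>}. of_nat (\<mu> \<gamma>) * (cbil \<gamma> \<alpha> / cbil \<gamma> (perp \<alpha>))) = 0"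
  shows "\<exists>B \<nu>. is_A_m1n m n B \<nu> \<and> equivalent_configurations A \<mu> B \<nu>"
proof -
  have fin: "finite A" and pw: "pairwise (\<lambda>u v. \<not> proportional u v) A"
    and iso: "\<And>\<alpha>. \<alpha> \<in> A \<Longrightarrow> cbil \<alpha> \<alpha> \<noteq> 0" and pos: "\<And>\<alpha>. \<alpha> \<in> A \<Longrightarrow> 0 < \<mu> \<alpha>"
    using conf by (auto simp: configuration_def)
  define r where "r = (\<lambda>\<alpha>. 1 / csqrt (cbil \<alpha> \<alpha>))"
  have r0: "r \<alpha> \<noteq> 0" if "\<alpha> \<in> A" for \<alpha> using iso[OF that] by (simp add: r_def)
  have r2: "r \<alpha> * (r \<alpha> * cbil \<alpha> \<alpha>) = 1" if "\<alpha> \<in> A" for \<alpha>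
    using iso[OF that] power2_csqrt[of "cbil \<alpha> \<alpha>"] by (simp add: r_def power2_eq_square field_simps)
  define e where "e = r \<alpha>0 *s \<alpha>0"
  have e: "e $ 1 * e $ 1 + e $ 2 * e $ 2 = 1"
    using r2[OF \<alpha>0(1)] by (simp add: e_def cbil_def algebra_simps)
  \<comment> \<open>The complex rotation with first row \<open>e\<close>, which takes the unit
    vector \<open>e\<close> to (1, 0).\<close>
  define T :: "complex^2^2" where "T = vector [vector [e $ 1, e $ 2], vector [- e $ 2, e $ 1]]"
  have T: "orthogonal_matrix T"
    unfolding orthogonal_matrix_def T_def
    by (auto simp: vec_eq_iff forall_2 matrix_matrix_mult_def transpose_def mat_def sum_2 e algebra_simps)
  define w where "w = (\<lambda>\<alpha>. r \<alpha> *s (T *v \<alpha>))"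
  have w1: "cbil (w \<alpha>) (w \<alpha>) = 1" if "\<alpha> \<in> A" for \<alpha>
    using r2[OF that] by (simp add: w_def cbil_simps cbil_orthogonal_matrix(1)[OF T])
  have w0: "w \<alpha>0 = vector [1, 0]"
  proof -
    have "w \<alpha>0 = T *v e"
      by (simp add: w_def e_def vec_eq_iff matrix_vector_mult_def sum_2 forall_2 algebra_simps)
    also have "\<dots> = vector [1, 0]"
      using e by (simp add: T_def vec_eq_iff matrix_vector_mult_def sum_2 forall_2)
    finally show ?thesis .
  qed
  have wperp: "cbil (w \<gamma>) (perp (w \<alpha>)) \<noteq> 0" if "\<gamma> \<in> A" "\<alpha> \<in> A" "\<gamma> \<noteq> \<alpha>" for \<gamma> \<alpha>
  proof -
    have "cbil \<gamma> (perp \<alpha>) \<noteq> 0"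
      using pw that iso by (intro cbil_perp_neq_0) (auto simp: pairwise_def)
    moreover have "det T \<noteq> 0" using cbil_orthogonal_matrix(3)[OF T] by auto
    ultimately show ?thesis
      using r0 that by (simp add: w_def perp_smult cbil_simps cbil_orthogonal_matrix(2)[OF T])
  qed
  have injw: "inj_on w A"
    by (rule inj_onI) (metis wperp cbil_perp_self)
  define B where "B = w ` A"
  define \<nu> where "\<nu> = (\<lambda>b. \<mu> (inv_into A w b))"
  have \<nu>: "\<nu> (w \<alpha>) = \<mu> \<alpha>" if "\<alpha> \<in> A" for \<alpha>
    using that injw by (simp add: \<nu>_def)
  have equiv: "equivalent_configurations A \<mu> B \<nu>"
    unfolding equivalent_configurations_def
  proof (intro exI conjI ballI)
    show "bij_betw (\<lambda>\<alpha>. r \<alpha> *s (T *v \<alpha>)) A B"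
      using injw by (simp add: bij_betw_def B_def w_def)
    show "\<nu> (r \<alpha> *s (T *v \<alpha>)) = \<mu> \<alpha>" if "\<alpha> \<in> A" for \<alpha>
      using \<nu>[OF that] by (simp add: w_def)
  qed (use T r0 in auto)
  have confB: "configuration B \<nu>"
    unfolding configuration_def
  proof (intro conjI ballI)
    show "finite B" using fin by (simp add: B_def)
    show "pairwise (\<lambda>u v. \<not> proportional u v) B"
      unfolding pairwise_def B_def using wperp proportional_imp_cbil_perp by blast
    fix b assume "b \<in> B"
    then obtain \<alpha> where "\<alpha> \<in> A" "b = w \<alpha>" by (auto simp: B_def)
    then show "cbil b b \<noteq> 0" "0 < \<nu> b" using w1 \<nu> pos by simp_all
  qed
  have typeB: "configuration_of_type m n B \<nu>"
    unfolding configuration_of_type_def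
  proof (intro conjI confB bexI[of _ "w \<alpha>0"] ballI)
    show "card B = n + 1" using injw cA by (simp add: B_def card_image)
    show "\<nu> (w \<alpha>0) = m" "w \<alpha>0 \<in> B" using \<nu> \<alpha>0 by (simp_all add: B_def)
    fix b assume "b \<in> B - {w \<alpha>0}"
    then obtain \<alpha> where "\<alpha> \<in> A - {\<alpha>0}" "b = w \<alpha>" by (auto simp: B_def)
    then show "\<nu> b = 1" using \<nu> \<mu>1 by simp
  qed
  have "card (A - {\<alpha>0}) = n" using fin \<alpha>0(1) cA by simp
  then obtain f' where f': "bij_betw f' {1..n} (A - {\<alpha>0})"
    using ex_bij_betw_nat_finite_1[of "A - {\<alpha>0}"] fin by auto
  define f where "f = (\<lambda>i. if i = 0 then \<alpha>0 else f' i)"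
  have f0: "f 0 = \<alpha>0" by (simp add: f_def)
  have f1: "f i \<in> A - {\<alpha>0}" if "i \<in> {1..n}" for i
    using f' that by (auto simp: f_def bij_betw_def)
  have bij: "bij_betw f {0..n} A"
  proof -
    have "bij_betw f {1..n} (A - {\<alpha>0})"
      using f' by (rule bij_betw_cong[THEN iffD1, rotated]) (auto simp: f_def)
    then have "bij_betw f ({1..n} \<union> {0}) ((A - {\<alpha>0}) \<union> {\<alpha>0})"
      by (rule bij_betw_combine) (auto simp: f_def)
    moreover have "{1..n} \<union> {0} = {0..n}" "(A - {\<alpha>0}) \<union> {\<alpha>0} = A" using \<alpha>0(1) by auto
    ultimately show ?thesis by simp
  qed
  have fA: "f i \<in> A" if "i \<in> {0..n}" for i using bij that by (auto simp: bij_betw_def)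
  have "\<exists>\<theta>. \<forall>i\<in>{0..n}. unit_vec (\<theta> i) = w (f i)"
    using exists_unit_vec[OF w1[OF fA]] by (intro bchoice) blast
  then obtain \<theta> where \<theta>: "\<And>i. i \<in> {0..n} \<Longrightarrow> unit_vec (\<theta> i) = w (f i)" by blast
  define z where "z = (\<lambda>i. exp (2 * \<i> * \<theta> i))"
  have \<theta>0: "unit_vec (\<theta> 0) = vector [1, 0]" using \<theta>[of 0] f0 w0 by simp
  have z0: "z 0 = 1" unfolding z_def by (rule exp_eq_1_of_unit_vec[OF \<theta>0])
  have zne: "z j \<noteq> z i" if "i \<in> {0..n}" "j \<in> {0..n}" "i \<noteq> j" for i j
  proof -
    have "f j \<noteq> f i" using bij that by (auto simp: bij_betw_def dest: inj_onD)
    then have "cbil (unit_vec (\<theta> j)) (perp (unit_vec (\<theta> i))) \<noteq> 0"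
      using wperp fA that \<theta> by simp
    then show ?thesis unfolding z_def by (rule exp_neq_of_cbil_perp)
  qed
  have inj: "inj_on z {1..n}"
  proof (rule inj_onI, rule ccontr)
    fix i j assume "i \<in> {1..n}" "j \<in> {1..n}" "z i = z j" "i \<noteq> j"
    then show False using zne[of j i] by simp
  qed
  have z1: "z i \<noteq> 1" if "i \<in> {1..n}" for i using zne[of 0 i] that z0 by auto
  have "equilibrium m n z"
    unfolding equilibrium_def
  proof
    fix i assume i: "i \<in> {1..n}"
    have bij': "bij_betw f ({0..n} - {i}) (A - {f i})"
      using bij i by (intro bij_betw_DiffI) (auto simp: bij_betw_def)
    \<comment> \<open>The sum is zero, so a factor may be inserted; \<open>det T\<close> is the one
      by which T changes each cotangent.\<close>
    have "0 = det T * (\<Sum>\<gamma>\<in>A - {f i}. of_nat (\<mu> \<gamma>) * (cbil \<gamma> (f i) / cbil \<gamma> (perp (f i))))"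
      using cot[OF f1[OF i]] by simp
    also have "\<dots> = det T * (\<Sum>j\<in>{0..n} - {i}. of_nat (\<mu> (f j)) * (cbil (f j) (f i) / cbil (f j) (perp (f i))))"
      by (subst sum.reindex_bij_betw[OF bij', symmetric]) simp
    also have "\<dots> = (\<Sum>j\<in>{0..n} - {i}. of_nat (\<mu> (f j)) *
        (cbil (unit_vec (\<theta> j)) (unit_vec (\<theta> i)) / cbil (unit_vec (\<theta> j)) (perp (unit_vec (\<theta> i)))))"
      unfolding sum_distrib_left
    proof (rule sum.cong[OF refl])
      fix j assume j: "j \<in> {0..n} - {i}"
      have "cbil (w (f j)) (w (f i)) / cbil (w (f j)) (perp (w (f i))) =
          det T * (cbil (f j) (f i) / cbil (f j) (perp (f i)))"
        unfolding w_def by (rule cot_orthogonal_matrix[OF T]) (use r0 fA i j in auto)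
      then show "det T * (of_nat (\<mu> (f j)) * (cbil (f j) (f i) / cbil (f j) (perp (f i)))) =
        of_nat (\<mu> (f j)) * (cbil (unit_vec (\<theta> j)) (unit_vec (\<theta> i)) / cbil (unit_vec (\<theta> j)) (perp (unit_vec (\<theta> i))))"
        using \<theta>[of i] \<theta>[of j] i j by simp
    qed
    also have "\<dots> = \<i> * (of_nat m * ((1 + z i) / (1 - z i)) + (\<Sum>j\<in>{1..n} - {i}. (z j + z i) / (z j - z i)))"
      by (rule unit_vec_cot_sum[where M = "\<lambda>j. \<mu> (f j)"]) (use z0 f0 \<alpha>0 \<mu>1 f1 i in \<open>auto simp: z_def\<close>)
    finally show "of_nat m * ((1 + z i) / (1 - z i)) + (\<Sum>j\<in>{1..n} - {i}. (z j + z i) / (z j - z i)) = 0"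
      by simp
  qed
  then have es: "\<forall>k\<in>{1..n}. elem_sym n k z = (- 1) ^ k * of_nat (n choose k) * of_nat ((m + k - 1) choose k) / of_nat ((m + n - 1) choose k)"
    using equilibrium_iff_elem_sym[OF m inj z1] by blast
  have B_eq: "B = (\<lambda>s. unit_vec (\<theta> s)) ` {0..n}"
  proof -
    have "A = f ` {0..n}" using bij by (simp add: bij_betw_def)
    then have "B = (\<lambda>s. w (f s)) ` {0..n}" by (simp only: B_def image_image)
    also have "\<dots> = (\<lambda>s. unit_vec (\<theta> s)) ` {0..n}"
      by (rule image_cong) (simp_all add: \<theta>)
    finally show ?thesis .
  qed
  have "is_A_m1n m n B \<nu>"
    unfolding is_A_m1n_def
  proof (intro conjI typeB exI[of _ \<theta>] \<theta>0 B_eq ballI)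
    show "\<nu> (unit_vec (\<theta> 0)) = m" using \<theta>[of 0] f0 \<nu> \<alpha>0 by simp
    show "\<nu> (unit_vec (\<theta> s)) = 1" if "s \<in> {1..n}" for s
      using \<theta>[of s] f1[OF that] that \<nu> \<mu>1 by simp
    show "elem_sym n k (\<lambda>s. exp (2 * \<i> * \<theta> s)) = (-1) ^ k * of_nat (n choose k) * of_nat ((m + k - 1) choose k)
             / of_nat ((m + n - 1) choose k)" if "k \<in> {1..n}" for k
      using es that by (simp add: z_def)
  qed
  with equiv show ?thesis by blast
qed

theorem theorem2p12:
  fixes m n :: nat and A :: "(complex^2) set" and \<mu> :: "complex^2 \<Rightarrow> nat"
  assumes "1 \<le> m" and "1 \<le> n"
    and "configuration_of_type m n A \<mu>"
  shows "admits_BA A \<mu> \<longleftrightarrow>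
    (\<exists>B \<nu>. is_A_m1n m n B \<nu> \<and> equivalent_configurations A \<mu> B \<nu>)"
proof
  from assms(3) obtain \<alpha>0 where conf: "configuration A \<mu>" and cA: "card A = n + 1"
    and \<alpha>0: "\<alpha>0 \<in> A" "\<mu> \<alpha>0 = m" "\<And>\<alpha>. \<alpha> \<in> A - {\<alpha>0} \<Longrightarrow> \<mu> \<alpha> = 1"
    unfolding configuration_of_type_def by blast
  {
    assume BA: "admits_BA A \<mu>"
    show "\<exists>B \<nu>. is_A_m1n m n B \<nu> \<and> equivalent_configurations A \<mu> B \<nu>"
      by (rule cot_sums_imp_equivalent[OF assms(1) conf cA \<alpha>0])
        (use admits_BA_imp_cot_sum[OF conf BA] \<alpha>0(3) in auto)
  next
    assume "\<exists>B \<nu>. is_A_m1n m n B \<nu> \<and> equivalent_configurations A \<mu> B \<nu>"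
    then have "cot_conditions A \<mu>"
      using is_A_m1n_cot_conditions[OF assms(1)] cot_conditions_equivalent by blast
    then show "admits_BA A \<mu>"
      using cot_conditions_imp_admits_BA[OF conf] \<alpha>0(1) by blast
  }
qed

end
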